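(* Let $k$ be an algebraically closed field of characteristic zero, let $G$ be a reductive algebraic group over $k$, and let $X$ be an irreducible affine algebraic variety endowed with a visible action of $G$. Then: (i) the action of $G$ on $X$ is modality-regular; (ii) $\mathrm{mod}(G:X)=\dim X/\!\!/G$; (iii) the induced action of $G$ on every closed $G$-stable subset of $X$ is visible.
   Context: All varieties and actions are algebraic over $k$; topological terms refer to the Zariski topology. For a reductive group $G$ acting on an affine variety $X$, $X/\!\!/G$ denotes the affine variety with coordinate ring $k[X]^G$, and $\pi_{G,X}\colon X\to X/\!\!/G$ is the categorical quotient (induced by $k[X]^G\subseteq k[X]$). The action is called visible if every fiber of $\pi_{G,X}$ contains only finitely many $G$-orbits. Modality. For a connected algebraic group $H$, a family of $H$-orbits is an irreducible algebraic variety $F$ with an $H$-action such that all $H$-orbits in $F$ have the same dimension $d$; put $\mathrm{mod}(H:F):=\dim F-d$. For an algebraic variety $X$ with an action of $H$, let $\mathscr F(X)$ be the set of all locally closed $H$-stable subsets of $X$ which are families, and put $\mathrm{mod}(H:X):=\max_{F\in\mathscr F(X)}\mathrm{mod}(H:F)$. For a not necessarily connected algebraic group $G$ with identity component $G^0$, $\mathrm{mod}(G:X):=\mathrm{mod}(G^0:X)$. For $X$ irreducible, $X^{\rm reg}:=\{x\in X\mid \dim G\cdot x\geqslant\dim G\cdot y \text{ for every } y\in X\}$ (an open dense subset of $X$). The action of $G$ on the irreducible variety $X$ is modality-regular if $\mathrm{mod}(G:X)=\mathrm{mod}(G:X^{\rm reg})$. *)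

theory Defs
  imports
    "HOL-Analysis.Finite_Cartesian_Product"
    "HOL-Analysis.Abstract_Topological_Spaces"
    "HOL-Algebra.Group_Action"
    "HOL-Library.Extended_Nat"
    "HOL-Computational_Algebra.Polynomial"
begin

section \<open>Polynomial functions and regular maps\<close>

text \<open>
  The ground field is a type of class \<^class>\<open>alg_closed_field\<close>; the affine space of dimension
  \<open>n\<close> is the type \<open>'k ^ 'n\<close>. As such a field is infinite, polynomials are identified with polynomial
  functions: the functions generated by the constants and the coordinate functions.
\<close>

inductive_set poly_functions :: "('x \<Rightarrow> 'k::comm_ring_1) set \<Rightarrow> ('x \<Rightarrow> 'k) set"
  for C :: "('x \<Rightarrow> 'k) set" where
  const: "(\<lambda>x. c) \<in> poly_functions C"
| coord: "f \<in> C \<Longrightarrow> f \<in> poly_functions C"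
| add: "\<lbrakk>f \<in> poly_functions C; g \<in> poly_functions C\<rbrakk> \<Longrightarrow> (\<lambda>x. f x + g x) \<in> poly_functions C"
| mult: "\<lbrakk>f \<in> poly_functions C; g \<in> poly_functions C\<rbrakk> \<Longrightarrow> (\<lambda>x. f x * g x) \<in> poly_functions C"

definition coords :: "('k ^ 'n \<Rightarrow> 'k) set" where
  "coords = {(\<lambda>x. x $ i) | i. True}"

definition coords2 :: "(('k ^ 'm) \<times> ('k ^ 'n) \<Rightarrow> 'k) set" where
  "coords2 = {(\<lambda>(x, y). f x) | f. f \<in> coords} \<union> {(\<lambda>(x, y). f y) | f. f \<in> coords}"

definition regular_map ::
  "('x \<Rightarrow> 'k::comm_ring_1) set \<Rightarrow> 'x set \<Rightarrow> ('x \<Rightarrow> 'k ^ 'n) \<Rightarrow> bool" where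
  "regular_map C X f \<longleftrightarrow> (\<forall>i. \<exists>p \<in> poly_functions C. \<forall>x \<in> X. f x $ i = p x)"

section \<open>The Zariski topology\<close>

definition zero_set :: "'x set \<Rightarrow> ('x \<Rightarrow> 'k::comm_ring_1) set \<Rightarrow> 'x set" where
  "zero_set X S = {x \<in> X. \<forall>f \<in> S. f x = 0}"

definition zariski_topology :: "'x set \<Rightarrow> ('x \<Rightarrow> 'k::idom) set \<Rightarrow> 'x topology" where
  "zariski_topology X A = topology (\<lambda>U. \<exists>S \<subseteq> A. U = X - zero_set X S)"

text \<open>The zero loci are the closed sets of a topology as soon as \<open>A\<close> is closed under products on \<open>X\<close>.\<close>

lemma istopology_zariski:
  fixes A :: "('x \<Rightarrow> 'k::idom) set"
  assumes mult: "\<And>f g. f \<in> A \<Longrightarrow> g \<in> A \<Longrightarrow> \<exists>h \<in> A. \<forall>x \<in> X. h x = f x * g x"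
  shows "istopology (\<lambda>U. \<exists>S \<subseteq> A. U = X - zero_set X S)"
  unfolding istopology_def
proof (intro conjI allI impI)
  fix U V
  assume "\<exists>S \<subseteq> A. U = X - zero_set X S" "\<exists>S \<subseteq> A. V = X - zero_set X S"
  then obtain S T where ST: "S \<subseteq> A" "U = X - zero_set X S" "T \<subseteq> A" "V = X - zero_set X T"
    by blast
  define R where "R = {h \<in> A. \<exists>f \<in> S. \<exists>g \<in> T. \<forall>x \<in> X. h x = f x * g x}"
  have "zero_set X R = zero_set X S \<union> zero_set X T"
  proof (intro equalityI subsetI)
    fix x assume x: "x \<in> zero_set X R"
    show "x \<in> zero_set X S \<union> zero_set X T"
    proof (rule ccontr)
      assume "\<not> ?thesis"
      then obtain f g where fg: "f \<in> S" "g \<in> T" "f x \<noteq> 0" "g x \<noteq> 0" "x \<in> X"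
        using x by (auto simp: zero_set_def)
      then obtain h where h: "h \<in> A" "\<forall>x \<in> X. h x = f x * g x"
        using mult ST by blast
      then have "h \<in> R" using fg by (auto simp: R_def)
      then have "h x = 0" using x by (simp add: zero_set_def)
      then show False using fg h by simp
    qed
  qed (auto simp: R_def zero_set_def)
  then have "U \<inter> V = X - zero_set X R" using ST by auto
  moreover have "R \<subseteq> A" by (auto simp: R_def)
  ultimately show "\<exists>S \<subseteq> A. U \<inter> V = X - zero_set X S" by blast
next
  fix \<U> assume "\<forall>U \<in> \<U>. \<exists>S \<subseteq> A. U = X - zero_set X S"
  then obtain s where s: "\<And>U. U \<in> \<U> \<Longrightarrow> s U \<subseteq> A \<and> U = X - zero_set X (s U)" by metis
  have "\<Union>\<U> = X - zero_set X (\<Union>(s ` \<U>))"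
    using s by (fastforce simp: zero_set_def)
  moreover have "\<Union>(s ` \<U>) \<subseteq> A" using s by blast
  ultimately show "\<exists>S \<subseteq> A. \<Union>\<U> = X - zero_set X S" by blast
qed

lemma closedin_zariski_topology:
  fixes A :: "('x \<Rightarrow> 'k::idom) set"
  assumes mult: "\<And>f g. f \<in> A \<Longrightarrow> g \<in> A \<Longrightarrow> \<exists>h \<in> A. \<forall>x \<in> X. h x = f x * g x"
    and one: "\<exists>f \<in> A. \<forall>x \<in> X. f x = 1"
  shows "topspace (zariski_topology X A) = X"
    and "closedin (zariski_topology X A) Z \<longleftrightarrow> (\<exists>S \<subseteq> A. Z = zero_set X S)"
proof -
  have op: "openin (zariski_topology X A) U \<longleftrightarrow> (\<exists>S \<subseteq> A. U = X - zero_set X S)" for U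
    unfolding zariski_topology_def by (subst topology_inverse'[OF istopology_zariski[OF mult]]) auto
  obtain u where "u \<in> A" "\<forall>x \<in> X. u x = 1" using one by blast
  then have u: "{u} \<subseteq> A" "X = X - zero_set X {u}" by (auto simp: zero_set_def)
  have opX: "openin (zariski_topology X A) X"
    unfolding op by (rule exI, rule conjI, rule u(1), rule u(2))
  show top: "topspace (zariski_topology X A) = X"
  proof -
    obtain S where "S \<subseteq> A" "topspace (zariski_topology X A) = X - zero_set X S"
      using openin_topspace[of "zariski_topology X A"] unfolding op by (elim exE conjE)
    then show ?thesis using openin_subset[OF opX] by blast
  qed
  show "closedin (zariski_topology X A) Z \<longleftrightarrow> (\<exists>S \<subseteq> A. Z = zero_set X S)"
  proof
    assume "closedin (zariski_topology X A) Z"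
    then obtain S where "Z \<subseteq> X" "S \<subseteq> A" "X - Z = X - zero_set X S"
      unfolding closedin_def top op by (elim exE conjE)
    then have "Z = zero_set X S" by (auto simp: zero_set_def)
    with \<open>S \<subseteq> A\<close> show "\<exists>S \<subseteq> A. Z = zero_set X S" by blast
  next
    assume "\<exists>S \<subseteq> A. Z = zero_set X S"
    then obtain S where S: "S \<subseteq> A" "Z = zero_set X S" by (elim exE conjE)
    show "closedin (zariski_topology X A) Z"
      unfolding closedin_def top op
    proof (intro conjI exI)
      show "Z \<subseteq> X" unfolding S(2) by (auto simp: zero_set_def)
      show "X - Z = X - zero_set X S" by (simp only: S(2))
    qed (fact S(1))
  qed
qed

abbreviation zariski :: "('k::idom ^ 'n) topology" where
  "zariski \<equiv> zariski_topology UNIV (poly_functions coords)"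

lemma closedin_zariski:
  "topspace (zariski :: ('k::idom ^ 'n) topology) = UNIV"
  "closedin zariski (Z :: ('k ^ 'n) set) \<longleftrightarrow> (\<exists>S \<subseteq> poly_functions coords. Z = zero_set UNIV S)"
proof -
  have m: "\<exists>h \<in> poly_functions coords. \<forall>x \<in> UNIV. h x = f x * g x"
    if fg: "f \<in> poly_functions coords" "g \<in> poly_functions coords" for f g :: "'k ^ 'n \<Rightarrow> 'k"
    by (rule bexI[OF _ poly_functions.mult[OF fg]]) simp
  have o: "\<exists>f \<in> poly_functions (coords :: ('k ^ 'n \<Rightarrow> 'k) set). \<forall>x \<in> UNIV. f x = 1"
    by (rule bexI[OF _ poly_functions.const]) simp
  show "topspace (zariski :: ('k ^ 'n) topology) = UNIV"
    by (rule closedin_zariski_topology(1)[OF m o])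
  show "closedin zariski (Z :: ('k ^ 'n) set) \<longleftrightarrow> (\<exists>S \<subseteq> poly_functions coords. Z = zero_set UNIV S)"
    by (rule closedin_zariski_topology(2)[OF m o])
qed

definition irreducible_in :: "'x topology \<Rightarrow> 'x set \<Rightarrow> bool" where
  "irreducible_in T Z \<longleftrightarrow> Z \<noteq> {} \<and> Z \<subseteq> topspace T \<and>
     (\<forall>A B. closedin T A \<and> closedin T B \<and> Z \<subseteq> A \<union> B \<longrightarrow> Z \<subseteq> A \<or> Z \<subseteq> B)"

definition locally_closed_in :: "'x topology \<Rightarrow> 'x set \<Rightarrow> bool" where
  "locally_closed_in T Z \<longleftrightarrow> (\<exists>U C. openin T U \<and> closedin T C \<and> Z = U \<inter> C)"

text \<open>
  Krull dimension of a topological space: the supremum of the lengths \<open>n\<close> of strict chains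
  \<open>Z 0 \<subset> Z 1 \<subset> \<dots> \<subset> Z n\<close> of irreducible closed subsets. With values in \<^typ>\<open>enat\<close>,
  the empty space gets dimension 0; this case is never used below.
\<close>

definition krull_dim :: "'x topology \<Rightarrow> enat" where
  "krull_dim T = Sup {enat n | n. \<exists>Z :: nat \<Rightarrow> 'x set.
     (\<forall>i \<le> n. closedin T (Z i) \<and> irreducible_in T (Z i)) \<and> (\<forall>i < n. Z i \<subset> Z (Suc i))}"

abbreviation zariski_dim :: "('k::idom ^ 'n) set \<Rightarrow> enat" where
  "zariski_dim Z \<equiv> krull_dim (subtopology zariski Z)"

definition coord_ring :: "('k::comm_ring_1 ^ 'n) set \<Rightarrow> ('k ^ 'n \<Rightarrow> 'k) set" where
  "coord_ring X = {restrict p X | p. p \<in> poly_functions coords}"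

section \<open>Affine algebraic groups\<close>

definition affine_algebraic_group :: "('k::idom ^ 'm) monoid \<Rightarrow> bool" where
  "affine_algebraic_group G \<longleftrightarrow> group G \<and> closedin zariski (carrier G) \<and>
     regular_map coords2 (carrier G \<times> carrier G) (\<lambda>(g, h). g \<otimes>\<^bsub>G\<^esub> h) \<and>
     regular_map coords (carrier G) (\<lambda>g. inv\<^bsub>G\<^esub> g)"

definition identity_component :: "('k::idom ^ 'm) monoid \<Rightarrow> ('k ^ 'm) monoid" where
  "identity_component G =
     G\<lparr>carrier := connected_component_of_set (subtopology zariski (carrier G)) \<one>\<^bsub>G\<^esub>\<rparr>"

text \<open>
  An element \<open>g\<close> is unipotent if the right translation \<open>\<rho> g\<close> of the coordinate ring,
  \<open>\<rho> g f = (\<lambda>h. f (h \<otimes> g))\<close>, is locally unipotent: every \<open>f\<close> is killed by a power of \<open>\<rho> g - id\<close>.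
\<close>

definition unipotent_element :: "('k::idom ^ 'm) monoid \<Rightarrow> 'k ^ 'm \<Rightarrow> bool" where
  "unipotent_element G g \<longleftrightarrow> g \<in> carrier G \<and>
     (\<forall>f \<in> coord_ring (carrier G). \<exists>n.
        ((\<lambda>f. \<lambda>h \<in> carrier G. f (h \<otimes>\<^bsub>G\<^esub> g) - f h) ^^ n) f = (\<lambda>h \<in> carrier G. 0))"

text \<open>
  Reductive means that the unipotent radical, the largest closed connected normal unipotent subgroup,
  is trivial. The group need not be connected.
\<close>

definition reductive_group :: "('k::idom ^ 'm) monoid \<Rightarrow> bool" where
  "reductive_group G \<longleftrightarrow> affine_algebraic_group G \<and>
     (\<forall>U. U \<lhd> G \<and> closedin zariski U \<and> connectedin zariski U \<and> (\<forall>u \<in> U. unipotent_element G u)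
        \<longrightarrow> U = {\<one>\<^bsub>G\<^esub>})"

definition algebraic_action ::
  "('k::idom ^ 'm) monoid \<Rightarrow> ('k ^ 'n) set \<Rightarrow> ('k ^ 'm \<Rightarrow> 'k ^ 'n \<Rightarrow> 'k ^ 'n) \<Rightarrow> bool" where
  "algebraic_action G X \<phi> \<longleftrightarrow> group_action G X \<phi> \<and>
     regular_map coords2 (carrier G \<times> X) (\<lambda>(g, x). \<phi> g x)"

definition stable ::
  "('k ^ 'm) monoid \<Rightarrow> ('k ^ 'm \<Rightarrow> 'k ^ 'n \<Rightarrow> 'k ^ 'n) \<Rightarrow> ('k ^ 'n) set \<Rightarrow> bool" where
  "stable G \<phi> F \<longleftrightarrow> (\<forall>g \<in> carrier G. \<phi> g ` F \<subseteq> F)"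

text \<open>The restriction to \<open>Z\<close> makes the induced action a \<^locale>\<open>group_action\<close>
  (which requires extensional functions).\<close>

definition induced_action ::
  "('k ^ 'm \<Rightarrow> 'k ^ 'n \<Rightarrow> 'k ^ 'n) \<Rightarrow> ('k ^ 'n) set \<Rightarrow> 'k ^ 'm \<Rightarrow> 'k ^ 'n \<Rightarrow> 'k ^ 'n" where
  "induced_action \<phi> Z = (\<lambda>g. restrict (\<phi> g) Z)"

section \<open>The categorical quotient\<close>

definition invariant_ring ::
  "('k::comm_ring_1 ^ 'm) monoid \<Rightarrow> ('k ^ 'n) set \<Rightarrow> ('k ^ 'm \<Rightarrow> 'k ^ 'n \<Rightarrow> 'k ^ 'n)
     \<Rightarrow> ('k ^ 'n \<Rightarrow> 'k) set" where
  "invariant_ring G X \<phi> = {f \<in> coord_ring X. \<forall>g \<in> carrier G. \<forall>x \<in> X. f (\<phi> g x) = f x}"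

text \<open>
  The variety with coordinate ring \<open>A\<close>, for a \<open>k\<close>-algebra \<open>A\<close> of functions on \<open>X\<close>: its points are the
  \<open>k\<close>-algebra homomorphisms from \<open>A\<close> to \<open>k\<close> (for finitely generated \<open>A\<close> equivalently,
  the maximal ideals), and an element
  \<open>f\<close> of \<open>A\<close> is the function \<open>h \<mapsto> h f\<close> on them. Extensionality makes the points unique as functions on
  all of \<open>'x \<Rightarrow> 'k\<close>.
\<close>

definition spectrum :: "'x set \<Rightarrow> ('x \<Rightarrow> 'k::comm_ring_1) set \<Rightarrow> (('x \<Rightarrow> 'k) \<Rightarrow> 'k) set" where
  "spectrum X A = {h \<in> extensional A.
     (\<forall>c. h (\<lambda>x \<in> X. c) = c) \<and>
     (\<forall>f \<in> A. \<forall>g \<in> A. h (\<lambda>x \<in> X. f x + g x) = h f + h g \<and> h (\<lambda>x \<in> X. f x * g x) = h f * h g)}"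

definition spectrum_topology ::
  "'x set \<Rightarrow> ('x \<Rightarrow> 'k::idom) set \<Rightarrow> (('x \<Rightarrow> 'k) \<Rightarrow> 'k) topology" where
  "spectrum_topology X A = zariski_topology (spectrum X A) {(\<lambda>h. h f) | f. f \<in> A}"

definition quotient_space ::
  "('k::idom ^ 'm) monoid \<Rightarrow> ('k ^ 'n) set \<Rightarrow> ('k ^ 'm \<Rightarrow> 'k ^ 'n \<Rightarrow> 'k ^ 'n)
     \<Rightarrow> (('k ^ 'n \<Rightarrow> 'k) \<Rightarrow> 'k) topology" where
  "quotient_space G X \<phi> = spectrum_topology X (invariant_ring G X \<phi>)"

definition quotient_map_to ::
  "('k::idom ^ 'm) monoid \<Rightarrow> ('k ^ 'n) set \<Rightarrow> ('k ^ 'm \<Rightarrow> 'k ^ 'n \<Rightarrow> 'k ^ 'n)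
     \<Rightarrow> 'k ^ 'n \<Rightarrow> (('k ^ 'n \<Rightarrow> 'k) \<Rightarrow> 'k)" where
  "quotient_map_to G X \<phi> x = (\<lambda>f \<in> invariant_ring G X \<phi>. f x)"

lemma invariant_ring_closed:
  assumes "algebraic_action G X \<phi>"
  shows "(\<lambda>x \<in> X. c) \<in> invariant_ring G X \<phi>"
    and "\<lbrakk>f \<in> invariant_ring G X \<phi>; g \<in> invariant_ring G X \<phi>\<rbrakk>
           \<Longrightarrow> (\<lambda>x \<in> X. f x + g x) \<in> invariant_ring G X \<phi>"
    and "\<lbrakk>f \<in> invariant_ring G X \<phi>; g \<in> invariant_ring G X \<phi>\<rbrakk>
           \<Longrightarrow> (\<lambda>x \<in> X. f x * g x) \<in> invariant_ring G X \<phi>"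
proof -
  have im: "\<phi> g x \<in> X" if "g \<in> carrier G" "x \<in> X" for g x
    using assms that unfolding algebraic_action_def by (metis group_action.element_image)
  have r: "(\<lambda>x \<in> X. c) \<in> coord_ring X" for c
    unfolding coord_ring_def using poly_functions.const by fastforce
  have s: "(\<lambda>x \<in> X. f x + g x) \<in> coord_ring X \<and> (\<lambda>x \<in> X. f x * g x) \<in> coord_ring X"
    if fg: "f \<in> coord_ring X" "g \<in> coord_ring X" for f g
  proof -
    obtain p q where pq: "p \<in> poly_functions coords" "q \<in> poly_functions coords"
      "f = restrict p X" "g = restrict q X" using fg unfolding coord_ring_def by blast
    then have "(\<lambda>x \<in> X. f x + g x) = restrict (\<lambda>x. p x + q x) X"
      "(\<lambda>x \<in> X. f x * g x) = restrict (\<lambda>x. p x * q x) X" by (auto simp: restrict_def)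
    then show ?thesis unfolding coord_ring_def using poly_functions.add poly_functions.mult pq by blast
  qed
  show "(\<lambda>x \<in> X. c) \<in> invariant_ring G X \<phi>"
    using im r by (simp add: invariant_ring_def)
  show "(\<lambda>x \<in> X. f x + g x) \<in> invariant_ring G X \<phi>" "(\<lambda>x \<in> X. f x * g x) \<in> invariant_ring G X \<phi>"
    if "f \<in> invariant_ring G X \<phi>" "g \<in> invariant_ring G X \<phi>"
    using that im s by (simp_all add: invariant_ring_def)
qed

lemma quotient_space:
  assumes "algebraic_action G X \<phi>"
  shows "topspace (quotient_space G X \<phi>) = spectrum X (invariant_ring G X \<phi>)"
    and "closedin (quotient_space G X \<phi>) Z \<longleftrightarrow> (\<exists>S \<subseteq> invariant_ring G X \<phi>.
           Z = {h \<in> spectrum X (invariant_ring G X \<phi>). \<forall>f \<in> S. h f = 0})"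
    and "quotient_map_to G X \<phi> \<in> X \<rightarrow> topspace (quotient_space G X \<phi>)"
proof -
  let ?A = "invariant_ring G X \<phi>" let ?E = "{(\<lambda>h. h f) | f. f \<in> invariant_ring G X \<phi>}"
  note cl = invariant_ring_closed[OF assms]
  have m: "\<exists>h \<in> ?E. \<forall>x \<in> spectrum X ?A. h x = f x * g x" if fg: "f \<in> ?E" "g \<in> ?E" for f g
  proof -
    obtain a b where ab: "a \<in> ?A" "b \<in> ?A" "f = (\<lambda>h. h a)" "g = (\<lambda>h. h b)"
      using fg by blast
    show ?thesis
    proof (rule bexI)
      show "\<forall>h \<in> spectrum X ?A. h (\<lambda>x \<in> X. a x * b x) = f h * g h"
        using ab by (simp add: spectrum_def)
      show "(\<lambda>h. h (\<lambda>x \<in> X. a x * b x)) \<in> ?E" using cl(3) ab(1,2) by blast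
    qed
  qed
  have o: "\<exists>f \<in> ?E. \<forall>x \<in> spectrum X ?A. f x = 1"
  proof (rule bexI)
    show "\<forall>h \<in> spectrum X ?A. h (\<lambda>x \<in> X. 1) = 1" by (simp add: spectrum_def)
    show "(\<lambda>h. h (\<lambda>x \<in> X. 1)) \<in> ?E" using cl(1) by blast
  qed
  show top: "topspace (quotient_space G X \<phi>) = spectrum X ?A"
    unfolding quotient_space_def spectrum_topology_def using closedin_zariski_topology(1)[OF m o] .
  have "closedin (quotient_space G X \<phi>) Z \<longleftrightarrow> (\<exists>S \<subseteq> ?E. Z = zero_set (spectrum X ?A) S)"
    unfolding quotient_space_def spectrum_topology_def using closedin_zariski_topology(2)[OF m o] .
  also have "\<dots> \<longleftrightarrow> (\<exists>S \<subseteq> ?A. Z = zero_set (spectrum X ?A) ((\<lambda>f h. h f) ` S))"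
  proof (intro iffI; elim exE conjE)
    fix S assume S: "S \<subseteq> ?E" "Z = zero_set (spectrum X ?A) S"
    then have "S = (\<lambda>f h. h f) ` {f \<in> ?A. (\<lambda>h. h f) \<in> S}" by blast
    with S(2) have "Z = zero_set (spectrum X ?A) ((\<lambda>f h. h f) ` {f \<in> ?A. (\<lambda>h. h f) \<in> S})"
      by simp
    then show "\<exists>S \<subseteq> ?A. Z = zero_set (spectrum X ?A) ((\<lambda>f h. h f) ` S)"
      by (intro exI conjI) auto
  next
    fix S assume S: "S \<subseteq> ?A" "Z = zero_set (spectrum X ?A) ((\<lambda>f h. h f) ` S)"
    show "\<exists>S \<subseteq> ?E. Z = zero_set (spectrum X ?A) S"
      using S by (intro exI[of _ "(\<lambda>f h. h f) ` S"]) auto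
  qed
  finally show "closedin (quotient_space G X \<phi>) Z \<longleftrightarrow> (\<exists>S \<subseteq> ?A.
           Z = {h \<in> spectrum X ?A. \<forall>f \<in> S. h f = 0})" by (simp add: zero_set_def)
  show "quotient_map_to G X \<phi> \<in> X \<rightarrow> topspace (quotient_space G X \<phi>)"
    unfolding top spectrum_def quotient_map_to_def using cl by auto
qed

definition visible ::
  "('k::idom ^ 'm) monoid \<Rightarrow> ('k ^ 'n) set \<Rightarrow> ('k ^ 'm \<Rightarrow> 'k ^ 'n \<Rightarrow> 'k ^ 'n) \<Rightarrow> bool" where
  "visible G X \<phi> \<longleftrightarrow> (\<forall>y \<in> topspace (quotient_space G X \<phi>).
     finite (orbits G {x \<in> X. quotient_map_to G X \<phi> x = y} \<phi>))"

section \<open>Modality\<close>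

definition is_family ::
  "('k::idom ^ 'm) monoid \<Rightarrow> ('k ^ 'm \<Rightarrow> 'k ^ 'n \<Rightarrow> 'k ^ 'n) \<Rightarrow> ('k ^ 'n) set \<Rightarrow> bool" where
  "is_family H \<phi> F \<longleftrightarrow> irreducible_in zariski F \<and> (\<exists>d. \<forall>x \<in> F. zariski_dim (orbit H \<phi> x) = d)"

definition families ::
  "('k::idom ^ 'm) monoid \<Rightarrow> ('k ^ 'm \<Rightarrow> 'k ^ 'n \<Rightarrow> 'k ^ 'n) \<Rightarrow> ('k ^ 'n) set \<Rightarrow> ('k ^ 'n) set set" where
  "families H \<phi> X = {F. F \<subseteq> X \<and> locally_closed_in (subtopology zariski X) F \<and> stable H \<phi> F \<and>
     is_family H \<phi> F}"

definition family_modality ::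
  "('k::idom ^ 'm) monoid \<Rightarrow> ('k ^ 'm \<Rightarrow> 'k ^ 'n \<Rightarrow> 'k ^ 'n) \<Rightarrow> ('k ^ 'n) set \<Rightarrow> enat" where
  "family_modality H \<phi> F = zariski_dim F - (THE d. \<forall>x \<in> F. zariski_dim (orbit H \<phi> x) = d)"

text \<open>All dimensions involved are bounded by that of the ambient affine space, so for nonempty \<open>X\<close>
  the supremum is a maximum.\<close>

definition modality ::
  "('k::idom ^ 'm) monoid \<Rightarrow> ('k ^ 'm \<Rightarrow> 'k ^ 'n \<Rightarrow> 'k ^ 'n) \<Rightarrow> ('k ^ 'n) set \<Rightarrow> enat" where
  "modality G \<phi> X = (SUP F \<in> families (identity_component G) \<phi> X.
     family_modality (identity_component G) \<phi> F)"

definition regular_locus ::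
  "('k::idom ^ 'm) monoid \<Rightarrow> ('k ^ 'm \<Rightarrow> 'k ^ 'n \<Rightarrow> 'k ^ 'n) \<Rightarrow> ('k ^ 'n) set \<Rightarrow> ('k ^ 'n) set" where
  "regular_locus G \<phi> X =
     {x \<in> X. \<forall>y \<in> X. zariski_dim (orbit G \<phi> x) \<ge> zariski_dim (orbit G \<phi> y)}"

definition modality_regular ::
  "('k::idom ^ 'm) monoid \<Rightarrow> ('k ^ 'm \<Rightarrow> 'k ^ 'n \<Rightarrow> 'k ^ 'n) \<Rightarrow> ('k ^ 'n) set \<Rightarrow> bool" where
  "modality_regular G \<phi> X \<longleftrightarrow> modality G \<phi> X = modality G \<phi> (regular_locus G \<phi> X)"

end

(*
  A family F with orbits of dimension d meets each fibre of the quotient map in a finite union of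
  orbits, hence in a set of dimension at most d. Cutting F by suitable level sets of nonconstant
  invariants lowers the dimension by at most one at a time, and the closures of the images of the
  successive sections form a chain of irreducible closed subsets of the quotient. Once all
  invariants are constant at most d dimensions are left, so dim F - d <= dim X//G.

  Conversely, a chain of length n in the quotient yields n algebraically independent invariants.
  They remain independent when one adds functions that are independent on the general orbits, so
  dim X >= n + m for the maximal orbit dimension m; a G-stable open subset of the regular locus is a
  family that realizes this bound, both in X and in the regular locus.

  For a closed stable subset Z, invariants of X restrict to invariants of Z, so each fibre of the
  quotient map of Z lies in a fibre of the quotient map of X.

  Dimensions are measured by algebraic independence of functions. The link with chains of
  irreducible closed sets rests on Chevalley's theorem and Hilbert's basis theorem.
*)

theory Submission
  imports Defs
begin

section \<open>Rings of functions\<close>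

text \<open>Dominant maps do the work of dimension theory. Functions independent on \<open>V\<close>
  map it onto a dense subset of an affine space, and over an algebraically closed field Chevalley's
  theorem puts a nonempty open set into the image. A general level set of one function therefore
  still dominates the space of the others; this stands in for the principal ideal theorem. Fractions
  are avoided by clearing denominators inside rings of functions, where irreducibility of
  \<open>V\<close> permits cancellation. Three obstacles shape the statements. Families are only
  locally closed, so a function \<open>h\<close> that must not vanish identically is carried through
  all sections. Points of the quotient are algebra homomorphisms, which are not known to come from
  points of \<open>X\<close>; hence chains are built from closures of images, and conversely a
  relation between invariants reaches the spectrum as an identity in the invariant ring. Modality
  refers to the identity component but fibres and invariants to the whole group, so the orbit
  dimensions of the two have to be compared.\<close>

lemmas pf_intros = poly_functions.const poly_functions.add poly_functions.mult

lemma pf_sum: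
  "(\<And>i. i \<in> I \<Longrightarrow> f i \<in> poly_functions C) \<Longrightarrow> (\<lambda>x. \<Sum>i\<in>I. f i x) \<in> poly_functions C"
  by (induction I rule: infinite_finite_induct) (auto intro: pf_intros)

lemma pf_power: "f \<in> poly_functions C \<Longrightarrow> (\<lambda>x. f x ^ n) \<in> poly_functions C"
  by (induction n) (auto intro: pf_intros)

lemma pf_uminus:
  assumes "f \<in> poly_functions C"
  shows "(\<lambda>x. - f x) \<in> poly_functions C"
proof -
  have "(\<lambda>x. (-1) * f x) \<in> poly_functions C"
    by (intro pf_intros assms)
  then show ?thesis by simp
qed

lemma pf_diff:
  assumes "f \<in> poly_functions C" "g \<in> poly_functions C"
  shows "(\<lambda>x. f x - g x) \<in> poly_functions C"
  using poly_functions.add[OF assms(1) pf_uminus[OF assms(2)]] by simp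

lemma pf_if: "(P \<Longrightarrow> f \<in> poly_functions C) \<Longrightarrow> (\<not> P \<Longrightarrow> g \<in> poly_functions C) \<Longrightarrow>
    (\<lambda>x. if P then f x else g x) \<in> poly_functions C"
  by (cases P) auto

lemmas pf = pf_intros pf_sum pf_power pf_uminus pf_diff pf_if

lemma pf_comp:
  assumes "f \<in> poly_functions C" "\<And>c. c \<in> C \<Longrightarrow> (\<lambda>x. c (q x)) \<in> poly_functions D"
  shows "(\<lambda>x. f (q x)) \<in> poly_functions D"
  using assms(1) by induction (auto intro: pf assms(2))

lemma pf_least:
  assumes "f \<in> poly_functions C" "C \<subseteq> poly_functions D"
  shows "f \<in> poly_functions D"
  using pf_comp[OF assms(1), of "\<lambda>x. x" D] assms(2) by auto

lemma pf_mono: "C \<subseteq> D \<Longrightarrow> poly_functions C \<subseteq> poly_functions D"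
  using pf_least poly_functions.coord by blast

lemma pf_idem: "poly_functions (poly_functions C) = poly_functions C"
  using pf_least[of _ "poly_functions C" C] poly_functions.coord by blast

text \<open>Products need only be treated when one factor is \<open>g\<close> or a coefficient: the
  induction proves that multiplication by \<open>f\<close> preserves \<open>P\<close>, and the
  constant 1 is then taken as the other factor.\<close>

lemma pf_generator_mult_induct [consumes 1, case_names add coeff gen]:
  assumes "f \<in> poly_functions (insert g C)"
    and add: "\<And>f h. P f \<Longrightarrow> P h \<Longrightarrow> P (\<lambda>x. f x + h x)"
    and coeff: "\<And>f. f \<in> poly_functions C \<Longrightarrow> P f"
    and gen: "\<And>c f. c \<in> insert g (poly_functions C) \<Longrightarrow> P f \<Longrightarrow> P (\<lambda>x. c x * f x)"
  shows "P f"
proof -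
  have "P (\<lambda>x. f x * h x)" if "P h" for h
    using assms(1) that
  proof (induction arbitrary: h)
    case (const c)
    then show ?case using gen[of "\<lambda>x. c" h] poly_functions.const by blast
  next
    case (coord f)
    then show ?case using gen[of f h] poly_functions.coord by blast
  next
    case (add f1 f2)
    then show ?case using assms(2)[of "\<lambda>x. f1 x * h x" "\<lambda>x. f2 x * h x"]
      by (simp add: distrib_right)
  next
    case (mult f1 f2)
    then show ?case by (simp add: mult.assoc)
  qed
  from this[of "\<lambda>x. 1"] show ?thesis
    using coeff[OF poly_functions.const[of 1]] by simp
qed

lemma pf_insert_expand:
  assumes "f \<in> poly_functions (insert g C)"
  obtains c n where "\<forall>i. c i \<in> poly_functions C" "\<forall>x. f x = (\<Sum>i<n. c i x * g x ^ i)"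
proof -
  have "\<exists>n c. (\<forall>i. c i \<in> poly_functions C) \<and> (\<forall>x. f x = (\<Sum>i<n. c i x * g x ^ i))"
    using assms
  proof (induction rule: pf_generator_mult_induct)
    case (add f h)
    then obtain n c m d where cd: "\<forall>i. c i \<in> poly_functions C" "\<forall>x. f x = (\<Sum>i<n. c i x * g x ^ i)"
      "\<forall>i. d i \<in> poly_functions C" "\<forall>x. h x = (\<Sum>i<m. d i x * g x ^ i)" by blast
    note cd = cd[rule_format]
    have e: "(\<Sum>i<k. b i x * g x ^ i) = (\<Sum>i<n+m. (if i < k then b i x else 0) * g x ^ i)"
      if "k \<le> n + m" for k x and b :: "nat \<Rightarrow> 'a \<Rightarrow> 'b"
      by (rule sum.mono_neutral_cong_left) (use that in auto)
    show ?case
      by (rule exI[of _ "n+m"], rule exI[of _ "\<lambda>i x. (if i < n then c i x else 0) + (if i < m then d i x else 0)"])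
        (simp add: cd(2,4) e[of n] e[of m] distrib_right sum.distrib pf cd(1,3))
  next
    case (coeff f)
    show ?case
      by (rule exI[of _ 1], rule exI[of _ "\<lambda>_. f"]) (auto simp: coeff)
  next
    case (gen r f)
    then obtain n c where c: "\<forall>i. c i \<in> poly_functions C" "\<forall>x. f x = (\<Sum>i<n. c i x * g x ^ i)"
      by blast
    note c = c[rule_format]
    show ?case
    proof (cases "r = g")
      case True
      show ?thesis
        by (rule exI[of _ "Suc n"], rule exI[of _ "\<lambda>i x. if i = 0 then 0 else c (i - 1) x"])
          (simp add: True c(2) sum.lessThan_Suc_shift sum_distrib_left mult_ac pf c(1)
            del: sum.lessThan_Suc)
    next
      case False
      then have "r \<in> poly_functions C" using gen by auto
      then show ?thesis
        by (intro exI[of _ n] exI[of _ "\<lambda>i x. r x * c i x"])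
          (simp add: c(2) sum_distrib_left mult_ac pf c(1))
    qed
  qed
  then show ?thesis using that by blast
qed

section \<open>Prime vanishing ideals and linear algebra with functions as coefficients\<close>

definition vanishes :: "'x set \<Rightarrow> ('x \<Rightarrow> 'k::zero) \<Rightarrow> bool" where
  "vanishes V f \<longleftrightarrow> (\<forall>x \<in> V. f x = 0)"

text \<open>For a ring \<open>R\<close>, the functions of \<open>R\<close> that vanish on
  \<open>V\<close> form a prime ideal. With \<open>R = polys\<close> this is irreducibility in the
  Zariski topology; the relative form also serves products and spectra.\<close>

definition irr :: "('x \<Rightarrow> 'k::comm_ring_1) set \<Rightarrow> 'x set \<Rightarrow> bool" where
  "irr R V \<longleftrightarrow> V \<noteq> {} \<and>
     (\<forall>f \<in> R. \<forall>g \<in> R. vanishes V (\<lambda>x. f x * g x) \<longrightarrow> vanishes V f \<or> vanishes V g)"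

lemma irr_mono: "irr R V \<Longrightarrow> S \<subseteq> R \<Longrightarrow> irr S V"
  unfolding irr_def by blast

lemma irr_mult:
  "irr R V \<Longrightarrow> f \<in> R \<Longrightarrow> g \<in> R \<Longrightarrow> \<not> vanishes V f \<Longrightarrow> \<not> vanishes V g \<Longrightarrow> \<not> vanishes V (\<lambda>x. f x * g x)"
  unfolding irr_def by blast

lemma irr_power:
  fixes f :: "'x \<Rightarrow> 'k::comm_ring_1"
  assumes "irr (poly_functions C) V" "f \<in> poly_functions C" "\<not> vanishes V f"
  shows "\<not> vanishes V (\<lambda>x. f x ^ n)"
proof (induction n)
  case 0
  show ?case using assms(1) by (auto simp: vanishes_def irr_def)
next
  case (Suc n)
  then show ?case using irr_mult[OF assms(1,2) _ assms(3)] pf_power[OF assms(2)] by simp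
qed

lemma irr_nontrivial: "irr R V \<Longrightarrow> c \<noteq> 0 \<Longrightarrow> \<not> vanishes V (\<lambda>x. c)"
  by (auto simp: irr_def vanishes_def)

text \<open>The proof is fraction-free Gaussian elimination.\<close>

lemma homogeneous_system_solution:
  fixes a :: "'i \<Rightarrow> 'j \<Rightarrow> 'x \<Rightarrow> 'k::comm_ring_1"
  assumes irr: "irr (poly_functions C) V"
    and "finite J" "finite I" "card J < card I"
    and "\<And>i j. a i j \<in> poly_functions C"
  shows "\<exists>c. (\<forall>i. c i \<in> poly_functions C) \<and> (\<exists>i\<in>I. \<not> vanishes V (c i)) \<and>
    (\<forall>j\<in>J. \<forall>x\<in>V. (\<Sum>i\<in>I. c i x * a i j x) = 0)"
  using assms(2-)
proof (induction J arbitrary: I a rule: finite_induct)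
  case empty
  then obtain i where "i \<in> I" by fastforce
  then show ?case using irr_nontrivial[OF irr, of "1::'k"]
    by (intro exI[of _ "\<lambda>_ _. 1"]) (auto intro: pf)
next
  case (insert k J)
  note a = insert.prems(3)
  show ?case
  proof (cases "\<forall>i\<in>I. vanishes V (a i k)")
    case True
    have "card J < card I" using insert by simp
    from insert.IH[OF insert.prems(1) this, of a, OF a]
    obtain c where "\<forall>i. c i \<in> poly_functions C" "\<exists>i\<in>I. \<not> vanishes V (c i)"
      "\<forall>j\<in>J. \<forall>x\<in>V. (\<Sum>i\<in>I. c i x * a i j x) = 0"
      by blast
    moreover have "\<forall>x\<in>V. (\<Sum>i\<in>I. c i x * a i k x) = 0"
      using True by (auto simp: vanishes_def)
    ultimately show ?thesis by (intro exI[of _ c]) auto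
  next
    case False
    then obtain p where p: "p \<in> I" "\<not> vanishes V (a p k)" by blast
    \<comment> \<open>Row \<open>p\<close> is the pivot. Cross-multiplication with the entry
      \<open>a p k\<close> replaces division, and column \<open>k\<close> of \<open>b\<close> is
      identically zero.\<close>
    define b where "b i j x = a p k x * a i j x - a i k x * a p j x" for i j x
    have "card J < card (I - {p})" using insert p by simp
    moreover have "b i j \<in> poly_functions C" for i j
      unfolding b_def by (intro pf a)
    ultimately obtain c where c: "\<And>i. c i \<in> poly_functions C" "\<exists>i\<in>I-{p}. \<not> vanishes V (c i)"
      "\<And>j x. j \<in> J \<Longrightarrow> x \<in> V \<Longrightarrow> (\<Sum>i\<in>I-{p}. c i x * b i j x) = 0"
      using insert.IH[of "I-{p}" b] insert.prems(1) by blast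
    \<comment> \<open>Back substitution: the solution is scaled by the pivot, and the coefficient at
      \<open>p\<close> is chosen to satisfy equation \<open>k\<close>.\<close>
    define d where "d i = (if i = p then (\<lambda>x. - (\<Sum>i\<in>I-{p}. c i x * a i k x))
      else (\<lambda>x. c i x * a p k x))" for i
    have "d i \<in> poly_functions C" for i
      unfolding d_def by (auto intro!: pf c a)
    moreover obtain i where i: "i \<in> I - {p}" "\<not> vanishes V (c i)" using c(2) by blast
    then have "\<not> vanishes V (d i)"
      using irr_mult[OF irr c(1) a] p(2) by (auto simp: d_def)
    moreover have "(\<Sum>i\<in>I. d i x * a i j x) = (\<Sum>i\<in>I-{p}. c i x * b i j x)" for j x
    proof -
      have "(\<Sum>i\<in>I. d i x * a i j x) = d p x * a p j x + (\<Sum>i\<in>I-{p}. d i x * a i j x)"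
        by (rule sum.remove) (use p insert in auto)
      also have "(\<Sum>i\<in>I-{p}. d i x * a i j x) = (\<Sum>i\<in>I-{p}. c i x * a p k x * a i j x)"
        by (rule sum.cong) (auto simp: d_def)
      finally show ?thesis
        by (simp add: d_def b_def sum_distrib_right sum_distrib_left algebra_simps sum_subtractf)
    qed
    moreover have "b i k x = 0" for i x by (simp add: b_def)
    ultimately show ?thesis using c(3) i(1)
      by (intro exI[of _ d]) auto
  qed
qed

lemma pf_insert_expand_padded:
  assumes "f \<in> poly_functions (insert g C)"
  obtains c n where "\<forall>i. c i \<in> poly_functions C"
    "\<forall>N x. n \<le> N \<longrightarrow> f x = (\<Sum>i<N. c i x * g x ^ i)"
proof -
  obtain c n where "\<forall>i. c i \<in> poly_functions C" "\<forall>x. f x = (\<Sum>i<n. c i x * g x ^ i)"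
    using pf_insert_expand[OF assms] .
  note c = this[rule_format]
  have "f x = (\<Sum>i<N. (if i < n then c i x else 0) * g x ^ i)" if "n \<le> N" for N x
    unfolding c(2) by (rule sum.mono_neutral_cong_left) (use that in auto)
  then show ?thesis using c(1) by (intro that[of "\<lambda>i x. if i < n then c i x else 0" n]) (auto intro: pf)
qed

text \<open>Modulo a relation for \<open>g\<close> with leading coefficient \<open>c p\<close>, the powers of \<open>g\<close> below \<open>p\<close> span after
  inverting \<open>c p\<close>.\<close>

lemma pseudo_division:
  fixes c :: "nat \<Rightarrow> 'x \<Rightarrow> 'k::comm_ring_1"
  assumes c: "\<And>i. c i \<in> poly_functions C" and "0 < p"
    and rel: "\<And>x. x \<in> W \<Longrightarrow> (\<Sum>i\<le>p. c i x * g x ^ i) = 0"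
    and "f \<in> poly_functions (insert g C)"
  shows "\<exists>N e. (\<forall>a. e a \<in> poly_functions C) \<and>
    (\<forall>x\<in>W. c p x ^ N * f x = (\<Sum>a<p. e a x * g x ^ a))"
  using assms(4)
proof (induction rule: pf_generator_mult_induct)
  case (add f h)
  then obtain N e M d where ed: "\<forall>a. e a \<in> poly_functions C"
    "\<forall>x\<in>W. c p x ^ N * f x = (\<Sum>a<p. e a x * g x ^ a)"
    "\<forall>a. d a \<in> poly_functions C"
    "\<forall>x\<in>W. c p x ^ M * h x = (\<Sum>a<p. d a x * g x ^ a)" by blast
  have "c p x ^ (N + M) * (f x + h x)
      = (\<Sum>a<p. (c p x ^ M * e a x + c p x ^ N * d a x) * g x ^ a)" if "x \<in> W" for x
  proof -
    have "c p x ^ (N + M) * (f x + h x) = c p x ^ M * (c p x ^ N * f x) + c p x ^ N * (c p x ^ M * h x)"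
      by (simp add: power_add algebra_simps)
    also have "\<dots> = c p x ^ M * (\<Sum>a<p. e a x * g x ^ a) + c p x ^ N * (\<Sum>a<p. d a x * g x ^ a)"
      using ed(2,4) that by simp
    finally show ?thesis
      by (simp add: sum_distrib_left sum.distrib distrib_right mult.assoc)
  qed
  then show ?case
    by (intro exI[of _ "N+M"] exI[of _ "\<lambda>a x. c p x ^ M * e a x + c p x ^ N * d a x"])
      (simp add: pf c ed(1,3)[rule_format])
next
  case (coeff f)
  have "f x = (\<Sum>a<p. (if a = 0 then f x else 0) * g x ^ a)" for x
  proof -
    have "(\<Sum>a<p. (if a = 0 then f x else 0) * g x ^ a) = (\<Sum>a<p. if a = 0 then f x else 0)"
      by (rule sum.cong) auto
    then show ?thesis using \<open>0 < p\<close> by simp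
  qed
  then show ?case
    by (intro exI[of _ 0] exI[of _ "\<lambda>a x. if a = 0 then f x else 0"]) (simp add: pf coeff)
next
  case (gen r f)
  then obtain N e where e: "\<forall>a. e a \<in> poly_functions C"
    "\<forall>x\<in>W. c p x ^ N * f x = (\<Sum>a<p. e a x * g x ^ a)" by blast
  show ?case
  proof (cases "r = g")
    case False
    then have "r \<in> poly_functions C" using gen by auto
    moreover have "c p x ^ N * (r x * f x) = (\<Sum>a<p. r x * e a x * g x ^ a)" if "x \<in> W" for x
    proof -
      have "c p x ^ N * (r x * f x) = r x * (c p x ^ N * f x)" by simp
      then show ?thesis using e(2) that by (simp add: sum_distrib_left mult.assoc)
    qed
    ultimately show ?thesis
      by (intro exI[of _ N] exI[of _ "\<lambda>a x. r x * e a x"]) (simp add: pf e(1)[rule_format])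
  next
    case True
    obtain q where q: "p = Suc q" using \<open>0 < p\<close> gr0_implies_Suc by blast
    \<comment> \<open>Multiplication by \<open>g\<close> shifts the coefficients. The overflow
      \<open>e q * g ^ p\<close> costs one more factor \<open>c p\<close>, after which the relation
      rewrites \<open>c p * g ^ p\<close> by lower powers.\<close>
    define d where "d a x = (if a = 0 then 0 else c p x * e (a - 1) x) - e q x * c a x" for a x
    have "c p x ^ Suc N * (g x * f x) = (\<Sum>a<p. d a x * g x ^ a)" if "x \<in> W" for x
    proof -
      have top: "c p x * g x ^ p = - (\<Sum>a<p. c a x * g x ^ a)"
        by (rule minus_unique[symmetric])
          (use rel[OF that] in \<open>simp add: lessThan_Suc_atMost[symmetric]\<close>)
      have "c p x ^ Suc N * (g x * f x) = c p x * g x * (c p x ^ N * f x)"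
        by (simp add: mult_ac)
      also have "\<dots> = c p x * g x * (\<Sum>a<p. e a x * g x ^ a)"
        using e(2) that by simp
      also have "\<dots> = c p x * g x * (\<Sum>a<q. e a x * g x ^ a) + e q x * (c p x * g x ^ p)"
        by (simp add: q distrib_left mult_ac)
      also have "\<dots> = (\<Sum>a<q. c p x * e a x * g x ^ Suc a) - e q x * (\<Sum>a<p. c a x * g x ^ a)"
        by (simp add: top sum_distrib_left mult_ac)
      also have "(\<Sum>a<q. c p x * e a x * g x ^ Suc a)
          = (\<Sum>a<p. (if a = 0 then 0 else c p x * e (a - 1) x) * g x ^ a)"
        unfolding q by (simp add: sum.lessThan_Suc_shift del: sum.lessThan_Suc)
      finally show ?thesis
        by (simp add: d_def left_diff_distrib sum_subtractf sum_distrib_left mult.assoc)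
    qed
    moreover have "d a \<in> poly_functions C" for a
      unfolding d_def using c e(1) by (intro pf) auto
    ultimately show ?thesis using True by (intro exI[of _ "Suc N"] exI[of _ d]) simp
  qed
qed

section \<open>Algebraic dependence\<close>

text \<open>\<open>alg C V v\<close>: on \<open>V\<close>, the function \<open>v\<close> is algebraic over the field of fractions of the ring of
  functions generated by \<open>C\<close>.\<close>

definition alg :: "('x \<Rightarrow> 'k::comm_ring_1) set \<Rightarrow> 'x set \<Rightarrow> ('x \<Rightarrow> 'k) \<Rightarrow> bool" where
  "alg C V v \<longleftrightarrow> (\<exists>n c. (\<forall>i. c i \<in> poly_functions C) \<and> (\<exists>i<n. \<not> vanishes V (c i)) \<and>
     (\<forall>x\<in>V. (\<Sum>i<n. c i x * v x ^ i) = 0))"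

lemma algI:
  assumes "\<And>i. c i \<in> poly_functions C" "\<exists>i<n. \<not> vanishes V (c i)"
    and "\<And>x. x \<in> V \<Longrightarrow> (\<Sum>i<n. c i x * v x ^ i) = 0"
  shows "alg C V v"
  unfolding alg_def by (rule exI[of _ n], rule exI[of _ c]) (use assms in simp)

text \<open>Terms beyond the last coefficient that does not vanish on \<open>V\<close> contribute
  nothing there and are cut off. The degree is positive, since a relation of degree 0 would make
  this coefficient vanish.\<close>

lemma algE:
  assumes "alg C V v"
  obtains c p where "\<forall>i. c i \<in> poly_functions C" "0 < p" "\<not> vanishes V (c p)"
    "\<forall>x\<in>V. (\<Sum>i\<le>p. c i x * v x ^ i) = 0"
proof -
  obtain n c where c: "\<And>i. c i \<in> poly_functions C" "\<exists>i<n. \<not> vanishes V (c i)"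
    "\<And>x. x \<in> V \<Longrightarrow> (\<Sum>i<n. c i x * v x ^ i) = 0"
    using assms unfolding alg_def by blast
  define p where "p = (GREATEST i. i < n \<and> \<not> vanishes V (c i))"
  have p: "p < n \<and> \<not> vanishes V (c p)"
    unfolding p_def by (rule GreatestI_ex_nat[of _ n]) (use c(2) in auto)
  have le: "i \<le> p" if "i < n" "\<not> vanishes V (c i)" for i
    unfolding p_def by (rule Greatest_le_nat[of _ _ n]) (use that in auto)
  have rel: "(\<Sum>i\<le>p. c i x * v x ^ i) = 0" if "x \<in> V" for x
  proof -
    have "(\<Sum>i\<le>p. c i x * v x ^ i) = (\<Sum>i<n. c i x * v x ^ i)"
    proof (rule sum.mono_neutral_left)
      show "\<forall>i\<in>{..<n} - {..p}. c i x * v x ^ i = 0"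
        using le that unfolding vanishes_def by fastforce
    qed (use p in auto)
    then show ?thesis using c(3) that by simp
  qed
  have "p \<noteq> 0"
  proof
    assume "p = 0"
    then have "c p x = 0" if "x \<in> V" for x using rel[OF that] by simp
    then show False using p by (auto simp: vanishes_def)
  qed
  then show ?thesis using that c(1) p rel by blast
qed

lemma alg_mono: "alg C V v \<Longrightarrow> C \<subseteq> D \<Longrightarrow> alg D V v"
  unfolding alg_def using pf_mono by blast

text \<open>Over the field of fractions all powers of \<open>v\<close> lie in a space spanned by
  \<open>card J\<close> functions, so \<open>card J + 1\<close> of them are dependent. The
  denominators \<open>r\<close> are multiplied into the coefficients, and irreducibility keeps one
  of the products from vanishing.\<close>

lemma alg_if_spanned:
  fixes v :: "'x \<Rightarrow> 'k::comm_ring_1"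
  assumes irr: "irr (poly_functions C) V" and "finite J"
    and span: "\<And>k. \<exists>r e. r \<in> poly_functions C \<and> \<not> vanishes V r \<and> (\<forall>j. e j \<in> poly_functions C) \<and>
      (\<forall>x\<in>V. r x * v x ^ k = (\<Sum>j\<in>J. e j x * w j x))"
  shows "alg C V v"
proof -
  from span have "\<forall>k. \<exists>r e. r \<in> poly_functions C \<and> \<not> vanishes V r \<and> (\<forall>j. e j \<in> poly_functions C) \<and>
      (\<forall>x\<in>V. r x * v x ^ k = (\<Sum>j\<in>J. e j x * w j x))" by blast
  from choice[OF this] obtain r where "\<forall>k. \<exists>e. r k \<in> poly_functions C \<and> \<not> vanishes V (r k) \<and>
      (\<forall>j. e j \<in> poly_functions C) \<and> (\<forall>x\<in>V. r k x * v x ^ k = (\<Sum>j\<in>J. e j x * w j x))" ..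
  from choice[OF this] obtain e where e: "\<forall>k. r k \<in> poly_functions C \<and> \<not> vanishes V (r k) \<and>
      (\<forall>j. e k j \<in> poly_functions C) \<and> (\<forall>x\<in>V. r k x * v x ^ k = (\<Sum>j\<in>J. e k j x * w j x))" ..
  then have re: "r k \<in> poly_functions C" "\<not> vanishes V (r k)" "e k j \<in> poly_functions C"
    "x \<in> V \<Longrightarrow> r k x * v x ^ k = (\<Sum>j\<in>J. e k j x * w j x)" for k j x by blast+
  have "card J < card {..<Suc (card J)}" by simp
  from homogeneous_system_solution[OF irr \<open>finite J\<close> finite_lessThan this, of e, OF re(3)]
  obtain d where "\<forall>i. d i \<in> poly_functions C" "\<exists>i\<in>{..<Suc (card J)}. \<not> vanishes V (d i)"
    "\<forall>j\<in>J. \<forall>x\<in>V. (\<Sum>i<Suc (card J). d i x * e i j x) = 0"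
    by (elim exE conjE)
  note d = this[rule_format]
  have "(\<Sum>i<Suc (card J). d i x * r i x * v x ^ i) = 0" if "x \<in> V" for x
  proof -
    have "(\<Sum>i<Suc (card J). d i x * r i x * v x ^ i) = (\<Sum>i<Suc (card J). \<Sum>j\<in>J. d i x * e i j x * w j x)"
      using re(4)[OF that] by (simp add: mult.assoc sum_distrib_left del: sum.lessThan_Suc)
    also have "\<dots> = (\<Sum>j\<in>J. (\<Sum>i<Suc (card J). d i x * e i j x) * w j x)"
      by (subst sum.swap) (simp add: sum_distrib_right del: sum.lessThan_Suc)
    finally show ?thesis using d(3) that by (simp del: sum.lessThan_Suc)
  qed
  moreover have "\<exists>i<Suc (card J). \<not> vanishes V (\<lambda>x. d i x * r i x)"
    using d(2) irr_mult[OF irr d(1) re(1) _ re(2)] by (elim bexE) (blast dest: lessThan_iff[THEN iffD1])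
  ultimately show ?thesis
    unfolding alg_def
    by (intro exI[of _ "Suc (card J)"] exI[of _ "\<lambda>i x. d i x * r i x"])
      (simp add: pf d(1) re(1) del: sum.lessThan_Suc)
qed

text \<open>By pseudo-division every power of \<open>t\<close> is a combination of the powers of
  \<open>g\<close> below \<open>p\<close>, up to a denominator \<open>c p ^ N\<close>.\<close>

lemma alg_adjoin:
  assumes irr: "irr (poly_functions C) V" and "alg C V g" and t: "t \<in> poly_functions (insert g C)"
  shows "alg C V t"
proof -
  obtain c p where "\<forall>i. c i \<in> poly_functions C" "0 < p" "\<not> vanishes V (c p)"
    "\<forall>x\<in>V. (\<Sum>i\<le>p. c i x * g x ^ i) = 0"
    using algE[OF assms(2)] .
  note c = this[rule_format]
  show ?thesis
  proof (rule alg_if_spanned[OF irr finite_lessThan])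
    fix k
    obtain N e where e: "\<forall>a. e a \<in> poly_functions C"
      "\<forall>x\<in>V. c p x ^ N * t x ^ k = (\<Sum>a<p. e a x * g x ^ a)"
      using pseudo_division[OF c(1,2,4) pf_power[OF t]] by blast
    show "\<exists>r e. r \<in> poly_functions C \<and> \<not> vanishes V r \<and> (\<forall>j. e j \<in> poly_functions C) \<and>
      (\<forall>x\<in>V. r x * t x ^ k = (\<Sum>j<p. e j x * (\<lambda>j x. g x ^ j) j x))"
      using e irr_power[OF irr c(1) c(3)] pf_power[OF c(1)] by blast
  qed
qed

text \<open>This inverts \<open>t\<close> up to a denominator. In a relation for \<open>t\<close>
  take the lowest coefficient that does not vanish on \<open>V\<close>; after the power of
  \<open>t\<close> in front is cancelled, this coefficient is a multiple of
  \<open>t\<close>.\<close>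

lemma alg_multiple_in_base:
  assumes irr: "irr (poly_functions (insert g C)) V" and g: "alg C V g"
    and t: "t \<in> poly_functions (insert g C)" "\<not> vanishes V t"
  obtains s r where "s \<in> poly_functions (insert g C)" "r \<in> poly_functions C" "\<not> vanishes V r"
    "\<forall>x\<in>V. t x * s x = r x"
proof -
  have sub: "poly_functions C \<subseteq> poly_functions (insert g C)" by (intro pf_mono) auto
  obtain n c where c: "\<And>i. c i \<in> poly_functions C" "\<exists>i<n. \<not> vanishes V (c i)"
    "\<And>x. x \<in> V \<Longrightarrow> (\<Sum>i<n. c i x * t x ^ i) = 0"
    using alg_adjoin[OF irr_mono[OF irr sub] g t(1)] unfolding alg_def by blast
  define j where "j = (LEAST i. i < n \<and> \<not> vanishes V (c i))"
  have j: "j < n" "\<not> vanishes V (c j)"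
    using LeastI_ex[of "\<lambda>i. i < n \<and> \<not> vanishes V (c i)"] c(2) unfolding j_def by blast+
  have less: "vanishes V (c i)" if "i < j" for i
    using not_less_Least[of i "\<lambda>i. i < n \<and> \<not> vanishes V (c i)"] that j(1) unfolding j_def[symmetric] by simp
  define s where "s x = - (\<Sum>i\<in>{Suc j..<n}. c i x * t x ^ (i - Suc j))" for x
  have s: "s \<in> poly_functions (insert g C)"
    unfolding s_def using sub c(1) t(1) by (intro pf) auto
  have "vanishes V (\<lambda>x. t x ^ j * (c j x - t x * s x))"
    unfolding vanishes_def
  proof
    fix x assume x: "x \<in> V"
    have "0 = (\<Sum>i<n. c i x * t x ^ i)" using c(3)[OF x] by simp
    also have "\<dots> = (\<Sum>i\<in>{j..<n}. c i x * t x ^ i)"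
      using less x by (intro sum.mono_neutral_right) (auto simp: vanishes_def)
    also have "\<dots> = c j x * t x ^ j + (\<Sum>i\<in>{Suc j..<n}. c i x * t x ^ i)"
      using j(1) by (simp add: sum.atLeast_Suc_lessThan)
    also have "(\<Sum>i\<in>{Suc j..<n}. c i x * t x ^ i)
        = (\<Sum>i\<in>{Suc j..<n}. t x ^ Suc j * (c i x * t x ^ (i - Suc j)))"
    proof (rule sum.cong)
      fix i assume "i \<in> {Suc j..<n}"
      then have "t x ^ i = t x ^ Suc j * t x ^ (i - Suc j)"
        by (simp only: power_add[symmetric]) simp
      then show "c i x * t x ^ i = t x ^ Suc j * (c i x * t x ^ (i - Suc j))"
        by (simp only: mult_ac)
    qed simp
    also have "\<dots> = t x ^ j * t x * (- s x)"
      unfolding s_def by (simp add: sum_distrib_left mult_ac)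
    finally show "t x ^ j * (c j x - t x * s x) = 0"
      by (simp add: algebra_simps)
  qed
  moreover have "c j \<in> poly_functions (insert g C)" using c(1) sub by blast
  then have "(\<lambda>x. c j x - t x * s x) \<in> poly_functions (insert g C)"
    by (intro pf t s)
  ultimately have "vanishes V (\<lambda>x. c j x - t x * s x)"
    using irr_mult[OF irr pf_power[OF t(1)] _ irr_power[OF irr t]] by blast
  then show ?thesis
    using that[OF s c(1) j(2)] by (simp add: vanishes_def)
qed

text \<open>Up to denominators, the powers of \<open>v\<close> are spanned by the products
  \<open>g ^ a * v ^ i\<close> with \<open>a < p\<close> and \<open>i < q\<close>. The leading
  coefficient \<open>b q\<close> involves \<open>g\<close>, so it is first replaced by its multiple
  \<open>r\<close> from \<open>poly_functions C\<close>.\<close>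

lemma alg_trans:
  assumes irr: "irr (poly_functions (insert g C)) V"
    and v: "alg (insert g C) V v" and g: "alg C V g"
  shows "alg C V v"
proof -
  have irrC: "irr (poly_functions C) V"
    by (rule irr_mono[OF irr pf_mono]) auto
  obtain c p where "\<forall>i. c i \<in> poly_functions C" "0 < p" "\<not> vanishes V (c p)"
    "\<forall>x\<in>V. (\<Sum>i\<le>p. c i x * g x ^ i) = 0"
    using algE[OF g] .
  note c = this[rule_format]
  obtain b q where "\<forall>i. b i \<in> poly_functions (insert g C)" "0 < q" "\<not> vanishes V (b q)"
    "\<forall>x\<in>V. (\<Sum>i\<le>q. b i x * v x ^ i) = 0"
    using algE[OF v] .
  note b = this[rule_format]
  obtain s r where "s \<in> poly_functions (insert g C)" "r \<in> poly_functions C" "\<not> vanishes V r"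
    "\<forall>x\<in>V. b q x * s x = r x"
    using alg_multiple_in_base[OF irr g b(1) b(3)] .
  note sr = this[rule_format]
  show ?thesis
  proof (rule alg_if_spanned[OF irrC, of "{..<q} \<times> {..<p}"])
    fix k
    have "(\<lambda>x. v x ^ k) \<in> poly_functions (insert v (insert g C))"
      by (intro pf_power poly_functions.coord) simp
    then have "\<exists>N d. (\<forall>i. d i \<in> poly_functions (insert g C)) \<and>
        (\<forall>x\<in>V. b q x ^ N * v x ^ k = (\<Sum>i<q. d i x * v x ^ i))"
      by (intro pseudo_division[OF b(1,2)] b(4))
    then obtain N d where "\<forall>i. d i \<in> poly_functions (insert g C)"
      "\<forall>x\<in>V. b q x ^ N * v x ^ k = (\<Sum>i<q. d i x * v x ^ i)"
      by (elim exE conjE)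
    note d = this[rule_format]
    have sd: "(\<lambda>x. s x ^ N * d i x) \<in> poly_functions (insert g C)" for i
      by (intro pf sr d)
    have "\<forall>i. \<exists>M e. (\<forall>a. e a \<in> poly_functions C) \<and>
        (\<forall>x\<in>V. c p x ^ M * (s x ^ N * d i x) = (\<Sum>a<p. e a x * g x ^ a))"
      by (intro allI pseudo_division[OF c(1,2)] c(4) sd)
    from choice[OF this] obtain M where "\<forall>i. \<exists>e. (\<forall>a. e a \<in> poly_functions C) \<and>
        (\<forall>x\<in>V. c p x ^ M i * (s x ^ N * d i x) = (\<Sum>a<p. e a x * g x ^ a))" ..
    from choice[OF this] obtain e where e: "\<forall>i. (\<forall>a. e i a \<in> poly_functions C) \<and>
        (\<forall>x\<in>V. c p x ^ M i * (s x ^ N * d i x) = (\<Sum>a<p. e i a x * g x ^ a))" ..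
    have e: "e i a \<in> poly_functions C"
      "x \<in> V \<Longrightarrow> c p x ^ M i * (s x ^ N * d i x) = (\<Sum>a<p. e i a x * g x ^ a)" for i a x
      using e by simp_all
    \<comment> \<open>A common exponent: the denominators \<open>c p ^ M i\<close> of the finitely
      many coefficients all divide \<open>c p ^ K\<close>.\<close>
    define K where "K = (\<Sum>i<q. M i)"
    have K: "M i \<le> K" if "i < q" for i
      unfolding K_def using that by (intro member_le_sum) auto
    have eq: "c p x ^ K * r x ^ N * v x ^ k
        = (\<Sum>(i, a)\<in>{..<q} \<times> {..<p}. c p x ^ (K - M i) * e i a x * (g x ^ a * v x ^ i))"
      if x: "x \<in> V" for x
    proof -
      have "c p x ^ K * r x ^ N * v x ^ k = c p x ^ K * s x ^ N * (b q x ^ N * v x ^ k)"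
        unfolding sr(4)[OF x, symmetric] by (simp add: power_mult_distrib mult_ac)
      also have "\<dots> = (\<Sum>i<q. c p x ^ K * (s x ^ N * d i x) * v x ^ i)"
        unfolding d(2)[OF x] by (simp add: sum_distrib_left mult_ac)
      also have "\<dots> = (\<Sum>i<q. \<Sum>a<p. c p x ^ (K - M i) * e i a x * (g x ^ a * v x ^ i))"
      proof (rule sum.cong)
        fix i assume "i \<in> {..<q}"
        then have "c p x ^ K = c p x ^ (K - M i) * c p x ^ M i"
          using K by (simp add: power_add[symmetric])
        then have "c p x ^ K * (s x ^ N * d i x) = c p x ^ (K - M i) * (\<Sum>a<p. e i a x * g x ^ a)"
          using e(2)[OF x, of i] by (simp add: mult.assoc)
        then show "c p x ^ K * (s x ^ N * d i x) * v x ^ i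
            = (\<Sum>a<p. c p x ^ (K - M i) * e i a x * (g x ^ a * v x ^ i))"
          by (simp add: sum_distrib_left sum_distrib_right mult_ac)
      qed simp
      finally show ?thesis by (simp add: sum.cartesian_product)
    qed
    show "\<exists>r e. r \<in> poly_functions C \<and> \<not> vanishes V r \<and> (\<forall>j. e j \<in> poly_functions C) \<and>
      (\<forall>x\<in>V. r x * v x ^ k = (\<Sum>j\<in>{..<q} \<times> {..<p}. e j x * (\<lambda>(i, a) x. g x ^ a * v x ^ i) j x))"
    proof (intro exI conjI ballI allI)
      show "(\<lambda>x. c p x ^ K * r x ^ N) \<in> poly_functions C" by (intro pf c sr)
      show "\<not> vanishes V (\<lambda>x. c p x ^ K * r x ^ N)"
        by (rule irr_mult[OF irrC]) (intro pf_power c sr irr_power[OF irrC])+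
      show "(\<lambda>(i, a) x. c p x ^ (K - M i) * e i a x) j \<in> poly_functions C" for j
        by (cases j) (simp add: pf c e)
      show "c p x ^ K * r x ^ N * v x ^ k = (\<Sum>j\<in>{..<q} \<times> {..<p}.
          (\<lambda>(i, a) x. c p x ^ (K - M i) * e i a x) j x * (\<lambda>(i, a) x. g x ^ a * v x ^ i) j x)"
        if "x \<in> V" for x
        unfolding eq[OF that] by (rule sum.cong) auto
    qed
  qed simp
qed

text \<open>A relation for \<open>v\<close> with coefficients polynomial in \<open>g\<close> is a
  polynomial in both; sorting it by powers of \<open>g\<close> gives a relation for
  \<open>g\<close>. If its coefficients all vanished on \<open>V\<close>, they would be relations
  for \<open>v\<close> over \<open>C\<close>, hence trivial, and the original relation would be
  trivial too.\<close>

lemma alg_exchange: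
  assumes v: "alg (insert g C) V v" "\<not> alg C V v"
  shows "alg (insert v C) V g"
proof -
  obtain n c where c: "\<And>i. c i \<in> poly_functions (insert g C)" "\<exists>i<n. \<not> vanishes V (c i)"
    "\<And>x. x \<in> V \<Longrightarrow> (\<Sum>i<n. c i x * v x ^ i) = 0"
    using v(1) unfolding alg_def by blast
  have "\<forall>i. \<exists>m r. (\<forall>j. r j \<in> poly_functions C) \<and>
      (\<forall>N x. m \<le> N \<longrightarrow> c i x = (\<Sum>j<N. r j x * g x ^ j))"
  proof
    fix i
    obtain r m where "\<forall>j. r j \<in> poly_functions C"
      "\<forall>N x. m \<le> N \<longrightarrow> c i x = (\<Sum>j<N. r j x * g x ^ j)"
      using pf_insert_expand_padded[OF c(1)] .
    then show "\<exists>m r. (\<forall>j. r j \<in> poly_functions C) \<and>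
        (\<forall>N x. m \<le> N \<longrightarrow> c i x = (\<Sum>j<N. r j x * g x ^ j))"
      by (intro exI[of _ m] exI[of _ r] conjI)
  qed
  from choice[OF this] obtain m where "\<forall>i. \<exists>r. (\<forall>j. r j \<in> poly_functions C) \<and>
      (\<forall>N x. m i \<le> N \<longrightarrow> c i x = (\<Sum>j<N. r j x * g x ^ j))" ..
  from choice[OF this] obtain r where r: "\<forall>i. (\<forall>j. r i j \<in> poly_functions C) \<and>
      (\<forall>N x. m i \<le> N \<longrightarrow> c i x = (\<Sum>j<N. r i j x * g x ^ j))" ..
  have r: "r i j \<in> poly_functions C"
    "m i \<le> N \<Longrightarrow> c i x = (\<Sum>j<N. r i j x * g x ^ j)" for i j N x
    using r by simp_all
  define M where "M = (\<Sum>i<n. m i)"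
  have cM: "c i x = (\<Sum>j<M. r i j x * g x ^ j)" if "i < n" for i x
  proof (rule r(2))
    show "m i \<le> M" unfolding M_def using that by (intro member_le_sum) auto
  qed
  define s where "s j x = (\<Sum>i<n. r i j x * v x ^ i)" for j x
  have "r i j \<in> poly_functions (insert v C)" for i j
    using r(1) pf_mono[of C "insert v C"] by blast
  moreover have "v \<in> poly_functions (insert v C)" by (rule poly_functions.coord) simp
  ultimately have "s j \<in> poly_functions (insert v C)" for j
    unfolding s_def by (intro pf) auto
  moreover have "(\<Sum>j<M. s j x * g x ^ j) = 0" if "x \<in> V" for x
  proof -
    have "0 = (\<Sum>i<n. (\<Sum>j<M. r i j x * g x ^ j) * v x ^ i)"
      using c(3)[OF that] cM by simp
    also have "\<dots> = (\<Sum>j<M. s j x * g x ^ j)"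
      unfolding s_def sum_distrib_right by (subst sum.swap) (simp add: mult_ac)
    finally show ?thesis by simp
  qed
  moreover have "\<exists>j<M. \<not> vanishes V (s j)"
  proof (rule ccontr)
    assume "\<not> ?thesis"
    then have s0: "\<forall>x\<in>V. (\<Sum>i<n. r i j x * v x ^ i) = 0" if "j < M" for j
      using that unfolding s_def vanishes_def by blast
    have "vanishes V (r i j)" if "i < n" "j < M" for i j
    proof (rule ccontr)
      assume "\<not> vanishes V (r i j)"
      then have "\<exists>i<n. \<not> vanishes V (r i j)" using that(1) by blast
      then have "alg C V v"
        by (rule algI[rotated]) (use r(1) s0[OF that(2)] in auto)
      then show False using v(2) by blast
    qed
    then have "\<forall>i<n. vanishes V (c i)"
      using cM by (simp add: vanishes_def)
    then show False using c(2) by blast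
  qed
  ultimately show ?thesis
    by (intro algI[of s _ M])
qed

section \<open>Polynomials as functions\<close>

definition Pol :: "'i set \<Rightarrow> (('i \<Rightarrow> 'k) \<Rightarrow> 'k::comm_ring_1) set" where
  "Pol I = poly_functions ((\<lambda>i u. u i) ` I)"

lemma Pol_coord: "i \<in> I \<Longrightarrow> (\<lambda>u. u i) \<in> Pol I"
  unfolding Pol_def by (intro poly_functions.coord) auto

lemma Pol_mono: "I \<subseteq> J \<Longrightarrow> Pol I \<subseteq> Pol J"
  unfolding Pol_def by (intro pf_mono) auto

lemma Pol_insert: "Pol (insert j I) = poly_functions (insert (\<lambda>u. u j) ((\<lambda>i u. u i) ` I))"
  by (simp add: Pol_def)

lemma Pol_cong: "P \<in> Pol I \<Longrightarrow> (\<And>i. i \<in> I \<Longrightarrow> u i = w i) \<Longrightarrow> P u = P w"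
  unfolding Pol_def by (induction rule: poly_functions.induct) auto

lemma Pol_comp:
  assumes "P \<in> Pol I" "\<And>i. i \<in> I \<Longrightarrow> (\<lambda>x. f x i) \<in> poly_functions D"
  shows "(\<lambda>x. P (f x)) \<in> poly_functions D"
  using assms pf_comp[of P "(\<lambda>i u. u i) ` I" f D] unfolding Pol_def by auto

lemma pf_imageE:
  assumes "h \<in> poly_functions (f ` I)"
  obtains P where "P \<in> Pol I" "\<forall>x. h x = P (\<lambda>i. f i x)"
proof -
  have "\<exists>P\<in>Pol I. \<forall>x. h x = P (\<lambda>i. f i x)"
    using assms
  proof induction
    case (const c)
    show ?case by (rule bexI[of _ "\<lambda>u. c"]) (auto simp: Pol_def intro: pf)
  next
    case (coord h)
    then obtain i where "i \<in> I" "h = f i" by blast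
    then show ?case by (intro bexI[of _ "\<lambda>u. u i"]) (auto intro: Pol_coord)
  next
    case (add g h)
    then obtain P Q where "P \<in> Pol I" "\<forall>x. g x = P (\<lambda>i. f i x)"
      "Q \<in> Pol I" "\<forall>x. h x = Q (\<lambda>i. f i x)" by blast
    then show ?case by (intro bexI[of _ "\<lambda>u. P u + Q u"]) (auto simp: Pol_def intro: pf)
  next
    case (mult g h)
    then obtain P Q where "P \<in> Pol I" "\<forall>x. g x = P (\<lambda>i. f i x)"
      "Q \<in> Pol I" "\<forall>x. h x = Q (\<lambda>i. f i x)" by blast
    then show ?case by (intro bexI[of _ "\<lambda>u. P u * Q u"]) (auto simp: Pol_def intro: pf)
  qed
  then show ?thesis using that by blast
qed

lemma Pol_on_line:
  assumes "P \<in> Pol I"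
  shows "\<exists>p. \<forall>t. P (\<lambda>i. u i + t * w i) = poly p t"
  using assms unfolding Pol_def
proof induction
  case (const c)
  show ?case by (rule exI[of _ "[:c:]"]) simp
next
  case (coord f)
  then obtain i where "f = (\<lambda>u. u i)" by blast
  then show ?case by (intro exI[of _ "[:u i, w i:]"]) (simp add: mult.commute)
next
  case (add f g)
  then show ?case by (metis poly_add)
next
  case (mult f g)
  then show ?case by (metis poly_mult)
qed

lemma poly_nonroot_common:
  fixes p q :: "'k::field_char_0 poly"
  assumes "p \<noteq> 0" "q \<noteq> 0"
  obtains t where "poly p t \<noteq> 0" "poly q t \<noteq> 0"
proof -
  have "finite {t. poly (p * q) t = 0}"
    using assms by (intro poly_roots_finite) simp
  then obtain t where "poly (p * q) t \<noteq> 0"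
    using infinite_UNIV_char_0[where 'a = 'k] by (metis (mono_tags) ex_new_if_finite mem_Collect_eq)
  then show ?thesis using that by auto
qed

text \<open>A point where \<open>P\<close> is nonzero and one where \<open>Q\<close> is nonzero are
  joined by a line, on which both become nonzero polynomials in one variable; these have a common
  non-root because a field of characteristic zero is infinite.\<close>

lemma irr_Pol_UNIV: "irr (Pol I :: (('i \<Rightarrow> 'k::field_char_0) \<Rightarrow> 'k) set) UNIV"
  unfolding irr_def
proof (intro conjI ballI impI)
  fix P Q :: "('i \<Rightarrow> 'k) \<Rightarrow> 'k"
  assume PQ: "P \<in> Pol I" "Q \<in> Pol I" "vanishes UNIV (\<lambda>u. P u * Q u)"
  show "vanishes UNIV P \<or> vanishes UNIV Q"
  proof (rule ccontr)
    assume "\<not> ?thesis"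
    then obtain u v where uv: "P u \<noteq> 0" "Q v \<noteq> 0" by (auto simp: vanishes_def)
    obtain p where p: "\<forall>t. P (\<lambda>i. u i + t * (v i - u i)) = poly p t"
      using Pol_on_line[OF PQ(1), of u "\<lambda>i. v i - u i"] by blast
    obtain q where q: "\<forall>t. Q (\<lambda>i. u i + t * (v i - u i)) = poly q t"
      using Pol_on_line[OF PQ(2), of u "\<lambda>i. v i - u i"] by blast
    have "poly p 0 \<noteq> 0" "poly q 1 \<noteq> 0"
      using uv p[rule_format, of 0] q[rule_format, of 1] by simp_all
    then have "p \<noteq> 0" "q \<noteq> 0" by auto
    then obtain t where "poly p t \<noteq> 0" "poly q t \<noteq> 0" by (rule poly_nonroot_common)
    then show False using PQ(3) p q by (simp add: vanishes_def) (metis mult_eq_0_iff)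
  qed
qed simp

text \<open>Independence on \<open>V\<close> of functions indexed by \<open>I\<close> says that \<open>x \<mapsto> (f i x)\<close>
  maps \<open>V\<close> onto a dense subset of the affine space with coordinates \<open>I\<close>.\<close>

definition indep :: "('i \<Rightarrow> 'x \<Rightarrow> 'k::comm_ring_1) \<Rightarrow> 'i set \<Rightarrow> 'x set \<Rightarrow> bool" where
  "indep f I V \<longleftrightarrow> (\<forall>P \<in> Pol I. vanishes V (\<lambda>x. P (\<lambda>i. f i x)) \<longrightarrow> vanishes UNIV P)"

lemma indepD:
  "indep f I V \<Longrightarrow> P \<in> Pol I \<Longrightarrow> vanishes V (\<lambda>x. P (\<lambda>i. f i x)) \<Longrightarrow> vanishes UNIV P"
  unfolding indep_def by blast

lemma indep_subset: "indep f I V \<Longrightarrow> J \<subseteq> I \<Longrightarrow> indep f J V"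
  unfolding indep_def using Pol_mono by blast

lemma indep_superset: "indep f I V \<Longrightarrow> V \<subseteq> W \<Longrightarrow> indep f I W"
  unfolding indep_def vanishes_def by blast

lemma indep_cong:
  assumes "\<And>i x. i \<in> I \<Longrightarrow> x \<in> V \<Longrightarrow> f i x = g i x"
  shows "indep f I V \<longleftrightarrow> indep g I V"
proof -
  have "vanishes V (\<lambda>x. P (\<lambda>i. f i x)) \<longleftrightarrow> vanishes V (\<lambda>x. P (\<lambda>i. g i x))" if "P \<in> Pol I" for P
    using Pol_cong[OF that, of "\<lambda>i. f i x" "\<lambda>i. g i x" for x] assms unfolding vanishes_def by metis
  then show ?thesis unfolding indep_def by blast
qed

lemma indep_image: "indep f I (p ` V) \<longleftrightarrow> indep (\<lambda>i x. f i (p x)) I V"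
  unfolding indep_def vanishes_def by simp

text \<open>The product of a relation on \<open>V\<close> and a relation on \<open>W\<close> is one
  on the union, and polynomials form a domain. Hence independence survives on some member of a
  finite cover, in particular on an irreducible component.\<close>

lemma indep_Un:
  fixes f :: "'i \<Rightarrow> 'x \<Rightarrow> 'k::field_char_0"
  assumes "indep f I (V \<union> W)"
  shows "indep f I V \<or> indep f I W"
proof (rule ccontr)
  assume "\<not> ?thesis"
  then obtain P Q where PQ: "P \<in> Pol I" "vanishes V (\<lambda>x. P (\<lambda>i. f i x))" "\<not> vanishes UNIV P"
    "Q \<in> Pol I" "vanishes W (\<lambda>x. Q (\<lambda>i. f i x))" "\<not> vanishes UNIV Q"
    unfolding indep_def by blast
  have "vanishes (V \<union> W) (\<lambda>x. P (\<lambda>i. f i x) * Q (\<lambda>i. f i x))"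
    using PQ by (auto simp: vanishes_def)
  moreover have "(\<lambda>u. P u * Q u) \<in> Pol I" using PQ unfolding Pol_def by (intro pf)
  ultimately have "vanishes UNIV (\<lambda>u. P u * Q u)" by (intro indepD[OF assms]) auto
  then show False using irr_mult[OF irr_Pol_UNIV PQ(1,4,3,6)] by blast
qed

lemma indep_nonempty: "indep f I V \<Longrightarrow> V \<noteq> {}"
  unfolding indep_def vanishes_def Pol_def using poly_functions.const[of 1] by fastforce

lemma indep_Union:
  fixes f :: "'i \<Rightarrow> 'x \<Rightarrow> 'k::field_char_0"
  assumes "finite \<V>" "indep f I (\<Union>\<V>)"
  shows "\<exists>V\<in>\<V>. indep f I V"
  using assms
proof (induction \<V> rule: finite_induct)
  case empty
  then show ?case using indep_nonempty by fastforce
next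
  case (insert V \<V>)
  then show ?case using indep_Un[of f I V "\<Union>\<V>"] by auto
qed

lemma indep_minus_zeros:
  assumes "indep f I V" "irr (poly_functions C) V" "h \<in> poly_functions C" "\<not> vanishes V h"
    "\<And>i. i \<in> I \<Longrightarrow> f i \<in> poly_functions C"
  shows "indep f I {x \<in> V. h x \<noteq> 0}"
  unfolding indep_def
proof (intro ballI impI)
  fix P assume P: "P \<in> Pol I" "vanishes {x \<in> V. h x \<noteq> 0} (\<lambda>x. P (\<lambda>i. f i x))"
  then have "vanishes V (\<lambda>x. P (\<lambda>i. f i x) * h x)" by (auto simp: vanishes_def)
  moreover have "(\<lambda>x. P (\<lambda>i. f i x)) \<in> poly_functions C"
    using P(1) assms(5) by (rule Pol_comp)
  ultimately have "vanishes V (\<lambda>x. P (\<lambda>i. f i x))"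
    using irr_mult[OF assms(2) _ assms(3) _ assms(4)] by blast
  then show "vanishes UNIV P" using assms(1) P(1) unfolding indep_def by blast
qed

text \<open>Fix the other coordinates where \<open>r a\<close> does not vanish and let coordinate
  \<open>j\<close> vary: the result is a nonzero polynomial in one variable.\<close>

lemma Pol_insert_relation_nontrivial:
  fixes r :: "nat \<Rightarrow> ('i \<Rightarrow> 'k::field_char_0) \<Rightarrow> 'k"
  assumes "j \<notin> I" "\<And>a. r a \<in> Pol I" "a < n" "\<not> vanishes UNIV (r a)"
  shows "\<not> vanishes UNIV (\<lambda>u. \<Sum>a<n. r a u * u j ^ a)"
proof
  assume van: "vanishes UNIV (\<lambda>u. \<Sum>a<n. r a u * u j ^ a)"
  obtain u where u: "r a u \<noteq> 0" using assms(4) by (auto simp: vanishes_def)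
  define p where "p = (\<Sum>a<n. monom (r a u) a)"
  have "poly p t = 0" for t
  proof -
    have "r b (u(j := t)) = r b u" for b
      by (rule Pol_cong[OF assms(2)]) (use assms(1) in auto)
    then show ?thesis
      using van[unfolded vanishes_def, rule_format, of "u(j := t)"]
      by (simp add: p_def poly_sum poly_monom)
  qed
  then have "p = 0" using poly_all_0_iff_0 by blast
  moreover have "coeff p a = r a u" using assms(3) by (simp add: p_def coeff_sum if_distrib cong: if_cong)
  ultimately show False using u by simp
qed

section \<open>Independence against algebraic dependence: the exchange property\<close>

lemma indep_not_alg:
  fixes f :: "'i \<Rightarrow> 'x \<Rightarrow> 'k::field_char_0"
  assumes "indep f I V" "i \<in> I"
  shows "\<not> alg (f ` (I - {i})) V (f i)"
proof
  assume "alg (f ` (I - {i})) V (f i)"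
  then obtain n c where c: "\<And>a. c a \<in> poly_functions (f ` (I - {i}))" "\<exists>a<n. \<not> vanishes V (c a)"
    "\<And>x. x \<in> V \<Longrightarrow> (\<Sum>a<n. c a x * f i x ^ a) = 0"
    unfolding alg_def by blast
  have "\<forall>a. \<exists>P. P \<in> Pol (I - {i}) \<and> (\<forall>x. c a x = P (\<lambda>i. f i x))"
    using pf_imageE[OF c(1)] by blast
  from choice[OF this] obtain r where r: "\<forall>a. r a \<in> Pol (I - {i}) \<and> (\<forall>x. c a x = r a (\<lambda>i. f i x))" ..
  have r: "r a \<in> Pol (I - {i})" "c a x = r a (\<lambda>i. f i x)" for a x using r by auto
  obtain a where a: "a < n" "\<not> vanishes V (c a)" using c(2) by blast
  then have "\<not> vanishes UNIV (r a)" using r(2) by (auto simp: vanishes_def)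
  then have "\<not> vanishes UNIV (\<lambda>u. \<Sum>a<n. r a u * u i ^ a)"
    by (intro Pol_insert_relation_nontrivial[OF _ r(1) a(1)]) auto
  moreover have "r a \<in> Pol I" for a using r(1)[of a] Pol_mono[of "I - {i}" I] by blast
  then have "(\<lambda>u. \<Sum>a<n. r a u * u i ^ a) \<in> Pol I"
    using Pol_coord[OF assms(2)] unfolding Pol_def by (intro pf) auto
  moreover have "vanishes V (\<lambda>x. \<Sum>a<n. r a (\<lambda>i. f i x) * f i x ^ a)"
    using c(3) by (simp add: vanishes_def r(2))
  ultimately show False using indepD[OF assms(1), of "\<lambda>u. \<Sum>a<n. r a u * u i ^ a"] by blast
qed

lemma indep_insert:
  assumes "indep f I V" "\<not> alg (f ` I) V (f j)"
  shows "indep f (insert j I) V"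
  unfolding indep_def
proof (intro ballI impI)
  fix P assume P: "P \<in> Pol (insert j I)" "vanishes V (\<lambda>x. P (\<lambda>i. f i x))"
  obtain r n where "\<forall>a. r a \<in> poly_functions ((\<lambda>i u. u i) ` I)" "\<forall>u. P u = (\<Sum>a<n. r a u * u j ^ a)"
    using pf_insert_expand[OF P(1)[unfolded Pol_insert]] .
  then have r: "r a \<in> Pol I" "P u = (\<Sum>a<n. r a u * u j ^ a)" for a u
    unfolding Pol_def by auto
  have "vanishes V (\<lambda>x. r a (\<lambda>i. f i x))" if "a < n" for a
  proof (rule ccontr)
    assume "\<not> ?thesis"
    then have "\<exists>a<n. \<not> vanishes V (\<lambda>x. r a (\<lambda>i. f i x))" using that by blast
    moreover have "(\<lambda>x. r a (\<lambda>i. f i x)) \<in> poly_functions (f ` I)" for a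
      using r(1) by (rule Pol_comp) (auto intro: poly_functions.coord)
    moreover have "(\<Sum>a<n. r a (\<lambda>i. f i x) * f j x ^ a) = 0" if "x \<in> V" for x
      using P(2) that by (simp add: vanishes_def r(2))
    ultimately have "alg (f ` I) V (f j)" by (intro algI[of "\<lambda>a x. r a (\<lambda>i. f i x)" _ n])
    then show False using assms(2) by blast
  qed
  then have "vanishes UNIV (r a)" if "a < n" for a
    using assms(1) r(1) that unfolding indep_def by blast
  then show "vanishes UNIV P" by (simp add: vanishes_def r(2))
qed

text \<open>It suffices that \<open>g\<close> is not algebraic over the family with some index
  removed. Otherwise take a smallest subfamily \<open>S\<close> over which \<open>g\<close> is
  algebraic and a member \<open>i\<close> of it: exchange makes \<open>f i\<close> algebraic over
  \<open>g\<close> and the other functions, and transitivity makes it algebraic over the others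
  alone, against independence.\<close>

lemma indep_exchange:
  fixes f :: "'i \<Rightarrow> 'x \<Rightarrow> 'k::field_char_0"
  assumes irr: "irr (poly_functions C) V" and f: "f ` I \<subseteq> poly_functions C" and g: "g \<in> poly_functions C"
    and fin: "finite I" and ne: "I \<noteq> {}" and g_alg: "\<not> alg {} V g" and ind: "indep f I V"
  shows "\<exists>i\<in>I. indep (f(i := g)) I V"
proof -
  have irr': "irr (poly_functions (insert g (f ` J))) V" if "J \<subseteq> I" for J
    by (rule irr_mono[OF irr]) (use pf_mono[of "insert g (f ` J)" "poly_functions C"] f g that
        in \<open>auto simp: pf_idem\<close>)
  have "\<exists>i\<in>I. \<not> alg (f ` (I - {i})) V g"
  proof (rule ccontr)
    assume neg: "\<not> ?thesis"
    define S where "S = arg_min card (\<lambda>S. S \<subseteq> I \<and> alg (f ` S) V g)"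
    have "I \<subseteq> I \<and> alg (f ` I) V g"
      using neg ne alg_mono[of _ V g "f ` I"] by (metis Diff_subset all_not_in_conv image_mono order_refl)
    then have S: "S \<subseteq> I \<and> alg (f ` S) V g"
      unfolding S_def by (rule arg_min_natI)
    have min: "\<not> alg (f ` T) V g" if "T \<subset> S" for T
    proof
      assume "alg (f ` T) V g"
      then have "card S \<le> card T"
        unfolding S_def using that S by (intro arg_min_nat_le) auto
      then show False using psubset_card_mono[OF _ that] finite_subset[OF _ fin] S by fastforce
    qed
    have "S \<noteq> {}" using S g_alg by auto
    then obtain i where i: "i \<in> S" by blast
    have "f ` S = insert (f i) (f ` (S - {i}))" using i by blast
    then have "alg (insert g (f ` (S - {i}))) V (f i)"
      using alg_exchange[of "f i" "f ` (S - {i})" V g] S min[of "S - {i}"] i by auto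
    then have "alg (insert g (f ` (I - {i}))) V (f i)"
      by (rule alg_mono) (use S in auto)
    moreover have "alg (f ` (I - {i})) V g" using neg i S by blast
    ultimately have "alg (f ` (I - {i})) V (f i)"
      using alg_trans[OF irr'[of "I - {i}"]] by blast
    then show False using indep_not_alg[OF ind, of i] i S by blast
  qed
  then obtain i where i: "i \<in> I" "\<not> alg (f ` (I - {i})) V g" by blast
  have "indep (f(i := g)) (I - {i}) V"
    using indep_subset[OF ind, of "I - {i}"] indep_cong[of "I - {i}" V f "f(i := g)"] by auto
  moreover have "(f(i := g)) ` (I - {i}) = f ` (I - {i})" by (rule image_cong) auto
  ultimately have "indep (f(i := g)) (insert i (I - {i})) V"
    using i(2) by (intro indep_insert) auto
  then show ?thesis using i(1) by (auto simp: insert_absorb)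
qed

text \<open>If \<open>g\<close> were algebraic over the constants, its values on \<open>V\<close>
  would be among the finitely many roots of a polynomial, so the product of the factors
  \<open>g - t\<close> over these roots would vanish. Irreducibility makes one factor vanish, which
  says that \<open>g\<close> is constant.\<close>

lemma nonconstant_not_alg:
  fixes g :: "'x \<Rightarrow> 'k::field_char_0"
  assumes irr: "irr (poly_functions C) V" and g: "g \<in> poly_functions C"
    and xy: "x \<in> V" "y \<in> V" "g x \<noteq> g y"
  shows "\<not> alg {} V g"
proof
  assume "alg {} V g"
  then obtain n c where c: "\<And>a. c a \<in> poly_functions {}" "\<exists>a<n. \<not> vanishes V (c a)"
    "\<And>x. x \<in> V \<Longrightarrow> (\<Sum>a<n. c a x * g x ^ a) = 0"
    unfolding alg_def by blast
  have const: "h z = h x" if "h \<in> poly_functions {}" for h z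
    using that by induction auto
  define p where "p = (\<Sum>a<n. monom (c a x) a)"
  have root: "poly p (g z) = 0" if "z \<in> V" for z
    using c(3)[OF that] const[OF c(1), of _ z] by (simp add: p_def poly_sum poly_monom)
  obtain a z where "a < n" "c a z \<noteq> 0" using c(2) by (auto simp: vanishes_def)
  then have "coeff p a \<noteq> 0"
    using const[OF c(1), of a z] by (simp add: p_def coeff_sum if_distrib cong: if_cong)
  then have "p \<noteq> 0" by auto
  then have fin: "finite {t. poly p t = 0}" by (rule poly_roots_finite)
  have ne: "\<not> vanishes V (\<lambda>z. g z - t)" for t
    using xy unfolding vanishes_def by (metis right_minus_eq)
  have "\<not> vanishes V (\<lambda>z. \<Prod>t\<in>T. g z - t) \<and> (\<lambda>z. \<Prod>t\<in>T. g z - t) \<in> poly_functions C"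
    if "finite T" for T
    using that
  proof (induction T rule: finite_induct)
    case empty
    show ?case using xy(1) by (auto simp: vanishes_def intro: pf)
  next
    case (insert t T)
    have gt: "(\<lambda>z. g z - t) \<in> poly_functions C" by (intro pf g)
    have "\<not> vanishes V (\<lambda>z. (g z - t) * (\<Prod>t\<in>T. g z - t))"
      by (rule irr_mult[OF irr gt]) (use insert ne in auto)
    moreover have "(\<lambda>z. (g z - t) * (\<Prod>t\<in>T. g z - t)) \<in> poly_functions C"
      using insert gt by (intro poly_functions.mult) auto
    ultimately show ?case using insert(1,2) by simp
  qed
  from this[OF fin] show False
    using root fin by (auto simp: vanishes_def)
qed

section \<open>Chevalley's theorem\<close>

text \<open>A relation of least length has a leading coefficient that does not vanish identically on
  \<open>V\<close>, and leaves the powers of \<open>v\<close> below \<open>p\<close> independent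
  over \<open>C\<close>. In Chevalley's theorem the latter shows that the remainder of a function
  vanishing on \<open>V\<close> has coefficients vanishing on \<open>V\<close>.\<close>

lemma alg_minimal_relation:
  assumes "alg C V v"
  obtains c p where "\<forall>i. c i \<in> poly_functions C" "0 < p" "\<not> vanishes V (c p)"
    "\<forall>x\<in>V. (\<Sum>i\<le>p. c i x * v x ^ i) = 0"
    "\<forall>e. (\<forall>i. e i \<in> poly_functions C) \<longrightarrow> (\<forall>x\<in>V. (\<Sum>i<p. e i x * v x ^ i) = 0) \<longrightarrow>
      (\<forall>i<p. vanishes V (e i))"
proof -
  define rel where "rel n c \<longleftrightarrow> (\<forall>i. c i \<in> poly_functions C) \<and> (\<exists>i<n. \<not> vanishes V (c i)) \<and>
    (\<forall>x\<in>V. (\<Sum>i<n. c i x * v x ^ i) = 0)" for n c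
  define n where "n = (LEAST n. \<exists>c. rel n c)"
  have "\<exists>n. \<exists>c. rel n c" using assms unfolding alg_def rel_def by blast
  then have "\<exists>c. rel n c" unfolding n_def by (rule LeastI_ex)
  then obtain c where c: "rel n c" ..
  have min: "\<not> rel m e" if "m < n" for m e
    using not_less_Least[of m "\<lambda>n. \<exists>c. rel n c"] that unfolding n_def by blast
  obtain p where p: "n = Suc p" using c by (cases n) (auto simp: rel_def)
  have cp: "\<not> vanishes V (c p)"
  proof
    assume v: "vanishes V (c p)"
    have "rel p c"
      unfolding rel_def
    proof (intro conjI ballI)
      show "\<forall>i. c i \<in> poly_functions C" using c by (simp add: rel_def)
      show "\<exists>i<p. \<not> vanishes V (c i)"
        using c v unfolding rel_def p by (metis less_antisym)
      show "(\<Sum>i<p. c i x * v x ^ i) = 0" if "x \<in> V" for x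
        using c v that by (simp add: rel_def p vanishes_def)
    qed
    then show False using min p by blast
  qed
  have "p \<noteq> 0"
  proof
    assume "p = 0"
    then have "c p x = 0" if "x \<in> V" for x using c that by (simp add: rel_def p)
    then show False using cp by (simp add: vanishes_def)
  qed
  show ?thesis
  proof (rule that[of c p])
    show "\<forall>e. (\<forall>i. e i \<in> poly_functions C) \<longrightarrow> (\<forall>x\<in>V. (\<Sum>i<p. e i x * v x ^ i) = 0) \<longrightarrow>
      (\<forall>i<p. vanishes V (e i))"
    proof (intro allI impI)
      fix e i assume e: "\<forall>i. e i \<in> poly_functions C" "\<forall>x\<in>V. (\<Sum>i<p. e i x * v x ^ i) = 0" "i < p"
      have "\<not> rel p e" using min p by simp
      then show "vanishes V (e i)" using e unfolding rel_def by blast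
    qed
  qed (use c cp \<open>p \<noteq> 0\<close> in \<open>auto simp: rel_def p lessThan_Suc_atMost\<close>)
qed

text \<open>A point \<open>u\<close> that satisfies all relations holding on \<open>V\<close>
  between the coordinates in \<open>I\<close> is extended by a coordinate \<open>t\<close>. If
  coordinate \<open>j\<close> is transcendental, the coefficients of every further relation vanish
  at \<open>u\<close>, so any \<open>t\<close> satisfies it, and \<open>h'\<close> is a coefficient
  of \<open>h\<close>. If it is algebraic, \<open>t\<close> is a root of the minimal relation, and
  \<open>h'\<close> is the leading coefficient times a function in the variables \<open>I\<close>
  that is a multiple of \<open>h\<close> on \<open>V\<close>.\<close>

lemma chevalley_step:
  fixes V :: "('i \<Rightarrow> 'k::{alg_closed_field, field_char_0}) set"
  assumes irr: "irr (Pol (insert j I)) V" and j: "j \<notin> I"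
    and h: "h \<in> Pol (insert j I)" "\<not> vanishes V h"
  shows "\<exists>h'\<in>Pol I. \<not> vanishes V h' \<and> (\<forall>u. h' u \<noteq> 0 \<longrightarrow> (\<forall>f\<in>Pol I. vanishes V f \<longrightarrow> f u = 0) \<longrightarrow>
    (\<exists>t. h (u(j := t)) \<noteq> 0 \<and> (\<forall>f\<in>Pol (insert j I). vanishes V f \<longrightarrow> f (u(j := t)) = 0)))"
proof -
  define g :: "('i \<Rightarrow> 'k) \<Rightarrow> 'k" where "g = (\<lambda>u. u j)"
  define S :: "(('i \<Rightarrow> 'k) \<Rightarrow> 'k) set" where "S = (\<lambda>i u. u i) ` I"
  have PI: "Pol I = poly_functions S" and PJ: "Pol (insert j I) = poly_functions (insert g S)"
    by (simp_all add: S_def g_def Pol_def)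
  have upd: "f (u(j := t)) = f u" if "f \<in> poly_functions S" for f u t
    by (rule Pol_cong[of f I]) (use j that PI in auto)
  have gS: "g \<in> poly_functions (insert g S)" by (rule poly_functions.coord) simp
  have sub: "poly_functions S \<subseteq> poly_functions (insert g S)" by (rule pf_mono) auto
  show ?thesis
  proof (cases "alg S V g")
    case False
    have van: "vanishes V (c i)" if "\<forall>i. c i \<in> poly_functions S"
      "\<forall>x\<in>V. (\<Sum>i<n. c i x * g x ^ i) = 0" "i < n" for c n i
    proof (rule ccontr)
      assume "\<not> vanishes V (c i)"
      then have "\<exists>i<n. \<not> vanishes V (c i)" using that by blast
      then have "alg S V g" using that by (intro algI[of c S n]) auto
      then show False using False by blast
    qed
    obtain c n where c: "\<forall>i. c i \<in> poly_functions S" "\<forall>u. h u = (\<Sum>i<n. c i u * g u ^ i)"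
      using pf_insert_expand[OF h(1)[unfolded PJ]] .
    obtain i where i: "i < n" "\<not> vanishes V (c i)"
      using h(2) c(2) unfolding vanishes_def by (metis (no_types, lifting) lessThan_iff mult_zero_left sum.neutral)
    show ?thesis
    proof (intro bexI[of _ "c i"] conjI allI impI)
      show "c i \<in> Pol I" using c(1) by (simp add: PI)
      show "\<not> vanishes V (c i)" by (rule i(2))
      fix u assume u: "c i u \<noteq> 0" "\<forall>f\<in>Pol I. vanishes V f \<longrightarrow> f u = 0"
      define p where "p = (\<Sum>i<n. monom (c i u) i)"
      have "coeff p i = c i u" using i by (simp add: p_def coeff_sum if_distrib cong: if_cong)
      then have "p \<noteq> 0" using u by auto
      then obtain t where t: "poly p t \<noteq> 0" using poly_all_0_iff_0 by blast
      have "h (u(j := t)) = poly p t"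
        using c by (simp add: p_def poly_sum poly_monom upd g_def)
      moreover have "f (u(j := t)) = 0" if f: "f \<in> Pol (insert j I)" "vanishes V f" for f
      proof -
        obtain d m where d: "\<forall>i. d i \<in> poly_functions S" "\<forall>u. f u = (\<Sum>i<m. d i u * g u ^ i)"
          using pf_insert_expand[OF f(1)[unfolded PJ]] .
        have "\<forall>x\<in>V. (\<Sum>i<m. d i x * g x ^ i) = 0" using f(2) d(2) by (simp add: vanishes_def)
        from van[OF d(1) this] have "d i u = 0" if "i < m" for i
          using that u(2) d(1) by (simp add: PI)
        then show ?thesis using d by (simp add: upd)
      qed
      ultimately show "\<exists>t. h (u(j := t)) \<noteq> 0 \<and>
          (\<forall>f\<in>Pol (insert j I). vanishes V f \<longrightarrow> f (u(j := t)) = 0)"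
        using t by (intro exI[of _ t]) auto
    qed
  next
    case True
    obtain c p where "\<forall>i. c i \<in> poly_functions S" "0 < p" "\<not> vanishes V (c p)"
      "\<forall>x\<in>V. (\<Sum>i\<le>p. c i x * g x ^ i) = 0"
      and min: "\<forall>e. (\<forall>i. e i \<in> poly_functions S) \<longrightarrow> (\<forall>x\<in>V. (\<Sum>i<p. e i x * g x ^ i) = 0) \<longrightarrow>
        (\<forall>i<p. vanishes V (e i))"
      using alg_minimal_relation[OF True] .
    note c = this(1-4)[rule_format]
    \<comment> \<open>\<open>W\<close> contains both \<open>V\<close> and the new point
      \<open>u(j := t)\<close>, so identities obtained by pseudo-division modulo the minimal
      relation hold at both.\<close>
    define W where "W = {u. (\<Sum>i\<le>p. c i u * g u ^ i) = 0}"
    obtain s r where "s \<in> poly_functions (insert g S)" "r \<in> poly_functions S" "\<not> vanishes V r"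
      "\<forall>x\<in>V. h x * s x = r x"
      using alg_multiple_in_base[OF irr[unfolded PJ] True h[unfolded PJ]] .
    note sr = this[rule_format]
    show ?thesis
    proof (intro bexI[of _ "\<lambda>u. c p u * r u"] conjI allI impI)
      show "(\<lambda>u. c p u * r u) \<in> Pol I" unfolding PI by (intro pf c sr)
      show "\<not> vanishes V (\<lambda>u. c p u * r u)"
        by (rule irr_mult[OF irr_mono[OF irr[unfolded PJ] sub]]) (intro c sr)+
      fix u assume u: "c p u * r u \<noteq> 0" "\<forall>f\<in>Pol I. vanishes V f \<longrightarrow> f u = 0"
      obtain t where t: "(\<Sum>i\<le>p. c i u * t ^ i) = 0"
        using alg_closed[of p "\<lambda>i. c i u"] c(2) u(1) by auto
      have W: "u(j := t) \<in> W"
        using t by (simp add: W_def upd[OF c(1)]) (simp add: g_def)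
      have van: "f (u(j := t)) = 0" if f: "f \<in> poly_functions (insert g S)" "vanishes V f" for f
      proof -
        have "\<exists>N e. (\<forall>a. e a \<in> poly_functions S) \<and>
            (\<forall>x\<in>W. c p x ^ N * f x = (\<Sum>a<p. e a x * g x ^ a))"
          by (rule pseudo_division[OF c(1,2) _ f(1)]) (simp add: W_def)
        then obtain N e where e: "\<forall>a. e a \<in> poly_functions S"
          "\<forall>x\<in>W. c p x ^ N * f x = (\<Sum>a<p. e a x * g x ^ a)" by (elim exE conjE)
        have "V \<subseteq> W" using c(4) by (auto simp: W_def)
        then have "(\<Sum>a<p. e a x * g x ^ a) = 0" if "x \<in> V" for x
          using e(2) f(2) that unfolding vanishes_def by (metis mult_zero_right subsetD)
        then have "vanishes V (e a)" if "a < p" for a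
          using min[rule_format, of e] e(1) that by blast
        then have "e a u = 0" if "a < p" for a
          using u(2) e(1) that by (simp add: PI)
        then have "c p (u(j := t)) ^ N * f (u(j := t)) = 0"
          using e W by (simp add: upd)
        then show ?thesis using u(1) by (simp add: upd[OF c(1)])
      qed
      \<comment> \<open>The identity \<open>h * s = r\<close> is known on \<open>V\<close> only. As
        a relation on \<open>V\<close> it carries over to the new point, where \<open>r\<close> is
        nonzero and hence so is \<open>h\<close>.\<close>
      have "h (u(j := t)) * s (u(j := t)) - r (u(j := t)) = 0"
      proof (rule van)
        show "(\<lambda>x. h x * s x - r x) \<in> poly_functions (insert g S)"
          using sr(2) sub h(1) by (intro pf sr(1)) (auto simp: PJ)
        show "vanishes V (\<lambda>x. h x * s x - r x)" using sr(4) by (simp add: vanishes_def)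
      qed
      then have "h (u(j := t)) \<noteq> 0" using u(1) by (auto simp: upd[OF sr(2)])
      then show "\<exists>t. h (u(j := t)) \<noteq> 0 \<and>
          (\<forall>f\<in>Pol (insert j I). vanishes V f \<longrightarrow> f (u(j := t)) = 0)"
        using van by (intro exI[of _ t]) (simp add: PJ)
    qed
  qed
qed

lemma chevalley_projection:
  fixes V :: "('i \<Rightarrow> 'k::{alg_closed_field, field_char_0}) set"
  assumes "finite J" "irr (Pol (I \<union> J)) V" "I \<inter> J = {}"
    and "h \<in> Pol (I \<union> J)" "\<not> vanishes V h"
  shows "\<exists>h'\<in>Pol I. \<not> vanishes V h' \<and> (\<forall>u. h' u \<noteq> 0 \<longrightarrow> (\<forall>f\<in>Pol I. vanishes V f \<longrightarrow> f u = 0) \<longrightarrow>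
    (\<exists>w. (\<forall>i\<in>I. w i = u i) \<and> h w \<noteq> 0 \<and> (\<forall>f\<in>Pol (I \<union> J). vanishes V f \<longrightarrow> f w = 0)))"
  using assms
proof (induction J arbitrary: h rule: finite_induct)
  case empty
  then show ?case by (intro bexI[of _ h]) auto
next
  case (insert j J)
  have "irr (Pol (insert j (I \<union> J))) V" "j \<notin> I \<union> J" "h \<in> Pol (insert j (I \<union> J))"
    using insert by auto
  from chevalley_step[OF this insert.prems(4)]
  obtain h1 where h1: "h1 \<in> Pol (I \<union> J)" "\<not> vanishes V h1"
    "\<And>u. h1 u \<noteq> 0 \<Longrightarrow> (\<forall>f\<in>Pol (I \<union> J). vanishes V f \<longrightarrow> f u = 0) \<Longrightarrow>
      \<exists>t. h (u(j := t)) \<noteq> 0 \<and> (\<forall>f\<in>Pol (insert j (I \<union> J)). vanishes V f \<longrightarrow> f (u(j := t)) = 0)"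
    by blast
  have "irr (Pol (I \<union> J)) V" by (rule irr_mono[OF insert.prems(1) Pol_mono]) auto
  moreover have "I \<inter> J = {}" using insert.prems by auto
  ultimately obtain h' where h': "h' \<in> Pol I" "\<not> vanishes V h'"
    "\<And>u. h' u \<noteq> 0 \<Longrightarrow> (\<forall>f\<in>Pol I. vanishes V f \<longrightarrow> f u = 0) \<Longrightarrow>
      \<exists>w. (\<forall>i\<in>I. w i = u i) \<and> h1 w \<noteq> 0 \<and> (\<forall>f\<in>Pol (I \<union> J). vanishes V f \<longrightarrow> f w = 0)"
    using insert.IH[of h1] h1(1,2) by blast
  show ?case
  proof (intro bexI[of _ h'] conjI allI impI)
    fix u assume "h' u \<noteq> 0" "\<forall>f\<in>Pol I. vanishes V f \<longrightarrow> f u = 0"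
    from h'(3)[OF this] obtain w where w: "\<forall>i\<in>I. w i = u i" "h1 w \<noteq> 0"
      "\<forall>f\<in>Pol (I \<union> J). vanishes V f \<longrightarrow> f w = 0" by blast
    from h1(3)[OF w(2,3)] obtain t where t: "h (w(j := t)) \<noteq> 0"
      "\<forall>f\<in>Pol (insert j (I \<union> J)). vanishes V f \<longrightarrow> f (w(j := t)) = 0" by blast
    have "j \<notin> I" using insert by auto
    then show "\<exists>w. (\<forall>i\<in>I. w i = u i) \<and> h w \<noteq> 0 \<and> (\<forall>f\<in>Pol (I \<union> insert j J). vanishes V f \<longrightarrow> f w = 0)"
      using t w(1) by (intro exI[of _ "w(j := t)"]) auto
  qed (use h' in auto)
qed

text \<open>\<open>V\<close> is Zariski closed with respect to the coordinates \<open>c\<close>: it contains every point at which all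
  polynomial relations between the coordinates on \<open>V\<close> hold.\<close>

definition zclosed :: "('j \<Rightarrow> 'x \<Rightarrow> 'k::comm_ring_1) \<Rightarrow> 'x set \<Rightarrow> bool" where
  "zclosed c V \<longleftrightarrow> (\<forall>u. (\<forall>P\<in>Pol UNIV. vanishes V (\<lambda>x. P (\<lambda>j. c j x)) \<longrightarrow> P u = 0) \<longrightarrow>
     (\<exists>x\<in>V. \<forall>j. c j x = u j))"

text \<open>Passing to the graph turns the map into a projection: \<open>Inl\<close> indexes the
  values \<open>f i\<close> and \<open>Inr\<close> the coordinates of the source. A point
  \<open>w\<close> over \<open>u\<close> that satisfies all relations of the graph has its
  \<open>Inr\<close> part in \<open>V\<close> because \<open>V\<close> is closed, and the relation
  expressing \<open>f i\<close> by the coordinates makes its \<open>Inl\<close> part the value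
  there.\<close>

theorem chevalley:
  fixes c :: "'j::finite \<Rightarrow> 'x \<Rightarrow> 'k::{alg_closed_field, field_char_0}" and f :: "'i \<Rightarrow> 'x \<Rightarrow> 'k"
  assumes V: "zclosed c V" "irr (poly_functions (range c)) V"
    and fI: "f ` I \<subseteq> poly_functions (range c)"
    and h: "h \<in> poly_functions (range c)" "\<not> vanishes V h"
  shows "\<exists>h'\<in>Pol I. \<not> vanishes V (\<lambda>x. h' (\<lambda>i. f i x)) \<and>
    (\<forall>u. h' u \<noteq> 0 \<longrightarrow> (\<forall>P\<in>Pol I. vanishes V (\<lambda>x. P (\<lambda>i. f i x)) \<longrightarrow> P u = 0) \<longrightarrow>
      (\<exists>x\<in>V. h x \<noteq> 0 \<and> (\<forall>i\<in>I. f i x = u i)))"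
proof -
  have f: "f i \<in> poly_functions (range c)" if "i \<in> I" for i using fI that by blast
  define \<iota> where "\<iota> x = case_sum (\<lambda>i. f i x) (\<lambda>j. c j x)" for x
  have \<iota>: "\<iota> x (Inl i) = f i x" "\<iota> x (Inr j) = c j x" for x i j
    by (simp_all add: \<iota>_def)
  let ?I = "Inl ` I :: ('i + 'j) set" let ?J = "range Inr :: ('i + 'j) set"
  have comp: "(\<lambda>x. P (\<iota> x)) \<in> poly_functions (range c)" if "P \<in> Pol (?I \<union> ?J)" for P
    by (rule Pol_comp[OF that]) (auto simp: \<iota> intro: f poly_functions.coord)
  have irr: "irr (Pol (?I \<union> ?J)) (\<iota> ` V)"
    unfolding irr_def
  proof (intro conjI ballI impI)
    show "\<iota> ` V \<noteq> {}" using V(2) by (auto simp: irr_def)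
    fix P Q assume PQ: "P \<in> Pol (?I \<union> ?J)" "Q \<in> Pol (?I \<union> ?J)" "vanishes (\<iota> ` V) (\<lambda>u. P u * Q u)"
    then have "vanishes V (\<lambda>x. P (\<iota> x) * Q (\<iota> x))" by (simp add: vanishes_def)
    then have "vanishes V (\<lambda>x. P (\<iota> x)) \<or> vanishes V (\<lambda>x. Q (\<iota> x))"
      using irr_mult[OF V(2) comp[OF PQ(1)] comp[OF PQ(2)]] by blast
    then show "vanishes (\<iota> ` V) P \<or> vanishes (\<iota> ` V) Q" by (simp add: vanishes_def)
  qed
  obtain H where H: "H \<in> Pol UNIV" "\<forall>x. h x = H (\<lambda>j. c j x)"
    using pf_imageE[OF h(1)] .
  define H' where "H' w = H (\<lambda>j. w (Inr j))" for w :: "'i + 'j \<Rightarrow> 'k"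
  have H'1: "H' \<in> Pol (?I \<union> ?J)"
    unfolding H'_def Pol_def by (rule Pol_comp[OF H(1)]) (auto intro: poly_functions.coord)
  have H'2: "\<not> vanishes (\<iota> ` V) H'"
    using h(2) H(2) by (simp add: vanishes_def H'_def \<iota>)
  have "finite ?J" "?I \<inter> ?J = {}" by auto
  from chevalley_projection[OF this(1) irr this(2) H'1 H'2] obtain h' where h': "h' \<in> Pol ?I" "\<not> vanishes (\<iota> ` V) h'" and
    ex: "\<forall>u. h' u \<noteq> 0 \<longrightarrow> (\<forall>f\<in>Pol ?I. vanishes (\<iota> ` V) f \<longrightarrow> f u = 0) \<longrightarrow>
      (\<exists>w. (\<forall>i\<in>?I. w i = u i) \<and> H' w \<noteq> 0 \<and> (\<forall>f\<in>Pol (?I \<union> ?J). vanishes (\<iota> ` V) f \<longrightarrow> f w = 0))"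
    by (elim bexE conjE)
  \<comment> \<open>The \<open>Inr\<close> coordinates are filled with 0; polynomials in
    \<open>Pol ?I\<close> depend on the \<open>Inl\<close> coordinates only.\<close>
  define e :: "('i \<Rightarrow> 'k) \<Rightarrow> 'i + 'j \<Rightarrow> 'k" where "e u = case_sum u (\<lambda>_. 0)" for u
  have pull: "(\<lambda>u. P (e u)) \<in> Pol I" if "P \<in> Pol ?I" for P
    unfolding Pol_def by (rule Pol_comp[OF that]) (auto simp: e_def intro: poly_functions.coord)
  have eq: "P (e (\<lambda>i. f i x)) = P (\<iota> x)" if "P \<in> Pol ?I" for P x
    by (rule Pol_cong[OF that]) (auto simp: e_def \<iota>)
  show ?thesis
  proof (intro bexI[of _ "\<lambda>u. h' (e u)"] conjI allI impI)
    show "(\<lambda>u. h' (e u)) \<in> Pol I" by (rule pull[OF h'(1)])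
    show "\<not> vanishes V (\<lambda>x. h' (e (\<lambda>i. f i x)))"
      using h'(2) eq[OF h'(1)] by (simp add: vanishes_def)
    fix u assume u: "h' (e u) \<noteq> 0" "\<forall>P\<in>Pol I. vanishes V (\<lambda>x. P (\<lambda>i. f i x)) \<longrightarrow> P u = 0"
    have "\<forall>P\<in>Pol ?I. vanishes (\<iota> ` V) P \<longrightarrow> P (e u) = 0"
    proof (intro ballI impI)
      fix P assume P: "P \<in> Pol ?I" "vanishes (\<iota> ` V) P"
      then have "vanishes V (\<lambda>x. P (e (\<lambda>i. f i x)))" using eq[OF P(1)] by (simp add: vanishes_def)
      then show "P (e u) = 0" by (rule u(2)[rule_format, OF pull[OF P(1)]])
    qed
    from ex[THEN spec, THEN mp, OF u(1), THEN mp, OF this] obtain w where w: "\<forall>i\<in>?I. w i = e u i" "H' w \<noteq> 0"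
      "\<forall>P\<in>Pol (?I \<union> ?J). vanishes (\<iota> ` V) P \<longrightarrow> P w = 0" by blast
    have "P (\<lambda>j. w (Inr j)) = 0" if P: "P \<in> Pol UNIV" "vanishes V (\<lambda>x. P (\<lambda>j. c j x))" for P
    proof -
      have "(\<lambda>w. P (\<lambda>j. w (Inr j))) \<in> Pol (?I \<union> ?J)"
        unfolding Pol_def by (rule Pol_comp[OF P(1)]) (auto intro: poly_functions.coord)
      moreover have "vanishes (\<iota> ` V) (\<lambda>w. P (\<lambda>j. w (Inr j)))"
        using P(2) by (simp add: vanishes_def \<iota>)
      ultimately show ?thesis using w(3) by blast
    qed
    then obtain x where x: "x \<in> V" "\<forall>j. c j x = w (Inr j)"
      using V(1) unfolding zclosed_def by (elim allE[of _ "\<lambda>j. w (Inr j)"]) auto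
    have w_eq: "P w = P (\<iota> x)" if "P \<in> Pol ?J" for P
      by (rule Pol_cong[OF that]) (auto simp: \<iota> x(2))
    have "f i x = u i" if i: "i \<in> I" for i
    proof -
      obtain F where F: "F \<in> Pol UNIV" "\<forall>x. f i x = F (\<lambda>j. c j x)"
        using pf_imageE[OF f[OF i]] .
      have "(\<lambda>w. w (Inl i) - F (\<lambda>j. w (Inr j))) \<in> Pol (?I \<union> ?J)"
        unfolding Pol_def
        by (intro pf_diff Pol_comp[OF F(1)]) (auto intro!: poly_functions.coord simp: i)
      moreover have "vanishes (\<iota> ` V) (\<lambda>w. w (Inl i) - F (\<lambda>j. w (Inr j)))"
        using F(2) by (simp add: vanishes_def \<iota>)
      ultimately have "w (Inl i) - F (\<lambda>j. w (Inr j)) = 0" using w(3) by blast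
      moreover have "F (\<lambda>j. w (Inr j)) = f i x" using F(2) x(2) by simp
      ultimately show ?thesis using w(1) i by (simp add: e_def)
    qed
    moreover have "h x \<noteq> 0" using w(2) H(2) x(2) by (simp add: H'_def)
    ultimately show "\<exists>x\<in>V. h x \<noteq> 0 \<and> (\<forall>i\<in>I. f i x = u i)" using x(1) by blast
  qed
qed

section \<open>Noetherian rings of functions\<close>

inductive_set fideal :: "('x \<Rightarrow> 'k::comm_ring_1) set \<Rightarrow> ('x \<Rightarrow> 'k) set \<Rightarrow> ('x \<Rightarrow> 'k) set"
  for R T where
  zero: "(\<lambda>x. 0) \<in> fideal R T"
| step: "\<lbrakk>r \<in> R; t \<in> T; s \<in> fideal R T\<rbrakk> \<Longrightarrow> (\<lambda>x. r x * t x + s x) \<in> fideal R T"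

definition noetherian :: "('x \<Rightarrow> 'k::comm_ring_1) set \<Rightarrow> bool" where
  "noetherian R \<longleftrightarrow> (\<forall>S\<subseteq>R. \<exists>T\<subseteq>S. finite T \<and> S \<subseteq> fideal R T)"

lemma fideal_generator: "t \<in> T \<Longrightarrow> t \<in> fideal (poly_functions C) T"
  using fideal.step[of "\<lambda>x. 1" "poly_functions C" t T "\<lambda>x. 0"]
  by (auto intro: fideal.zero pf)

lemma fideal_add: "f \<in> fideal R T \<Longrightarrow> g \<in> fideal R T \<Longrightarrow> (\<lambda>x. f x + g x) \<in> fideal R T"
  by (induction rule: fideal.induct) (auto simp: add.assoc intro: fideal.step)

lemma fideal_mult:
  assumes "f \<in> fideal (poly_functions C) T" "r \<in> poly_functions C"
  shows "(\<lambda>x. r x * f x) \<in> fideal (poly_functions C) T"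
  using assms(1)
proof induction
  case zero
  then show ?case by (simp add: fideal.zero)
next
  case (step q t s)
  have "(\<lambda>x. (r x * q x) * t x + r x * s x) \<in> fideal (poly_functions C) T"
    by (rule fideal.step[OF poly_functions.mult[OF assms(2) step(1)] step(2) step.IH])
  then show ?case by (simp add: algebra_simps)
qed

lemma fideal_subset:
  assumes "T \<subseteq> fideal (poly_functions C) U"
  shows "fideal (poly_functions C) T \<subseteq> fideal (poly_functions C) U"
proof
  fix f assume "f \<in> fideal (poly_functions C) T"
  then show "f \<in> fideal (poly_functions C) U"
    by induction (use assms in \<open>auto intro!: fideal.zero fideal_add fideal_mult\<close>)
qed

lemma fideal_mono: "T \<subseteq> U \<Longrightarrow> fideal R T \<subseteq> fideal R U"
proof
  fix f assume "T \<subseteq> U" "f \<in> fideal R T"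
  from this(2,1) show "f \<in> fideal R U" by induction (auto intro: fideal.intros)
qed

lemma fideal_finite_generators:
  "f \<in> fideal R T \<Longrightarrow> \<exists>U\<subseteq>T. finite U \<and> f \<in> fideal R U"
proof (induction rule: fideal.induct)
  case zero
  then show ?case using fideal.zero by blast
next
  case (step r t s)
  then obtain U where U: "U \<subseteq> T" "finite U" "s \<in> fideal R U" by blast
  then have "s \<in> fideal R (insert t U)" using fideal_mono[of U "insert t U"] by blast
  then have "(\<lambda>x. r x * t x + s x) \<in> fideal R (insert t U)"
    by (intro fideal.step step) auto
  then show ?case using U step by (intro exI[of _ "insert t U"]) auto
qed

lemma fideal_vanishes:
  "f \<in> fideal R T \<Longrightarrow> (\<And>t. t \<in> T \<Longrightarrow> vanishes V t) \<Longrightarrow> vanishes V f"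
proof (induction rule: fideal.induct)
  case (step r t s)
  then have "vanishes V t" "vanishes V s" by blast+
  then show ?case by (simp add: vanishes_def)
qed (simp add: vanishes_def)

lemma noetherian_constants: "noetherian (poly_functions {} :: ('x \<Rightarrow> 'k::field) set)"
  unfolding noetherian_def
proof (intro allI impI)
  fix S :: "('x \<Rightarrow> 'k) set" assume S: "S \<subseteq> poly_functions {}"
  have const: "f x = f y" if "f \<in> poly_functions {}" for f :: "'x \<Rightarrow> 'k" and x y
    using that by induction auto
  show "\<exists>T\<subseteq>S. finite T \<and> S \<subseteq> fideal (poly_functions {}) T"
  proof (cases "S \<subseteq> {\<lambda>x. 0}")
    case True
    then show ?thesis by (intro exI[of _ "{}"]) (auto intro: fideal.zero)
  next
    case False
    then obtain t y where t: "t \<in> S" "t y \<noteq> 0" by fastforce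
    have "s \<in> fideal (poly_functions {}) {t}" if "s \<in> S" for s
    proof -
      have "(\<lambda>x. (s y / t y) * t x) \<in> fideal (poly_functions {}) {t}"
        by (intro fideal_mult fideal_generator pf) auto
      moreover have "(s y / t y) * t x = s x" for x
        using const[of t x y] const[of s x y] subsetD[OF S t(1)] subsetD[OF S that] t(2) by simp
      ultimately show ?thesis by simp
    qed
    then show ?thesis using t(1) by (intro exI[of _ "{t}"]) auto
  qed
qed

text \<open>Hilbert's argument: choose elements of least degree outside the ideal of their
  predecessors. Some leading coefficient is a combination of earlier ones, and subtracting the
  matching combination of earlier elements yields an element of lower degree that is still outside
  that ideal.\<close>

theorem hilbert_basis:
  fixes C :: "('x \<Rightarrow> 'k::comm_ring_1) set"
  assumes noeth: "noetherian (poly_functions C)"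
  shows "noetherian (poly_functions (insert g C))"
  unfolding noetherian_def
proof (intro allI impI)
  let ?A = "poly_functions (insert g C)"
  fix S assume S: "S \<subseteq> ?A"
  have sub: "poly_functions C \<subseteq> ?A" by (rule pf_mono) auto
  have gA: "g \<in> ?A" by (rule poly_functions.coord) simp
  \<comment> \<open>Since \<open>g\<close> may satisfy relations over \<open>C\<close>, expansions
    are not unique. The degree \<open>deg\<close> below is the least formal degree of any expansion,
    and leading coefficients belong to a chosen expansion of that degree.\<close>
  define rep where "rep f d c \<longleftrightarrow> (\<forall>i. c i \<in> poly_functions C) \<and> (\<forall>x. f x = (\<Sum>i\<le>d. c i x * g x ^ i))" for f d c
  have rep_ex: "\<exists>d c. rep f d c" if f: "f \<in> ?A" for f
  proof -
    obtain c n where "\<forall>i. c i \<in> poly_functions C" "\<forall>N x. n \<le> N \<longrightarrow> f x = (\<Sum>i<N. c i x * g x ^ i)"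
      using pf_insert_expand_padded[OF f] .
    then have "rep f n c" unfolding rep_def lessThan_Suc_atMost[symmetric]
      by (metis le_SucI order_refl)
    then show ?thesis by blast
  qed
  have S_A: "fideal ?A S \<subseteq> ?A"
  proof
    fix f assume "f \<in> fideal ?A S" then show "f \<in> ?A"
    proof induction
      case (step r t s)
      then show ?case using S by (intro poly_functions.add poly_functions.mult) auto
    qed (rule pf)
  qed
  have "\<exists>T\<subseteq>fideal ?A S. finite T \<and> fideal ?A S \<subseteq> fideal ?A T"
  proof (rule ccontr)
    assume neg: "\<not> ?thesis"
    define deg where "deg f = (LEAST d. \<exists>c. rep f d c)" for f
    define pick where "pick T = arg_min deg (\<lambda>f. f \<in> fideal ?A S - fideal ?A T)" for T
    define F where "F = rec_nat {} (\<lambda>_ T. insert (pick T) T)"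
    define f where "f n = pick (F n)" for n
    have F: "F n = f ` {..<n}" for n
      by (induction n) (auto simp: F_def f_def lessThan_Suc)
    have f_min: "deg (f n) \<le> deg h" if "h \<in> fideal ?A S - fideal ?A (f ` {..<n})" for n h
      unfolding f_def[of n] pick_def using that unfolding F[symmetric]
      by (intro arg_min_nat_le[of "\<lambda>h. h \<in> fideal ?A S - fideal ?A (F n)"])
    have f_in: "f n \<in> fideal ?A S - fideal ?A (f ` {..<n})" for n
    proof (induction n rule: less_induct)
      case (less n)
      then have "f ` {..<n} \<subseteq> fideal ?A S" by blast
      then obtain h where "h \<in> fideal ?A S - fideal ?A (f ` {..<n})" using neg by blast
      then show ?case
        unfolding f_def[of n] pick_def unfolding F[symmetric]
          by (intro arg_min_natI[of "\<lambda>h. h \<in> fideal ?A S - fideal ?A (F n)"])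
    qed
    have "\<forall>n. \<exists>c. rep (f n) (deg (f n)) c"
    proof
      fix n
      have "f n \<in> ?A" using f_in[of n] S_A by blast
      from rep_ex[OF this] show "\<exists>c. rep (f n) (deg (f n)) c"
        unfolding deg_def by (rule LeastI_ex[of "\<lambda>d. \<exists>c. rep (f n) d c"])
    qed
    from choice[OF this] obtain c where c: "\<forall>n. rep (f n) (deg (f n)) (c n)" ..
    have cC: "c n i \<in> poly_functions C" for n i using c by (simp add: rep_def)
    define a where "a n = c n (deg (f n))" for n
    have "range a \<subseteq> poly_functions C" unfolding a_def using cC by (rule image_subsetI)
    from noeth[unfolded noetherian_def, rule_format, OF this]
    obtain T where T: "T \<subseteq> range a" "finite T" "range a \<subseteq> fideal (poly_functions C) T"
      by (elim exE conjE)
    obtain M where M: "finite M" "T = a ` M" using finite_subset_image[OF T(2,1)] by blast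
    obtain N where "M \<subseteq> {..<N}" using finite_nat_bounded[OF M(1)] by blast
    then have "fideal (poly_functions C) T \<subseteq> fideal (poly_functions C) (a ` {..<N})"
      using M(2) by (intro fideal_mono) auto
    then have aN: "a N \<in> fideal (poly_functions C) (a ` {..<N})" using T(3) by blast
    have degs: "deg (f i) \<le> deg (f N)" if "i < N" for i
    proof -
      have "fideal ?A (f ` {..<i}) \<subseteq> fideal ?A (f ` {..<N})"
        using that by (intro fideal_mono) auto
      then show ?thesis using f_in[of N] by (intro f_min) auto
    qed
    \<comment> \<open>A combination of earlier leading coefficients becomes the coefficient at
      \<open>deg (f N)\<close> of an element of the ideal: each \<open>f i\<close> is multiplied by
      the power of \<open>g\<close> that makes up the difference in degree.\<close>
    have "\<exists>q e. q \<in> fideal ?A (f ` {..<N}) \<and> rep q (deg (f N)) e \<and> e (deg (f N)) = s"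
      if "s \<in> fideal (poly_functions C) (a ` {..<N})" for s
      using that
    proof induction
      case zero
      show ?case
        by (rule exI[of _ "\<lambda>x. 0"], rule exI[of _ "\<lambda>i x. 0"])
          (auto simp: rep_def intro: fideal.zero pf)
    next
      case (step r t s)
      then obtain q e i where q: "q \<in> fideal ?A (f ` {..<N})" "rep q (deg (f N)) e"
        "e (deg (f N)) = s" and i: "i < N" "t = a i" by blast
      define k where "k = deg (f N) - deg (f i)"
      have k: "deg (f N) = k + deg (f i)" using degs[OF i(1)] by (simp add: k_def)
      define q' where "q' x = q x + (r x * g x ^ k) * f i x" for x
      define e' where "e' j x = e j x + (if k \<le> j then r x * c i (j - k) x else 0)" for j x
      have "(\<lambda>x. r x * g x ^ k) \<in> ?A" using step(1) sub gA by (intro pf) auto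
      then have "q' \<in> fideal ?A (f ` {..<N})"
        unfolding q'_def using i(1)
        by (intro fideal_add[OF q(1)] fideal_mult[OF fideal_generator]) auto
      moreover have "rep q' (deg (f N)) e'"
        unfolding rep_def
      proof (intro conjI allI)
        have "e j \<in> poly_functions C" for j using q(2) by (simp add: rep_def)
        then show "e' j \<in> poly_functions C" for j
          unfolding e'_def by (intro pf step(1) cC)
        fix x
        have "f i x = (\<Sum>j\<le>deg (f i). c i j x * g x ^ j)" using c by (simp add: rep_def)
        then have "(r x * g x ^ k) * f i x = (\<Sum>j\<le>deg (f i). r x * c i j x * g x ^ (k + j))"
          by (simp add: sum_distrib_left power_add mult_ac)
        also have "\<dots> = (\<Sum>j\<in>{k..k + deg (f i)}. r x * c i (j - k) x * g x ^ j)"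
          by (rule sum.reindex_bij_witness[of _ "\<lambda>j. j - k" "\<lambda>j. k + j"]) auto
        also have "\<dots> = (\<Sum>j\<le>deg (f N). (if k \<le> j then r x * c i (j - k) x else 0) * g x ^ j)"
          unfolding k by (rule sum.mono_neutral_cong_left) auto
        finally show "q' x = (\<Sum>j\<le>deg (f N). e' j x * g x ^ j)"
          using q(2) by (simp add: q'_def e'_def rep_def distrib_right sum.distrib)
      qed
      moreover have "e' (deg (f N)) = (\<lambda>x. r x * t x + s x)"
      proof -
        have "k \<le> deg (f N)" "deg (f N) - k = deg (f i)" using k by simp_all
        then show ?thesis by (intro ext) (simp add: e'_def q(3) i(2) a_def)
      qed
      ultimately show ?case by blast
    qed
    from this[OF aN] obtain q e where q: "q \<in> fideal ?A (f ` {..<N})" "rep q (deg (f N)) e"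
      "e (deg (f N)) = a N" by blast
    define h where "h x = f N x + (-1) * q x" for x
    have mq: "(\<lambda>x. (-1) * q x) \<in> fideal ?A (f ` {..<N})"
      by (rule fideal_mult[OF q(1)]) (intro pf)
    have "f ` {..<N} \<subseteq> fideal ?A S" using f_in by blast
    then have "h \<in> fideal ?A S"
      unfolding h_def using f_in[of N] mq fideal_subset[of "f ` {..<N}" "insert g C" S]
      by (intro fideal_add) auto
    moreover have "h \<notin> fideal ?A (f ` {..<N})"
    proof
      assume "h \<in> fideal ?A (f ` {..<N})"
      from fideal_add[OF this q(1)] have "f N \<in> fideal ?A (f ` {..<N})"
        by (simp add: h_def)
      then show False using f_in[of N] by blast
    qed
    ultimately have le: "deg (f N) \<le> deg h" by (intro f_min) simp
    have h: "h x = (\<Sum>i<deg (f N). (c N i x + (-1) * e i x) * g x ^ i)" for x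
    proof -
      have "f N x = (\<Sum>i<deg (f N). c N i x * g x ^ i) + a N x * g x ^ deg (f N)"
        using c by (simp add: rep_def lessThan_Suc_atMost[symmetric] a_def)
      moreover have "q x = (\<Sum>i<deg (f N). e i x * g x ^ i) + a N x * g x ^ deg (f N)"
        using q(2,3) by (simp add: rep_def lessThan_Suc_atMost[symmetric])
      ultimately show ?thesis by (simp add: h_def left_diff_distrib sum_subtractf)
    qed
    have "deg (f N) \<noteq> 0"
    proof
      assume "deg (f N) = 0"
      then have "h = (\<lambda>x. 0)" using h by auto
      then show False using \<open>h \<notin> fideal ?A (f ` {..<N})\<close> fideal.zero by auto
    qed
    then obtain d where d: "deg (f N) = Suc d" using not0_implies_Suc by blast
    have "e i \<in> poly_functions C" for i using q(2) by (simp add: rep_def)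
    then have "(\<lambda>x. c N i x + (-1) * e i x) \<in> poly_functions C" for i by (intro pf cC)
    then have "rep h d (\<lambda>i x. c N i x + (-1) * e i x)"
      unfolding rep_def using h by (simp add: d lessThan_Suc_atMost)
    then have "deg h \<le> d" unfolding deg_def by (intro Least_le) blast
    then show False using le d by simp
  qed
  then obtain T where T: "T \<subseteq> fideal ?A S" "finite T" "fideal ?A S \<subseteq> fideal ?A T" by blast
  \<comment> \<open>The generators found lie in the ideal of \<open>S\<close>. Each involves only
    finitely many elements of \<open>S\<close>, and these together generate it.\<close>
  have "\<forall>t\<in>T. \<exists>U\<subseteq>S. finite U \<and> t \<in> fideal ?A U"
    using T(1) fideal_finite_generators by blast
  from bchoice[OF this] obtain U where U: "\<forall>t\<in>T. U t \<subseteq> S \<and> finite (U t) \<and> t \<in> fideal ?A (U t)" ..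
  have "T \<subseteq> fideal ?A (\<Union>t\<in>T. U t)"
    using U fideal_mono[of _ "\<Union>t\<in>T. U t" ?A] by blast
  then have "fideal ?A T \<subseteq> fideal ?A (\<Union>t\<in>T. U t)" by (rule fideal_subset)
  moreover have "S \<subseteq> fideal ?A S" using fideal_generator by blast
  ultimately have "S \<subseteq> fideal ?A (\<Union>t\<in>T. U t)" using T(3) by blast
  then show "\<exists>T\<subseteq>S. finite T \<and> S \<subseteq> fideal ?A T"
    using U T(2) by (intro exI[of _ "\<Union>t\<in>T. U t"]) auto
qed

lemma noetherian_poly_functions:
  fixes C :: "('x \<Rightarrow> 'k::field) set"
  shows "finite C \<Longrightarrow> noetherian (poly_functions C)"
  by (induction C rule: finite_induct) (simp_all add: noetherian_constants hilbert_basis)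

text \<open>A strictly descending sequence of zero sets would give an ascending sequence of
  vanishing ideals \<open>I n\<close>. Finitely many generators of their union lie in a single
  \<open>I N\<close>, so the zero sets cannot shrink after \<open>N\<close>.\<close>

lemma minimal_zero_set:
  fixes R :: "('x \<Rightarrow> 'k::comm_ring_1) set"
  assumes noeth: "noetherian R" and Z: "S \<subseteq> R" "Q (zero_set UNIV S)"
  obtains T where "T \<subseteq> R" "Q (zero_set UNIV T)" "zero_set UNIV T \<subseteq> zero_set UNIV S"
    "\<forall>U\<subseteq>R. zero_set UNIV U \<subseteq> zero_set UNIV T \<longrightarrow> Q (zero_set UNIV U) \<longrightarrow>
      zero_set UNIV U = zero_set UNIV T"
proof -
  have "\<exists>T\<subseteq>R. (Q (zero_set UNIV T) \<and> zero_set UNIV T \<subseteq> zero_set UNIV S) \<and>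
    (\<forall>U\<subseteq>R. zero_set UNIV U \<subseteq> zero_set UNIV T \<longrightarrow> Q (zero_set UNIV U) \<longrightarrow>
      zero_set UNIV U = zero_set UNIV T)" (is "\<exists>T\<subseteq>R. ?P T \<and> ?min T")
  proof (rule ccontr)
    assume neg: "\<not> ?thesis"
    have "\<exists>T. \<forall>n. (T n \<subseteq> R \<and> ?P (T n)) \<and> zero_set UNIV (T (Suc n)) \<subset> zero_set UNIV (T n)"
    proof (rule dependent_nat_choice)
      show "\<exists>T. T \<subseteq> R \<and> ?P T" by (rule exI[of _ S]) (use Z in simp)
      fix T and n :: nat assume T: "T \<subseteq> R \<and> ?P T"
      then have "\<not> ?min T" using neg by simp
      then obtain U where "U \<subseteq> R" "zero_set UNIV U \<subseteq> zero_set UNIV T" "Q (zero_set UNIV U)"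
        "zero_set UNIV U \<noteq> zero_set UNIV T" by (auto simp del: not_ex)
      then show "\<exists>U. (U \<subseteq> R \<and> ?P U) \<and> zero_set UNIV U \<subset> zero_set UNIV T"
        using T by (intro exI[of _ U]) auto
    qed
    then obtain T where "\<forall>n. (T n \<subseteq> R \<and> ?P (T n)) \<and> zero_set UNIV (T (Suc n)) \<subset> zero_set UNIV (T n)" ..
    then have T: "T n \<subseteq> R" "zero_set UNIV (T (Suc n)) \<subset> zero_set UNIV (T n)" for n by simp_all
    define I where "I n = {f \<in> R. vanishes (zero_set UNIV (T n)) f}" for n
    have mono: "m \<le> n \<Longrightarrow> I m \<subseteq> I n" for m n
      using lift_Suc_antimono_le[of "\<lambda>n. zero_set UNIV (T n)" m n, OF psubset_imp_subset[OF T(2)]]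
      by (auto simp: I_def vanishes_def)
    have "(\<Union>n. I n) \<subseteq> R" by (auto simp: I_def)
    from noeth[unfolded noetherian_def, rule_format, OF this]
    obtain B where B: "B \<subseteq> (\<Union>n. I n)" "finite B" "(\<Union>n. I n) \<subseteq> fideal R B"
      by (elim exE conjE)
    have "\<forall>b\<in>B. \<exists>n. b \<in> I n" using B(1) by blast
    from bchoice[OF this] obtain m where m: "\<forall>b\<in>B. b \<in> I (m b)" ..
    obtain N where "m ` B \<subseteq> {..<N}" using finite_nat_bounded[of "m ` B"] B(2) by auto
    then have "b \<in> I N" if "b \<in> B" for b using m mono[of "m b" N] that by fastforce
    then have "vanishes (zero_set UNIV (T N)) f" if "f \<in> T (Suc N)" for f
    proof -
      have "f \<in> I (Suc N)" using that T(1) by (auto simp: I_def vanishes_def zero_set_def)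
      then have "f \<in> fideal R B" using B(3) by blast
      then show ?thesis by (rule fideal_vanishes) (use \<open>\<And>b. b \<in> B \<Longrightarrow> b \<in> I N\<close> in \<open>auto simp: I_def\<close>)
    qed
    then have "zero_set UNIV (T N) \<subseteq> zero_set UNIV (T (Suc N))"
      unfolding vanishes_def zero_set_def by blast
    then show False using T(2)[of N] by blast
  qed
  then show ?thesis using that by blast
qed

section \<open>Closed subsets of affine space\<close>

abbreviation polys :: "('k::comm_ring_1 ^ 'n \<Rightarrow> 'k) set" where
  "polys \<equiv> poly_functions coords"

lemma coords_eq_range: "coords = range (\<lambda>i x. x $ i)"
  by (auto simp: coords_def)

lemma closedin_zariski_zeros:
  fixes f :: "'k::idom ^ 'n \<Rightarrow> 'k"
  shows "f \<in> polys \<Longrightarrow> closedin zariski {x. f x = 0}"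
  unfolding closedin_zariski(2) by (intro exI[of _ "{f}"]) (auto simp: zero_set_def)

lemma zclosed_if_closedin:
  fixes V :: "('k::idom ^ 'n) set"
  assumes "closedin zariski V"
  shows "zclosed (\<lambda>i x. x $ i) V"
  unfolding zclosed_def
proof (intro allI impI)
  fix u :: "'n \<Rightarrow> 'k"
  assume u: "\<forall>P\<in>Pol UNIV. vanishes V (\<lambda>x. P (\<lambda>j. x $ j)) \<longrightarrow> P u = 0"
  obtain S where S: "S \<subseteq> polys" "V = zero_set UNIV S" using assms unfolding closedin_zariski(2) by blast
  have "f (\<chi> j. u j) = 0" if f: "f \<in> S" for f
  proof -
    have "f \<in> poly_functions (range (\<lambda>i x. x $ i))" using f S(1) by (auto simp: coords_eq_range)
    then obtain P where P: "P \<in> Pol UNIV" "\<forall>x. f x = P (\<lambda>i. x $ i)"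
      using pf_imageE by blast
    have "vanishes V (\<lambda>x. P (\<lambda>j. x $ j))"
      using f P(2) by (auto simp: vanishes_def S(2) zero_set_def)
    then show ?thesis using u P by simp
  qed
  then show "\<exists>x\<in>V. \<forall>j. x $ j = u j"
    by (intro bexI[of _ "\<chi> j. u j"]) (auto simp: S(2) zero_set_def)
qed

lemma irreducible_in_zariski_iff:
  fixes V :: "('k::idom ^ 'n) set"
  shows "irreducible_in zariski V \<longleftrightarrow> irr polys V"
proof
  assume V: "irreducible_in zariski V"
  show "irr polys V"
    unfolding irr_def
  proof (intro conjI ballI impI)
    show "V \<noteq> {}" using V by (simp add: irreducible_in_def)
    fix f g :: "'k ^ 'n \<Rightarrow> 'k" assume fg: "f \<in> polys" "g \<in> polys" "vanishes V (\<lambda>x. f x * g x)"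
    then have "V \<subseteq> {x. f x = 0} \<union> {x. g x = 0}" by (auto simp: vanishes_def)
    then have "V \<subseteq> {x. f x = 0} \<or> V \<subseteq> {x. g x = 0}"
      using V closedin_zariski_zeros fg(1,2) unfolding irreducible_in_def by blast
    then show "vanishes V f \<or> vanishes V g" by (auto simp: vanishes_def)
  qed
next
  assume V: "irr polys V"
  show "irreducible_in zariski V"
    unfolding irreducible_in_def
  proof (intro conjI allI impI; (elim conjE)?)
    show "V \<noteq> {}" using V by (simp add: irr_def)
    show "V \<subseteq> topspace zariski" by (simp add: closedin_zariski(1))
    fix A B :: "('k ^ 'n) set"
    assume AB: "closedin zariski A" "closedin zariski B" "V \<subseteq> A \<union> B"
    obtain S T where ST: "S \<subseteq> polys" "A = zero_set UNIV S" "T \<subseteq> polys" "B = zero_set UNIV T"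
      using AB(1,2) unfolding closedin_zariski(2) by blast
    show "V \<subseteq> A \<or> V \<subseteq> B"
    proof (rule ccontr)
      assume "\<not> ?thesis"
      then obtain f g where fg: "f \<in> S" "\<not> vanishes V f" "g \<in> T" "\<not> vanishes V g"
        by (auto simp: ST zero_set_def vanishes_def)
      then have "\<not> vanishes V (\<lambda>x. f x * g x)" using irr_mult[OF V] ST(1,3) by blast
      moreover have "vanishes V (\<lambda>x. f x * g x)"
        using AB(3) fg(1,3) by (fastforce simp: ST zero_set_def vanishes_def)
      ultimately show False by blast
    qed
  qed
qed

lemma noetherian_polys: "noetherian (polys :: ('k::field ^ 'n \<Rightarrow> 'k) set)"
  by (rule noetherian_poly_functions) (simp add: coords_eq_range)

text \<open>A closed set minimal with a property that passes to one of two closed pieces is irreducible.\<close>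

lemma exists_irreducible_closed:
  fixes Z :: "('k::field ^ 'n) set"
  assumes Z: "closedin zariski Z" "Q Z" and empty: "\<not> Q {}"
    and Un: "\<And>A B. closedin zariski A \<Longrightarrow> closedin zariski B \<Longrightarrow> Q (A \<union> B) \<Longrightarrow> Q A \<or> Q B"
  obtains V where "closedin zariski V" "irr polys V" "V \<subseteq> Z" "Q V"
proof -
  obtain S where S: "S \<subseteq> polys" "Z = zero_set UNIV S" using Z(1) unfolding closedin_zariski(2) by blast
  have QS: "Q (zero_set UNIV S)" using Z(2) S(2) by simp
  obtain T where T: "T \<subseteq> polys" "Q (zero_set UNIV T)" "zero_set UNIV T \<subseteq> zero_set UNIV S"
    and min: "\<forall>U\<subseteq>polys. zero_set UNIV U \<subseteq> zero_set UNIV T \<longrightarrow> Q (zero_set UNIV U) \<longrightarrow>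
      zero_set UNIV U = zero_set UNIV T"
    using minimal_zero_set[OF noetherian_polys S(1), of Q, OF QS] .
  define V where "V = zero_set UNIV T"
  have V: "closedin zariski V" "Q V" "V \<subseteq> Z"
    using T S unfolding V_def closedin_zariski(2) by auto
  have min: "W = V" if "closedin zariski W" "W \<subseteq> V" "Q W" for W
  proof -
    obtain U where "U \<subseteq> polys" "W = zero_set UNIV U"
      using \<open>closedin zariski W\<close> unfolding closedin_zariski(2) by blast
    then show ?thesis using min that unfolding V_def by simp
  qed
  have "irr polys V"
    unfolding irr_def
  proof (intro conjI ballI impI)
    show "V \<noteq> {}" using V(2) empty by auto
    fix f g :: "'k ^ 'n \<Rightarrow> 'k" assume fg: "f \<in> polys" "g \<in> polys" "vanishes V (\<lambda>x. f x * g x)"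
    let ?A = "V \<inter> {x. f x = 0}" and ?B = "V \<inter> {x. g x = 0}"
    have closed: "closedin zariski ?A" "closedin zariski ?B"
      using V(1) closedin_zariski_zeros fg(1,2) by (auto intro: closedin_Int)
    have "V = ?A \<union> ?B" using fg(3) by (auto simp: vanishes_def)
    then have "Q ?A \<or> Q ?B" using Un[OF closed] V(2) by simp
    then have "?A = V \<or> ?B = V" using min[OF closed(1)] min[OF closed(2)] by blast
    then show "vanishes V f \<or> vanishes V g" by (auto simp: vanishes_def)
  qed
  then show ?thesis using that V by blast
qed

text \<open>Noetherian induction: if some closed set had no such cover, an irreducible closed set
  would have none either, but an irreducible set covers itself.\<close>

lemma finite_irreducible_cover:
  fixes Z :: "('k::field ^ 'n) set"
  assumes Z: "closedin zariski Z"
  obtains \<V> where "finite \<V>" "Z = \<Union>\<V>" "\<And>V. V \<in> \<V> \<Longrightarrow> closedin zariski V \<and> irr polys V"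
proof -
  define Q where "Q Z \<longleftrightarrow> \<not> (\<exists>\<V>. finite \<V> \<and> Z = \<Union>\<V> \<and> (\<forall>V\<in>\<V>. closedin zariski V \<and> irr polys V))"
    for Z :: "('k ^ 'n) set"
  have "\<not> Q Z"
  proof
    assume "Q Z"
    have "\<not> Q {}" unfolding Q_def not_not by (rule exI[of _ "{}"]) auto
    moreover have "Q A \<or> Q B" if "Q (A \<union> B)" for A B
    proof (rule ccontr)
      assume "\<not> ?thesis"
      then obtain \<V> \<W> where "finite \<V>" "A = \<Union>\<V>" "\<forall>V\<in>\<V>. closedin zariski V \<and> irr polys V"
        "finite \<W>" "B = \<Union>\<W>" "\<forall>V\<in>\<W>. closedin zariski V \<and> irr polys V"
        unfolding Q_def by blast
      then have "\<not> Q (A \<union> B)" unfolding Q_def not_not by (intro exI[of _ "\<V> \<union> \<W>"]) auto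
      then show False using that by blast
    qed
    ultimately obtain V where V: "closedin zariski V" "irr polys V" "Q V"
      using exists_irreducible_closed[of Z Q, OF Z \<open>Q Z\<close>] by metis
    have "\<not> Q V" unfolding Q_def not_not by (rule exI[of _ "{V}"]) (use V in auto)
    then show False using V(3) by blast
  qed
  then obtain \<V> where "finite \<V>" "Z = \<Union>\<V>" "\<forall>V\<in>\<V>. closedin zariski V \<and> irr polys V"
    unfolding Q_def not_not by (elim exE conjE)
  then show ?thesis by (intro that) auto
qed

section \<open>Hypersurface sections and chains\<close>

text \<open>On \<open>V\<close> there are \<open>r\<close> algebraically independent functions from \<open>B\<close>. For \<open>B = polys\<close> this says
  that the dimension of the closure of \<open>V\<close> is at least \<open>r\<close>.\<close>

definition dim_ge :: "('x \<Rightarrow> 'k::comm_ring_1) set \<Rightarrow> 'x set \<Rightarrow> nat \<Rightarrow> bool" where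
  "dim_ge B V r \<longleftrightarrow> (\<exists>(f :: nat \<Rightarrow> 'x \<Rightarrow> 'k) I. finite I \<and> card I = r \<and> f ` I \<subseteq> B \<and> indep f I V)"

lemma dim_geI:
  fixes f :: "nat \<Rightarrow> 'x \<Rightarrow> 'k::comm_ring_1"
  shows "finite I \<Longrightarrow> card I = r \<Longrightarrow> f ` I \<subseteq> B \<Longrightarrow> indep f I V \<Longrightarrow> dim_ge B V r"
  unfolding dim_ge_def by (rule exI[of _ f], rule exI[of _ I]) simp

lemma dim_geE:
  fixes B :: "('x \<Rightarrow> 'k::comm_ring_1) set"
  assumes "dim_ge B V r"
  obtains f :: "nat \<Rightarrow> 'x \<Rightarrow> 'k" and I
  where "finite I" "card I = r" "f ` I \<subseteq> B" "indep f I V"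
  using assms unfolding dim_ge_def by (elim exE conjE)

lemma dim_ge_antimono:
  assumes "dim_ge B V r" "s \<le> r"
  shows "dim_ge B V s"
proof -
  obtain f :: "nat \<Rightarrow> 'a \<Rightarrow> 'b" and I where f: "finite I" "card I = r" "f ` I \<subseteq> B" "indep f I V"
    using assms(1) unfolding dim_ge_def by (elim exE conjE)
  obtain J where J: "J \<subseteq> I" "card J = s" "finite J"
    using obtain_subset_with_card_n[of s I] assms(2) f(2) by auto
  then show ?thesis using f(3) indep_subset[OF f(4) J(1)] by (intro dim_geI[of J _ f]) auto
qed

lemma dim_ge_mono: "dim_ge B V r \<Longrightarrow> V \<subseteq> W \<Longrightarrow> dim_ge B W r"
  by (elim dim_geE) (rule dim_geI, assumption+, rule indep_superset)

lemma indep_empty: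
  assumes "V \<noteq> {}"
  shows "indep f {} V"
  unfolding indep_def
proof (intro ballI impI)
  fix P assume P: "P \<in> Pol {}" "vanishes V (\<lambda>x. P (\<lambda>i. f i x))"
  obtain x where x: "x \<in> V" using assms by blast
  have "P u = 0" for u
  proof -
    have "P u = P (\<lambda>i. f i x)" by (rule Pol_cong[OF P(1)]) simp
    then show ?thesis using P(2) x by (simp add: vanishes_def)
  qed
  then show "vanishes UNIV P" by (simp add: vanishes_def)
qed

lemma dim_ge_nonempty: "dim_ge B V r \<Longrightarrow> V \<noteq> {}"
  by (elim dim_geE) (rule indep_nonempty)

lemma dim_ge_Union:
  fixes B :: "('x \<Rightarrow> 'k::field_char_0) set"
  assumes "dim_ge B (\<Union>\<V>) r" "finite \<V>"
  shows "\<exists>V\<in>\<V>. dim_ge B V r"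
proof -
  obtain f :: "nat \<Rightarrow> 'x \<Rightarrow> 'k" and I where f: "finite I" "card I = r" "f ` I \<subseteq> B" "indep f I (\<Union>\<V>)"
    using assms(1) unfolding dim_ge_def by (elim exE conjE)
  obtain V where "V \<in> \<V>" "indep f I V" using indep_Union[OF assms(2) f(4)] by (elim bexE)
  then show ?thesis using f(1-3) by (intro bexI[of _ V] dim_geI[of I r f])
qed

lemma dim_ge_minus_zeros:
  assumes "dim_ge B V r" "irr (poly_functions C) V" "h \<in> poly_functions C" "\<not> vanishes V h"
    "B \<subseteq> poly_functions C"
  shows "dim_ge B {x \<in> V. h x \<noteq> 0} r"
proof -
  obtain f :: "nat \<Rightarrow> 'a \<Rightarrow> 'b" and I where f: "finite I" "card I = r" "f ` I \<subseteq> B" "indep f I V"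
    using assms(1) unfolding dim_ge_def by (elim exE conjE)
  have "indep f I {x \<in> V. h x \<noteq> 0}"
    by (rule indep_minus_zeros[OF f(4) assms(2-4)]) (use f(3) assms(5) in auto)
  with f(1-3) show ?thesis by (rule dim_geI)
qed

text \<open>By exchange \<open>g\<close> becomes one of \<open>e + 1\<close> independent functions.
  The image of the part of \<open>V\<close> with \<open>h \<noteq> 0\<close> under these functions
  contains a nonempty open set \<open>h' \<noteq> 0\<close>. A nonempty slice of this set at a value
  \<open>c\<close> of \<open>g\<close> is dense in the affine space of the other coordinates, so the
  other \<open>e\<close> functions stay independent on the level set.\<close>

lemma hypersurface_section:
  fixes V :: "('k::{alg_closed_field, field_char_0} ^ 'n) set"
  assumes V: "closedin zariski V" "irr polys V" and h: "h \<in> polys" "\<not> vanishes V h"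
    and B: "B \<subseteq> polys" "g \<in> B" and g: "x \<in> V" "y \<in> V" "g x \<noteq> g y"
    and dim: "dim_ge B V (Suc e)"
  obtains c V' where "closedin zariski V'" "irr polys V'" "V' \<subseteq> {x \<in> V. g x = c}"
    "\<not> vanishes V' h" "dim_ge B V' e"
proof -
  obtain f0 :: "nat \<Rightarrow> 'k ^ 'n \<Rightarrow> 'k" and I
    where f0: "finite I" "card I = Suc e" "f0 ` I \<subseteq> B" "indep f0 I V"
    using dim unfolding dim_ge_def by (elim exE conjE)
  have "I \<noteq> {}" using f0(2) by auto
  then obtain i where i: "i \<in> I" "indep (f0(i := g)) I V"
    using indep_exchange[OF V(2) _ _ f0(1) _ nonconstant_not_alg[OF V(2) _ g] f0(4)] f0(3) B by blast
  define f where "f = f0(i := g)"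
  have f: "f i = g" "indep f I V" "f ` I \<subseteq> B" using i f0(3) B(2) by (auto simp: f_def)
  have V': "zclosed (\<lambda>i x. x $ i) V" "irr (poly_functions (range (\<lambda>i x. x $ i))) V"
    using zclosed_if_closedin V by (simp_all add: coords_eq_range)
  have "f ` I \<subseteq> poly_functions (range (\<lambda>i x. x $ i))"
    using f(3) B(1) by (simp add: coords_eq_range)
  from chevalley[OF V' this h(1)[unfolded coords_eq_range] h(2)]
  obtain h' where h': "h' \<in> Pol I" "\<not> vanishes V (\<lambda>x. h' (\<lambda>i. f i x))" and
    dom: "\<forall>u. h' u \<noteq> 0 \<longrightarrow> (\<forall>P\<in>Pol I. vanishes V (\<lambda>x. P (\<lambda>i. f i x)) \<longrightarrow> P u = 0) \<longrightarrow>
      (\<exists>x\<in>V. h x \<noteq> 0 \<and> (\<forall>i\<in>I. f i x = u i))"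
    by (elim bexE conjE)
  have dom: "\<exists>x\<in>V. h x \<noteq> 0 \<and> (\<forall>i\<in>I. f i x = u i)" if "h' u \<noteq> 0" for u
    using dom that indepD[OF f(2)] by (auto simp: vanishes_def[of UNIV])
  obtain x0 where x0: "x0 \<in> V" "h' (\<lambda>i. f i x0) \<noteq> 0" using h'(2) by (auto simp: vanishes_def)
  \<comment> \<open>The level of \<open>g\<close> is taken at a point where \<open>h'\<close> is
    nonzero, so the slice of \<open>h'\<close> at \<open>c\<close> is not the zero
    polynomial.\<close>
  define c where "c = f i x0"
  let ?I = "I - {i}"
  define W where "W = V \<inter> {x. g x - c = 0}"
  have ind: "indep f ?I {x \<in> W. h x \<noteq> 0}"
    unfolding indep_def
  proof (intro ballI impI)
    fix P assume P: "P \<in> Pol ?I" "vanishes {x \<in> W. h x \<noteq> 0} (\<lambda>x. P (\<lambda>i. f i x))"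
    define Q where "Q u = h' (u(i := c))" for u
    have "(\<lambda>u. (u(i := c)) j) \<in> poly_functions ((\<lambda>i u. u i) ` I)" if "j \<in> I" for j
      using that by (cases "j = i") (auto intro: poly_functions.const poly_functions.coord)
    then have "Q \<in> Pol I" unfolding Q_def Pol_def by (intro Pol_comp[OF h'(1)])
    moreover have "Q (\<lambda>i. f i x0) \<noteq> 0"
      using x0(2) fun_upd_triv[of "\<lambda>i. f i x0" i] by (simp add: Q_def c_def)
    then have "\<not> vanishes UNIV Q" by (auto simp: vanishes_def)
    moreover have "P \<in> Pol I" using P(1) Pol_mono[of ?I I] by blast
    moreover have "vanishes UNIV (\<lambda>u. P u * Q u)"
      unfolding vanishes_def
    proof
      fix u
      have "P u = 0" if Qu: "Q u \<noteq> 0"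
      proof -
        obtain x where x: "x \<in> V" "h x \<noteq> 0" "\<forall>j\<in>I. f j x = (u(i := c)) j"
          using dom[OF Qu[unfolded Q_def]] by blast
        then have "x \<in> W" using f(1) i(1) by (auto simp: W_def)
        then have "P (\<lambda>i. f i x) = 0" using P(2) x(2) by (simp add: vanishes_def)
        moreover have "P (\<lambda>i. f i x) = P u" by (rule Pol_cong[OF P(1)]) (use x(3) in auto)
        ultimately show ?thesis by simp
      qed
      then show "P u * Q u = 0" by auto
    qed
    ultimately show "vanishes UNIV P" using irr_mult[OF irr_Pol_UNIV] by blast
  qed
  have "(\<lambda>x. g x - c) \<in> polys" using B by (intro pf) auto
  then have W: "closedin zariski W"
    unfolding W_def by (intro closedin_Int V closedin_zariski_zeros)
  have Un: "indep f ?I {x \<in> A. h x \<noteq> 0} \<or> indep f ?I {x \<in> B. h x \<noteq> 0}"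
    if "indep f ?I {x \<in> A \<union> B. h x \<noteq> 0}" for A B
  proof (rule indep_Un)
    have "{x \<in> A \<union> B. h x \<noteq> 0} = {x \<in> A. h x \<noteq> 0} \<union> {x \<in> B. h x \<noteq> 0}" by blast
    then show "indep f ?I ({x \<in> A. h x \<noteq> 0} \<union> {x \<in> B. h x \<noteq> 0})" using that by simp
  qed
  have empty: "\<not> indep f ?I {x \<in> {}. h x \<noteq> 0}" using indep_nonempty by fastforce
  \<comment> \<open>The property passed on to a component concerns its part with
    \<open>h \<noteq> 0\<close>; this gives both the dimension and the nonvanishing of
    \<open>h\<close>.\<close>
  obtain V' where V': "closedin zariski V'" "irr polys V'" "V' \<subseteq> W" "indep f ?I {x \<in> V'. h x \<noteq> 0}"
    using exists_irreducible_closed[of W "\<lambda>Z. indep f ?I {x \<in> Z. h x \<noteq> 0}", OF W ind empty Un] .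
  have "dim_ge B V' e"
  proof (rule dim_geI)
    show "finite ?I" "card ?I = e" "f ` ?I \<subseteq> B" using f0(1,2) i(1) f(3) by auto
    show "indep f ?I V'" by (rule indep_superset[OF V'(4)]) auto
  qed
  moreover have "\<not> vanishes V' h" using indep_nonempty[OF V'(4)] by (auto simp: vanishes_def)
  ultimately show ?thesis using that[of V' c] V' by (auto simp: W_def)
qed

text \<open>A level set of a coordinate that is not constant on \<open>V\<close> costs at most one
  dimension and makes at least one more coordinate constant. Once all coordinates are constant,
  \<open>V\<close> is a point and carries no independent function.\<close>

lemma dim_ge_bound:
  fixes V :: "('k::{alg_closed_field, field_char_0} ^ 'n) set"
  assumes "dim_ge polys V r"
  shows "r \<le> CARD('n)"
proof -
  have irr: "r \<le> card {j. \<exists>x\<in>V. \<exists>y\<in>V. x $ j \<noteq> y $ j}"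
    if "closedin zariski V" "irr polys V" "dim_ge polys V r" for V :: "('k ^ 'n) set"
    using that
  proof (induction r arbitrary: V)
    case (Suc r)
    have one: "(\<lambda>x. 1) \<in> (polys :: ('k ^ 'n \<Rightarrow> 'k) set)" "\<not> vanishes V (\<lambda>x. 1 :: 'k)"
      using Suc.prems(2) by (auto simp: irr_def vanishes_def intro: pf)
    show ?case
    proof (cases "{j. \<exists>x\<in>V. \<exists>y\<in>V. x $ j \<noteq> y $ j} = {}")
      case True
      obtain f :: "nat \<Rightarrow> 'k ^ 'n \<Rightarrow> 'k" and I
        where f: "finite I" "card I = Suc r" "f ` I \<subseteq> polys" "indep f I V"
        using Suc.prems(3) unfolding dim_ge_def by (elim exE conjE)
      obtain i where i: "i \<in> I" using f(2) by fastforce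
      obtain x where x: "x \<in> V" using Suc.prems(2) by (auto simp: irr_def)
      have eq: "y = x" if "y \<in> V" for y using True x that unfolding vec_eq_iff by blast
      have "f i y - f i x = 0" if "y \<in> V" for y unfolding eq[OF that] by simp
      then have "vanishes V (\<lambda>y. f i y - f i x)" by (simp add: vanishes_def)
      moreover have "(\<lambda>u. u i - f i x) \<in> Pol I"
        unfolding Pol_def by (rule pf_diff[OF Pol_coord[OF i, unfolded Pol_def] poly_functions.const])
      ultimately have "vanishes UNIV (\<lambda>u :: nat \<Rightarrow> 'k. u i - f i x)"
        by (intro indepD[OF f(4)])
      then have "(f i x + 1) - f i x = 0"
        unfolding vanishes_def by (rule bspec[of _ _ "\<lambda>_. f i x + 1"]) simp
      then show ?thesis by simp
    next
      case False
      then obtain j x y where j: "x \<in> V" "y \<in> V" "x $ j \<noteq> y $ j" by blast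
      have coord: "(\<lambda>x. x $ j) \<in> (polys :: ('k ^ 'n \<Rightarrow> 'k) set)"
        by (rule poly_functions.coord) (simp add: coords_eq_range)
      obtain c V' where V': "closedin zariski V'" "irr polys V'" "V' \<subseteq> {x \<in> V. x $ j = c}"
        "\<not> vanishes V' (\<lambda>x. 1 :: 'k)" "dim_ge polys V' r"
        using hypersurface_section[OF Suc.prems(1,2) one order_refl coord j Suc.prems(3)] .
      have "{j. \<exists>x\<in>V'. \<exists>y\<in>V'. x $ j \<noteq> y $ j} \<subset> {j. \<exists>x\<in>V. \<exists>y\<in>V. x $ j \<noteq> y $ j}"
        using V'(3) j by auto
      then have "card {j. \<exists>x\<in>V'. \<exists>y\<in>V'. x $ j \<noteq> y $ j} < card {j. \<exists>x\<in>V. \<exists>y\<in>V. x $ j \<noteq> y $ j}"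
        by (intro psubset_card_mono) auto
      then show ?thesis using Suc.IH[OF V'(1,2,5)] by simp
    qed
  qed simp
  \<comment> \<open>An arbitrary \<open>V\<close> is replaced by an irreducible closed set on which
    the same functions are independent.\<close>
  obtain f :: "nat \<Rightarrow> 'k ^ 'n \<Rightarrow> 'k" and I
    where f: "finite I" "card I = r" "f ` I \<subseteq> polys" "indep f I V"
    using assms unfolding dim_ge_def by (elim exE conjE)
  have "closedin zariski (UNIV :: ('k ^ 'n) set)"
    using closedin_topspace[of "zariski :: ('k ^ 'n) topology"] by (simp add: closedin_zariski(1))
  moreover have "indep f I UNIV" by (rule indep_superset[OF f(4)]) simp
  moreover have "\<not> indep f I {}" using indep_nonempty[of f I "{}"] by blast
  moreover have "indep f I A \<or> indep f I B" if "indep f I (A \<union> B)" for A B :: "('k ^ 'n) set"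
    using that by (rule indep_Un)
  ultimately obtain Z where Z: "closedin zariski Z" "irr polys Z" "Z \<subseteq> UNIV" "indep f I Z"
    by (rule exists_irreducible_closed[of UNIV "indep f I"])
  have "dim_ge polys Z r" by (rule dim_geI[OF f(1-3) Z(4)])
  from irr[OF Z(1,2) this] show ?thesis
    by (rule order_trans) (simp add: card_mono)
qed

text \<open>\<open>A\<close> holds functions whose level sets come from closed sets of
  \<open>T\<close>, \<open>B\<close> those by which dimension is counted, and \<open>d\<close>
  bounds the dimension left once all of \<open>A\<close> is constant. For regular maps the lemma is
  used with \<open>A = B\<close> and \<open>d = 0\<close>, for the quotient with invariants, all
  polynomials and the orbit dimension. Prescribing the last member of the chain lets the induction
  append a larger one.\<close>

lemma chain_of_sections:
  fixes T :: "'t topology" and \<pi> :: "'k::{alg_closed_field, field_char_0} ^ 'n \<Rightarrow> 't"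
  assumes AB: "A \<subseteq> B" "B \<subseteq> polys" and h: "h \<in> polys"
    and im: "\<pi> ` X \<subseteq> topspace T"
    and cont: "\<And>C. closedin T C \<Longrightarrow> \<exists>S\<subseteq>polys. \<forall>x\<in>X. \<pi> x \<in> C \<longleftrightarrow> (\<forall>f\<in>S. f x = 0)"
    and lev: "\<And>g c. g \<in> A \<Longrightarrow> \<exists>C. closedin T C \<and> (\<forall>x\<in>X. \<pi> x \<in> C \<longleftrightarrow> g x = c)"
    and fib: "\<And>W. W \<subseteq> X \<Longrightarrow> \<forall>g\<in>A. \<forall>x\<in>W. \<forall>y\<in>W. g x = g y \<Longrightarrow> \<not> dim_ge B W (Suc d)"
    and V: "closedin zariski V" "irr polys V" "{x \<in> V. h x \<noteq> 0} \<subseteq> X" "\<not> vanishes V h" "dim_ge B V e"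
  shows "\<exists>Z. (\<forall>i\<le>e - d. closedin T (Z i) \<and> irreducible_in T (Z i)) \<and> (\<forall>i<e - d. Z i \<subset> Z (Suc i)) \<and>
    Z (e - d) = T closure_of (\<pi> ` {x \<in> V. h x \<noteq> 0})"
proof -
  have top: "closedin T (T closure_of (\<pi> ` {x \<in> V. h x \<noteq> 0})) \<and>
      irreducible_in T (T closure_of (\<pi> ` {x \<in> V. h x \<noteq> 0}))"
    if V: "irr polys V" "{x \<in> V. h x \<noteq> 0} \<subseteq> X" "\<not> vanishes V h" for V
  proof -
    let ?V = "{x \<in> V. h x \<noteq> 0}"
    have sub: "\<pi> ` ?V \<subseteq> T closure_of (\<pi> ` ?V)"
      by (rule closure_of_subset) (use im V(2) in auto)
    have "T closure_of (\<pi> ` ?V) \<subseteq> D \<or> T closure_of (\<pi> ` ?V) \<subseteq> E"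
      if DE: "closedin T D" "closedin T E" "T closure_of (\<pi> ` ?V) \<subseteq> D \<union> E" for D E
    proof -
      obtain F where F: "F \<subseteq> polys" "\<forall>x\<in>X. \<pi> x \<in> D \<longleftrightarrow> (\<forall>f\<in>F. f x = 0)" using cont[OF DE(1)] by (elim exE conjE)
      obtain F' where F': "F' \<subseteq> polys" "\<forall>x\<in>X. \<pi> x \<in> E \<longleftrightarrow> (\<forall>f\<in>F'. f x = 0)" using cont[OF DE(2)] by (elim exE conjE)
      have "\<pi> ` ?V \<subseteq> D \<or> \<pi> ` ?V \<subseteq> E"
      proof (rule ccontr)
        assume "\<not> ?thesis"
        then obtain x x' where "x \<in> ?V" "\<pi> x \<notin> D" "x' \<in> ?V" "\<pi> x' \<notin> E" by blast
        moreover from this obtain f f' where "f \<in> F" "f x \<noteq> 0" "f' \<in> F'" "f' x' \<noteq> 0"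
          using F(2) F'(2) V(2) by (meson subsetD)
        ultimately have f: "f \<in> F" "\<not> vanishes V f" "f' \<in> F'" "\<not> vanishes V f'"
          unfolding vanishes_def by blast+
        then have p: "f \<in> polys" "f' \<in> polys" using F(1) F'(1) by auto
        have "\<not> vanishes V (\<lambda>x. f x * f' x)" by (rule irr_mult[OF V(1) p f(2,4)])
        then have "\<not> vanishes V (\<lambda>x. (f x * f' x) * h x)"
          by (rule irr_mult[OF V(1) poly_functions.mult[OF p] h _ V(3)])
        moreover have "(f x * f' x) * h x = 0" if "x \<in> V" for x
        proof (cases "h x = 0")
          case False
          then have "\<pi> x \<in> D \<union> E" using sub DE(3) that by blast
          then show ?thesis using F(2) F'(2) f(1,3) V(2) that by auto
        qed simp
        ultimately show False by (simp add: vanishes_def)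
      qed
      then show ?thesis using closure_of_minimal DE(1,2) by blast
    qed
    moreover have "\<pi> ` ?V \<noteq> {}" using V(3) by (auto simp: vanishes_def)
    ultimately show ?thesis
      using sub closure_of_subset_topspace[of T "\<pi> ` ?V"] unfolding irreducible_in_def by auto
  qed
  show ?thesis
    using V
  proof (induction e arbitrary: V)
    case 0
    then show ?case using top[of V] by (intro exI[of _ "\<lambda>_. T closure_of (\<pi> ` {x \<in> V. h x \<noteq> 0})"]) simp
  next
    case (Suc e)
    let ?V = "{x \<in> V. h x \<noteq> 0}"
    have topV: "closedin T (T closure_of (\<pi> ` ?V)) \<and> irreducible_in T (T closure_of (\<pi> ` ?V))"
      by (rule top) (use Suc.prems in auto)
    show ?case
    proof (cases "Suc e \<le> d")
      \<comment> \<open>Here \<open>Suc e - d\<close> is 0, and a single irreducible closed set is a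
        chain of length 0.\<close>
      case True
      then show ?thesis using topV by (intro exI[of _ "\<lambda>_. T closure_of (\<pi> ` ?V)"]) simp
    next
      case False
      have "dim_ge B ?V (Suc e)"
        by (rule dim_ge_minus_zeros[OF Suc.prems(5,2) h Suc.prems(4) AB(2)])
      then have "dim_ge B ?V (Suc d)" by (rule dim_ge_antimono) (use False in simp)
      then have "\<not> (\<forall>g\<in>A. \<forall>x\<in>?V. \<forall>y\<in>?V. g x = g y)" using fib[of ?V] Suc.prems(3) by blast
      then obtain g x y where g: "g \<in> A" "x \<in> ?V" "y \<in> ?V" "g x \<noteq> g y" by blast
      then have "g \<in> B" "x \<in> V" "y \<in> V" using AB by auto
      from hypersurface_section[OF Suc.prems(1,2) h Suc.prems(4) AB(2) this g(4) Suc.prems(5)]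
      obtain c W where W: "closedin zariski W" "irr polys W" "W \<subseteq> {x \<in> V. g x = c}"
        "\<not> vanishes W h" "dim_ge B W e" .
      let ?W = "{x \<in> W. h x \<noteq> 0}"
      have "?W \<subseteq> X" using W(3) Suc.prems(3) by auto
      from Suc.IH[OF W(1,2) this W(4,5)] obtain Z where Z:
        "\<forall>i\<le>e - d. closedin T (Z i) \<and> irreducible_in T (Z i)" "\<forall>i<e - d. Z i \<subset> Z (Suc i)"
        "Z (e - d) = T closure_of (\<pi> ` ?W)" by (elim exE conjE)
      obtain C where C: "closedin T C" "\<forall>x\<in>X. \<pi> x \<in> C \<longleftrightarrow> g x = c" using lev[OF g(1)] by blast
      have "T closure_of (\<pi> ` ?W) \<subset> T closure_of (\<pi> ` ?V)"
      proof
        show "T closure_of (\<pi> ` ?W) \<subseteq> T closure_of (\<pi> ` ?V)"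
          by (rule closure_of_mono) (use W(3) in auto)
        \<comment> \<open>Strictness: the image of \<open>?W\<close> lies in the closed set
          \<open>C\<close> given by the level \<open>c\<close>, but \<open>g\<close> takes another
          value on \<open>?V\<close>.\<close>
        have "\<pi> ` ?W \<subseteq> C" using C(2) W(3) Suc.prems(3) by blast
        then have le: "T closure_of (\<pi> ` ?W) \<subseteq> C" by (rule closure_of_minimal[OF _ C(1)])
        obtain z where z: "z \<in> ?V" "g z \<noteq> c" using g by metis
        have "\<pi> z \<in> T closure_of (\<pi> ` ?V)"
          by (rule subsetD[OF closure_of_subset]) (use im Suc.prems(3) z in auto)
        moreover have "\<pi> z \<notin> C" using C(2) z Suc.prems(3) by blast
        ultimately show "T closure_of (\<pi> ` ?W) \<noteq> T closure_of (\<pi> ` ?V)" using le by blast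
      qed
      then show ?thesis
        using Z topV False
        by (intro exI[of _ "\<lambda>i. if i \<le> e - d then Z i else T closure_of (\<pi> ` ?V)"])
          (auto simp: Suc_diff_le le_Suc_eq less_Suc_eq)
    qed
  qed
qed

text \<open>In a relation sorted by powers of \<open>h\<close>, let the coefficients below
  \<open>a\<close> be zero. Cancelling \<open>h ^ a\<close> on \<open>W\<close> and restricting to
  \<open>V\<close>, where \<open>h\<close> vanishes, leaves the coefficient \<open>r a\<close>
  alone; it vanishes on \<open>V\<close> and is zero by independence.\<close>

lemma indep_add_hypersurface_equation:
  fixes f :: "nat \<Rightarrow> 'x \<Rightarrow> 'k::field_char_0"
  assumes irr: "irr (poly_functions C) W" and VW: "V \<subseteq> W"
    and f: "\<And>i. f i \<in> poly_functions C" "indep f {..<n} V"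
    and h: "h \<in> poly_functions C" "vanishes V h" "\<not> vanishes W h"
  shows "indep (f(n := h)) {..<Suc n} W"
  unfolding indep_def
proof (intro ballI impI)
  fix P :: "(nat \<Rightarrow> 'k) \<Rightarrow> 'k"
  assume P: "P \<in> Pol {..<Suc n}" "vanishes W (\<lambda>x. P (\<lambda>i. (f(n := h)) i x))"
  obtain r N where "\<forall>a. r a \<in> poly_functions ((\<lambda>i u. u i) ` {..<n})"
    "\<forall>u. P u = (\<Sum>a<N. r a u * u n ^ a)"
    using pf_insert_expand[OF P(1)[unfolded lessThan_Suc Pol_insert]] .
  then have r: "r a \<in> Pol {..<n}" "P u = (\<Sum>a<N. r a u * u n ^ a)" for a u
    unfolding Pol_def by simp_all
  have rf: "r a (\<lambda>i. (f(n := h)) i x) = r a (\<lambda>i. f i x)" for a x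
    by (rule Pol_cong[OF r(1)]) simp
  have rC: "(\<lambda>x. r a (\<lambda>i. f i x)) \<in> poly_functions C" for a
    using r(1) f(1) by (rule Pol_comp)
  have "vanishes UNIV (r a)" if "a < N" for a
    using that
  proof (induction a rule: less_induct)
    case (less a)
    define s where "s x = (\<Sum>b\<in>{a..<N}. r b (\<lambda>i. f i x) * h x ^ (b - a))" for x
    have s: "s \<in> poly_functions C" unfolding s_def by (intro pf rC h)
    have "vanishes W (\<lambda>x. h x ^ a * s x)"
      unfolding vanishes_def
    proof
      fix x assume "x \<in> W"
      then have "0 = (\<Sum>b<N. r b (\<lambda>i. f i x) * h x ^ b)"
        using P(2) unfolding vanishes_def r(2) rf by simp
      also have "\<dots> = (\<Sum>b\<in>{a..<N}. r b (\<lambda>i. f i x) * h x ^ b)"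
        using less by (intro sum.mono_neutral_right) (auto simp: vanishes_def)
      also have "\<dots> = (\<Sum>b\<in>{a..<N}. h x ^ a * (r b (\<lambda>i. f i x) * h x ^ (b - a)))"
      proof (rule sum.cong)
        fix b assume "b \<in> {a..<N}"
        then have "h x ^ b = h x ^ a * h x ^ (b - a)" by (simp add: power_add[symmetric])
        then show "r b (\<lambda>i. f i x) * h x ^ b = h x ^ a * (r b (\<lambda>i. f i x) * h x ^ (b - a))"
          by simp
      qed simp
      finally show "h x ^ a * s x = 0" by (simp add: s_def sum_distrib_left)
    qed
    then have "vanishes W s"
      using irr_mult[OF irr pf_power[OF h(1)] s irr_power[OF irr h(1,3)]] by blast
    then have sV: "s x = 0" if "x \<in> V" for x using VW that by (auto simp: vanishes_def)
    have "vanishes V (\<lambda>x. r a (\<lambda>i. f i x))"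
      unfolding vanishes_def
    proof
      fix x assume x: "x \<in> V"
      have "s x = r a (\<lambda>i. f i x) * h x ^ (a - a) +
          (\<Sum>b\<in>{Suc a..<N}. r b (\<lambda>i. f i x) * h x ^ (b - a))"
        unfolding s_def using less.prems by (rule sum.atLeast_Suc_lessThan)
      also have "(\<Sum>b\<in>{Suc a..<N}. r b (\<lambda>i. f i x) * h x ^ (b - a)) = 0"
        using h(2) x by (intro sum.neutral) (auto simp: vanishes_def)
      finally show "r a (\<lambda>i. f i x) = 0" using sV[OF x] by simp
    qed
    then show ?case by (rule indepD[OF f(2) r(1)])
  qed
  then show "vanishes UNIV P" by (simp add: vanishes_def r(2))
qed

text \<open>Each strict inclusion contributes a function that separates the two sets. The ring of
  functions is arbitrary because the chains live in affine space in one application and in the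
  spectrum of the invariants in the other.\<close>

lemma chain_independent:
  fixes Z :: "nat \<Rightarrow> 'x set" and C :: "('x \<Rightarrow> 'k::field_char_0) set"
  assumes "\<And>i. i \<le> n \<Longrightarrow> irr (poly_functions C) (Z i)"
    and "\<And>i. i < n \<Longrightarrow> Z i \<subseteq> Z (Suc i)"
    and "\<And>i. i < n \<Longrightarrow> \<exists>h\<in>poly_functions C. vanishes (Z i) h \<and> \<not> vanishes (Z (Suc i)) h"
  shows "\<exists>f. (\<forall>i. f i \<in> poly_functions C) \<and> indep f {..<n} (Z n)"
  using assms
proof (induction n)
  case 0
  then have "Z 0 \<noteq> {}" by (auto simp: irr_def)
  then show ?case
    using indep_empty[of "Z 0" "\<lambda>_ _. 0"]
    by (intro exI[of _ "\<lambda>_ _. 0"]) (simp add: poly_functions.const)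
next
  case (Suc n)
  have "\<exists>f. (\<forall>i. f i \<in> poly_functions C) \<and> indep f {..<n} (Z n)"
    by (rule Suc.IH) (use Suc.prems in auto)
  then obtain f where f: "\<forall>i. f i \<in> poly_functions C" "indep f {..<n} (Z n)" by (elim exE conjE)
  obtain h where h: "h \<in> poly_functions C" "vanishes (Z n) h" "\<not> vanishes (Z (Suc n)) h"
    using Suc.prems(3)[of n] by auto
  have "indep (f(n := h)) {..<Suc n} (Z (Suc n))"
    by (rule indep_add_hypersurface_equation[OF _ _ f(1)[rule_format] f(2) h]) (use Suc.prems in auto)
  moreover have "\<forall>i. (f(n := h)) i \<in> poly_functions C" using f(1) h(1) by simp
  ultimately show ?case by blast
qed

section \<open>Generic independence in families\<close>

lemma range_case_sum: "range (case_sum f g) = range f \<union> range g"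
  by (simp add: UNIV_sum image_Un image_image)

lemma coords2_eq_range:
  "coords2 = range (case_sum (\<lambda>i (x :: 'k ^ 'm, y :: 'k ^ 'n). x $ i) (\<lambda>j (x, y). y $ j))"
proof -
  have "{(\<lambda>(x :: 'k ^ 'm, y :: 'k ^ 'n). f x) | f. f \<in> coords} = range (\<lambda>i (x, y). x $ i)"
    "{(\<lambda>(x :: 'k ^ 'm, y :: 'k ^ 'n). f y) | f. f \<in> coords} = range (\<lambda>j (x, y). y $ j)"
    unfolding coords_eq_range by (simp_all add: Setcompr_eq_image image_image)
  then show ?thesis by (simp add: coords2_def range_case_sum)
qed

lemma coords2_snd: "f \<in> polys \<Longrightarrow> (\<lambda>x. f (snd x)) \<in> poly_functions coords2"
  by (rule pf_comp) (auto simp: coords2_def case_prod_beta' intro!: poly_functions.coord)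

lemma coords2_Pair1:
  assumes "f \<in> poly_functions coords2"
  shows "(\<lambda>x. f (x, y)) \<in> polys"
  using assms by (rule pf_comp) (auto simp: coords2_def intro: poly_functions.intros)

lemma coords2_Pair2:
  assumes "f \<in> poly_functions coords2"
  shows "(\<lambda>y. f (x, y)) \<in> polys"
  using assms by (rule pf_comp) (auto simp: coords2_def intro: poly_functions.intros)

text \<open>If \<open>f\<close> is nonzero at \<open>(x, y)\<close> and \<open>g\<close> at
  \<open>(x', y')\<close>, irreducibility of \<open>W\<close> gives one \<open>z\<close> that serves
  both \<open>x\<close> and \<open>x'\<close>, and irreducibility of \<open>V\<close> then a common
  point over \<open>z\<close>.\<close>

lemma irr_Times:
  fixes V :: "('k::idom ^ 'm) set" and W :: "('k ^ 'n) set"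
  assumes V: "irr polys V" and W: "irr polys W"
  shows "irr (poly_functions coords2) (V \<times> W)"
  unfolding irr_def
proof (intro conjI ballI impI)
  show "V \<times> W \<noteq> {}" using V W by (auto simp: irr_def)
  fix f g :: "('k ^ 'm) \<times> ('k ^ 'n) \<Rightarrow> 'k"
  assume fg: "f \<in> poly_functions coords2" "g \<in> poly_functions coords2"
    "vanishes (V \<times> W) (\<lambda>z. f z * g z)"
  show "vanishes (V \<times> W) f \<or> vanishes (V \<times> W) g"
  proof (rule ccontr)
    assume "\<not> ?thesis"
    then obtain x y x' y' where xy: "x \<in> V" "y \<in> W" "f (x, y) \<noteq> 0" "x' \<in> V" "y' \<in> W" "g (x', y') \<noteq> 0"
      by (auto simp: vanishes_def)
    have "\<not> vanishes W (\<lambda>y. f (x, y) * g (x', y))"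
      by (rule irr_mult[OF W coords2_Pair2[OF fg(1)] coords2_Pair2[OF fg(2)]])
        (use xy in \<open>auto simp: vanishes_def\<close>)
    then obtain z where z: "z \<in> W" "f (x, z) \<noteq> 0" "g (x', z) \<noteq> 0" by (auto simp: vanishes_def)
    have "\<not> vanishes V (\<lambda>x. f (x, z) * g (x, z))"
      by (rule irr_mult[OF V coords2_Pair1[OF fg(1)] coords2_Pair1[OF fg(2)]])
        (use xy z in \<open>auto simp: vanishes_def\<close>)
    then show False using fg(3) z(1) by (auto simp: vanishes_def)
  qed
qed

lemma zclosed_Times:
  fixes c :: "'i \<Rightarrow> 'x \<Rightarrow> 'k::comm_ring_1" and d :: "'j \<Rightarrow> 'y \<Rightarrow> 'k"
  assumes V: "zclosed c V" and W: "zclosed d W"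
  shows "zclosed (case_sum (\<lambda>i (x, y). c i x) (\<lambda>j (x, y). d j y)) (V \<times> W)"
  unfolding zclosed_def
proof (intro allI impI)
  fix u :: "'i + 'j \<Rightarrow> 'k"
  let ?c = "case_sum (\<lambda>i (x, y). c i x) (\<lambda>j (x, y). d j y)"
  assume u: "\<forall>P\<in>Pol UNIV. vanishes (V \<times> W) (\<lambda>z. P (\<lambda>j. ?c j z)) \<longrightarrow> P u = 0"
  have "\<forall>P\<in>Pol UNIV. vanishes V (\<lambda>x. P (\<lambda>i. c i x)) \<longrightarrow> P (\<lambda>i. u (Inl i)) = 0"
  proof (intro ballI impI)
    fix P :: "('i \<Rightarrow> 'k) \<Rightarrow> 'k" assume P: "P \<in> Pol UNIV" "vanishes V (\<lambda>x. P (\<lambda>i. c i x))"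
    show "P (\<lambda>i. u (Inl i)) = 0"
    proof (rule u[rule_format])
      show "(\<lambda>w. P (\<lambda>i. w (Inl i))) \<in> Pol UNIV"
        unfolding Pol_def by (rule Pol_comp[OF P(1)]) (auto intro: poly_functions.coord)
      show "vanishes (V \<times> W) (\<lambda>z. P (\<lambda>i. ?c (Inl i) z))"
        using P(2) by (simp add: vanishes_def)
    qed
  qed
  then obtain x where x: "x \<in> V" "\<forall>i. c i x = u (Inl i)"
    using V[unfolded zclosed_def, rule_format, of "\<lambda>i. u (Inl i)"] by auto
  have "\<forall>P\<in>Pol UNIV. vanishes W (\<lambda>x. P (\<lambda>i. d i x)) \<longrightarrow> P (\<lambda>i. u (Inr i)) = 0"
  proof (intro ballI impI)
    fix P :: "('j \<Rightarrow> 'k) \<Rightarrow> 'k" assume P: "P \<in> Pol UNIV" "vanishes W (\<lambda>x. P (\<lambda>i. d i x))"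
    show "P (\<lambda>i. u (Inr i)) = 0"
    proof (rule u[rule_format])
      show "(\<lambda>w. P (\<lambda>i. w (Inr i))) \<in> Pol UNIV"
        unfolding Pol_def by (rule Pol_comp[OF P(1)]) (auto intro: poly_functions.coord)
      show "vanishes (V \<times> W) (\<lambda>z. P (\<lambda>i. ?c (Inr i) z))"
        using P(2) by (simp add: vanishes_def)
    qed
  qed
  then obtain y where y: "y \<in> W" "\<forall>i. d i y = u (Inr i)"
    using W[unfolded zclosed_def, rule_format, of "\<lambda>i. u (Inr i)"] by auto
  show "\<exists>z\<in>V \<times> W. \<forall>j. ?c j z = u j"
    by (rule bexI[of _ "(x, y)"]) (use x y in \<open>auto split: sum.splits\<close>)
qed

section \<open>Separation of variables and generic independence\<close>

lemma pf_Un_expand: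
  fixes f :: "'x \<Rightarrow> 'k::comm_ring_1"
  assumes "f \<in> poly_functions (C \<union> D)"
  shows "\<exists>N c m. (\<forall>l::nat. c l \<in> poly_functions C \<and> m l \<in> poly_functions D) \<and>
    (\<forall>x. f x = (\<Sum>l<N. c l x * m l x))"
proof -
  define E where "E = {f. \<exists>N c m. (\<forall>l::nat. c l \<in> poly_functions C \<and> m l \<in> poly_functions D) \<and>
    (\<forall>x. f x = (\<Sum>l<N. c l x * m l x))}"
  have E_I: "f \<in> E" if "\<And>l::nat. c l \<in> poly_functions C" "\<And>l. m l \<in> poly_functions D"
    "\<And>x. f x = (\<Sum>l<N. c l x * m l x)" for f N c m
    unfolding E_def using that by (intro CollectI exI[of _ N] exI[of _ c] exI[of _ m]) simp
  have add: "(\<lambda>x. f x + g x) \<in> E" if f: "f \<in> E" and g: "g \<in> E" for f g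
  proof -
    obtain N c m where cm: "\<forall>l::nat. c l \<in> poly_functions C \<and> m l \<in> poly_functions D"
      "\<forall>x. f x = (\<Sum>l<N. c l x * m l x)" using f unfolding E_def by (elim CollectE exE conjE)
    obtain M d n where dn: "\<forall>l::nat. d l \<in> poly_functions C \<and> n l \<in> poly_functions D"
      "\<forall>x. g x = (\<Sum>l<M. d l x * n l x)" using g unfolding E_def by (elim CollectE exE conjE)
    show ?thesis
    proof (rule E_I)
      show "f x + g x = (\<Sum>l<N+M. (\<lambda>l. if l < N then c l else d (l - N)) l x * (\<lambda>l. if l < N then m l else n (l - N)) l x)" for x
      proof -
        have "(\<Sum>l<N+M. (if l < N then c l else d (l - N)) x * (if l < N then m l else n (l - N)) x)
          = (\<Sum>l<N. c l x * m l x) + (\<Sum>l\<in>{N..<N+M}. d (l - N) x * n (l - N) x)"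
          using sum.atLeastLessThan_concat[of 0 N "N+M" "\<lambda>l. (if l < N then c l else d (l - N)) x * (if l < N then m l else n (l - N)) x"]
          by (simp add: atLeast0LessThan[symmetric] cong: sum.cong_simp)
        also have "(\<Sum>l\<in>{N..<N+M}. d (l - N) x * n (l - N) x) = (\<Sum>l<M. d l x * n l x)"
          by (rule sum.reindex_bij_witness[of _ "\<lambda>l. l + N" "\<lambda>l. l - N"]) auto
        finally show ?thesis using cm(2) dn(2) by simp
      qed
    qed (use cm(1) dn(1) in auto)
  qed
  have mult: "(\<lambda>x. r x * f x) \<in> E" if f: "f \<in> E" and r: "r \<in> poly_functions C \<union> poly_functions D" for f r
  proof -
    obtain N c m where cm: "\<forall>l::nat. c l \<in> poly_functions C \<and> m l \<in> poly_functions D"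
      "\<forall>x. f x = (\<Sum>l<N. c l x * m l x)" using f unfolding E_def by (elim CollectE exE conjE)
    show ?thesis
    proof (cases "r \<in> poly_functions C")
      case True
      show ?thesis
        by (rule E_I[of "\<lambda>l x. r x * c l x" m _ N])
          (use cm True in \<open>auto intro: poly_functions.mult simp: sum_distrib_left mult.assoc\<close>)
    next
      case False
      then have "r \<in> poly_functions D" using r by blast
      then show ?thesis
        by (intro E_I[of c "\<lambda>l x. r x * m l x" _ N])
          (use cm in \<open>auto intro: poly_functions.mult simp: sum_distrib_left mult_ac\<close>)
    qed
  qed
  have one: "(\<lambda>x. 1) \<in> E"
    by (rule E_I[of "\<lambda>_ _. 1" "\<lambda>_ _. 1" _ 1]) (auto intro: poly_functions.const)
  have "(\<lambda>x. f x * h x) \<in> E" if "h \<in> E" for h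
    using assms that
  proof (induction arbitrary: h)
    case (const a)
    then show ?case using mult[of h "\<lambda>x. a"] poly_functions.const[of a C] by simp
  next
    case (coord g)
    then show ?case using mult[of h g] poly_functions.coord[of g] by blast
  next
    case (add f g)
    then show ?case using \<open>\<And>f g. f \<in> E \<Longrightarrow> g \<in> E \<Longrightarrow> (\<lambda>x. f x + g x) \<in> E\<close>[OF add.IH(1)[of h] add.IH(2)[of h]]
      by (simp add: distrib_right)
  next
    case (mult f g)
    then show ?case by (simp add: mult.assoc)
  qed
  from this[OF one] show ?thesis by (simp add: E_def)
qed

text \<open>Taking as few summands as possible makes the second factors linearly independent.\<close>

lemma Pol_Un_expand_independent:
  fixes P :: "('i \<Rightarrow> 'k::field) \<Rightarrow> 'k"
  assumes "P \<in> Pol (A \<union> B)"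
  obtains L :: "nat set" and c m where "finite L" "\<forall>l. c l \<in> Pol A" "\<forall>l. m l \<in> Pol B"
    "\<forall>w. P w = (\<Sum>l\<in>L. c l w * m l w)"
    "\<forall>a. (\<forall>w. (\<Sum>l\<in>L. a l * m l w) = 0) \<longrightarrow> (\<forall>l\<in>L. a l = 0)"
proof -
  define R where "R L c m \<longleftrightarrow> finite L \<and> (\<forall>l. c l \<in> Pol A) \<and> (\<forall>l. m l \<in> Pol B) \<and>
    (\<forall>w. P w = (\<Sum>l\<in>L. c l w * m l w))" for L :: "nat set" and c m
  define n where "n = (LEAST n. \<exists>L c m. R L c m \<and> card L = n)"
  have "P \<in> poly_functions ((\<lambda>i u. u i) ` A \<union> (\<lambda>i u. u i) ` B)"
    using assms by (simp add: Pol_def image_Un)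
  from pf_Un_expand[OF this] obtain N c m where
    "\<forall>l::nat. c l \<in> poly_functions ((\<lambda>i u. u i) ` A) \<and> m l \<in> poly_functions ((\<lambda>i u. u i) ` B)"
    "\<forall>x. P x = (\<Sum>l<N. c l x * m l x)" by (elim exE conjE)
  then have "R {..<N} c m" by (simp add: R_def Pol_def)
  then have "\<exists>n. \<exists>L c m. R L c m \<and> card L = n" by blast
  then have "\<exists>L c m. R L c m \<and> card L = n" unfolding n_def by (rule LeastI_ex)
  then obtain L c m where R: "R L c m" "card L = n" by (elim exE conjE)
  have min: "n \<le> card K" if "R K d e" for K d e
    unfolding n_def by (rule Least_le) (use that in blast)
  have "a k = 0" if a: "\<forall>w. (\<Sum>l\<in>L. a l * m l w) = 0" and k: "k \<in> L" for a k
  proof (rule ccontr)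
    assume ak: "a k \<noteq> 0"
    \<comment> \<open>The dependency expresses \<open>m k\<close> by the other \<open>m l\<close>,
      so the summand \<open>k\<close> can be absorbed into them, against minimality of
      \<open>n\<close>.\<close>
    define d where "d l w = c l w - (a l / a k) * c k w" for l w
    have "R (L - {k}) d m"
      unfolding R_def
    proof (intro conjI allI)
      show "finite (L - {k})" "m l \<in> Pol B" for l using R(1) by (auto simp: R_def)
      have "c l \<in> Pol A" for l using R(1) by (simp add: R_def)
      then show "d l \<in> Pol A" for l
        unfolding d_def Pol_def by (intro pf_diff poly_functions.mult poly_functions.const)
      fix w
      have fin: "finite L" using R(1) by (simp add: R_def)
      have "(\<Sum>l\<in>L. a l * m l w) = a k * m k w + (\<Sum>l\<in>L-{k}. a l * m l w)"
        by (rule sum.remove[OF fin k])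
      then have mk: "m k w = - (\<Sum>l\<in>L-{k}. a l * m l w) / a k"
        using a ak by (simp add: field_simps eq_neg_iff_add_eq_0)
      have "P w = c k w * m k w + (\<Sum>l\<in>L-{k}. c l w * m l w)"
        using R(1) sum.remove[OF fin k, of "\<lambda>l. c l w * m l w"] by (simp add: R_def)
      also have "c k w * m k w = - (\<Sum>l\<in>L-{k}. (a l / a k) * c k w * m l w)"
        unfolding mk by (simp add: sum_distrib_left sum_divide_distrib mult_ac)
      finally show "P w = (\<Sum>l\<in>L-{k}. d l w * m l w)"
        by (simp add: d_def left_diff_distrib sum_subtractf)
    qed
    then have "n \<le> card (L - {k})" by (rule min)
    moreover have "card (L - {k}) < card L"
      using R(1) k by (intro psubset_card_mono) (auto simp: R_def)
    ultimately show False using R(2) by simp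
  qed
  then show ?thesis using that[of L c m] R(1) unfolding R_def by blast
qed

text \<open>Here \<open>m l g y\<close> are functions of \<open>g\<close> depending on a parameter \<open>y\<close>: a relation with coefficients
  depending on \<open>y\<close> cannot hold identically if the functions are linearly independent for one \<open>y\<close>.\<close>

lemma no_generic_relation:
  fixes m :: "'l \<Rightarrow> 'g \<Rightarrow> 'y \<Rightarrow> 'k::field"
  assumes "finite L" and irr: "irr (poly_functions C) Y" and y0: "y0 \<in> Y"
    and c: "\<And>l. c l \<in> poly_functions C" and m: "\<And>l g. m l g \<in> poly_functions C"
    and "\<And>a. \<forall>g\<in>G. (\<Sum>l\<in>L. a l * m l g y0) = 0 \<Longrightarrow> \<forall>l\<in>L. a l = 0"
    and "\<And>g y. g \<in> G \<Longrightarrow> y \<in> Y \<Longrightarrow> (\<Sum>l\<in>L. c l y * m l g y) = 0"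
  shows "\<forall>l\<in>L. vanishes Y (c l)"
  using assms(1,5-)
proof (induction L arbitrary: m rule: finite_induct)
  case (insert k L)
  note m = insert.prems(1) and ind = insert.prems(2) and rel = insert.prems(3)
  have "\<exists>g\<in>G. m k g y0 \<noteq> 0"
  proof (rule ccontr)
    assume "\<not> ?thesis"
    moreover have "(\<Sum>l\<in>L. (if l = k then 1 else 0) * m l g y0) = 0" for g
      using insert.hyps by (intro sum.neutral) auto
    ultimately have "\<forall>l\<in>insert k L. (if l = k then 1 else 0 :: 'k) = 0"
      using insert.hyps by (intro ind) auto
    then show False by simp
  qed
  then obtain g1 where g1: "g1 \<in> G" "m k g1 y0 \<noteq> 0" by blast
  \<comment> \<open>Cross-multiplication with the pivot \<open>m k g1\<close> eliminates the summand
    \<open>k\<close>; linear independence at \<open>y0\<close> is inherited because the pivot is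
    nonzero there.\<close>
  define m' where "m' l g y = m l g y * m k g1 y - m l g1 y * m k g y" for l g y
  have L: "\<forall>l\<in>L. vanishes Y (c l)"
  proof (rule insert.IH)
    show "m' l g \<in> poly_functions C" for l g
      unfolding m'_def by (intro pf m)
    show "\<forall>l\<in>L. a l = 0" if a: "\<forall>g\<in>G. (\<Sum>l\<in>L. a l * m' l g y0) = 0" for a
    proof -
      define b where "b l = (if l = k then - (\<Sum>l\<in>L. a l * m l g1 y0) else a l * m k g1 y0)" for l
      have "(\<Sum>l\<in>insert k L. b l * m l g y0) = (\<Sum>l\<in>L. a l * m' l g y0)" for g
      proof -
        have "(\<Sum>l\<in>L. b l * m l g y0) = (\<Sum>l\<in>L. a l * m k g1 y0 * m l g y0)"
          using insert.hyps by (intro sum.cong) (auto simp: b_def)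
        then show ?thesis
          using insert.hyps
          by (simp add: m'_def b_def right_diff_distrib sum_subtractf sum_distrib_left
              sum_distrib_right mult_ac)
      qed
      then have "\<forall>l\<in>insert k L. b l = 0" using a by (intro ind) simp
      then have "a l * m k g1 y0 = 0" if "l \<in> L" for l
        using that insert.hyps(2) by (auto simp: b_def split: if_splits)
      then show ?thesis using g1(2) by simp
    qed
    show "(\<Sum>l\<in>L. c l y * m' l g y) = 0" if "g \<in> G" "y \<in> Y" for g y
    proof -
      have s: "(\<Sum>l\<in>L. c l y * m l h y) = - (c k y * m k h y)" if "h \<in> G" for h
        using rel[OF that \<open>y \<in> Y\<close>] insert.hyps by (simp add: eq_neg_iff_add_eq_0 add.commute)
      have "(\<Sum>l\<in>L. c l y * m' l g y)
          = (\<Sum>l\<in>L. c l y * m l g y) * m k g1 y - (\<Sum>l\<in>L. c l y * m l g1 y) * m k g y"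
        by (simp add: m'_def right_diff_distrib sum_subtractf sum_distrib_right mult.assoc)
      then show ?thesis unfolding s[OF that(1)] s[OF g1(1)] by (simp add: mult_ac)
    qed
  qed
  have "c k y * m k g1 y = 0" if "y \<in> Y" for y
  proof -
    have "(\<Sum>l\<in>L. c l y * m l g1 y) = 0"
      using L that by (intro sum.neutral) (auto simp: vanishes_def)
    then show ?thesis using rel[OF g1(1) that] insert.hyps by simp
  qed
  then have "vanishes Y (\<lambda>y. c k y * m k g1 y)" by (simp add: vanishes_def)
  moreover have "\<not> vanishes Y (m k g1)" using g1(2) y0 by (auto simp: vanishes_def)
  ultimately have "vanishes Y (c k)" using irr_mult[OF irr c m] by blast
  then show ?case using L by simp
qed simp

text \<open>Send \<open>(g, y)\<close> to \<open>y\<close> together with the values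
  \<open>\<beta> i (g, y)\<close>. Independence at the single parameter \<open>y0\<close> makes this
  map dominant onto \<open>Y\<close> times an affine space. By Chevalley the image contains a
  nonempty open set, and over a general \<open>y\<close> this set is nonempty, so the values at
  \<open>y\<close> alone are dense.\<close>

lemma generic_independence:
  fixes \<beta> :: "nat \<Rightarrow> ('k::{alg_closed_field, field_char_0} ^ 'm) \<times> ('k ^ 'n) \<Rightarrow> 'k"
  assumes G: "closedin zariski G" "irr polys G" and Y: "closedin zariski Y" "irr polys Y"
    and \<beta>: "\<And>i. \<beta> i \<in> poly_functions coords2"
    and y0: "y0 \<in> Y" "indep (\<lambda>i g. \<beta> i (g, y0)) I G"
  obtains h where "h \<in> polys" "\<not> vanishes Y h"
    "\<forall>y\<in>Y. h y \<noteq> 0 \<longrightarrow> indep (\<lambda>i g. \<beta> i (g, y)) I G"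
proof -
  define e where "e y v = case_sum (\<lambda>j. y $ j) v" for y :: "'k ^ 'n" and v :: "nat \<Rightarrow> 'k"
  define p where "p s z = e (snd z) (\<lambda>i. \<beta> i z) s" for s z
  let ?K = "range Inl \<union> Inr ` I :: ('n + nat) set"
  have e: "e y v (Inl j) = y $ j" "e y v (Inr i) = v i" for y v i j
    by (simp_all add: e_def)
  have p: "(\<lambda>s. p s z) = e (snd z) (\<lambda>i. \<beta> i z)" for z
    by (simp add: p_def)
  have coord: "(\<lambda>y. y $ j) \<in> polys" for j
    by (rule poly_functions.coord) (simp add: coords_eq_range)
  \<comment> \<open>\<open>P\<close> is a sum of products of functions \<open>a l\<close> of
    \<open>y\<close> and linearly independent \<open>\<mu> l\<close> in the remaining variables. The
    \<open>\<mu> l\<close> stay linearly independent as functions of \<open>g\<close> at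
    \<open>y0\<close>, so a relation with coefficients depending on \<open>y\<close> is
    trivial.\<close>
  have dense: "P (e y v) = 0"
    if P: "P \<in> Pol ?K" "vanishes (G \<times> Y) (\<lambda>z. P (\<lambda>s. p s z))" and y: "y \<in> Y" for P y v
  proof -
    obtain L :: "nat set" and a \<mu> where L: "finite L" "\<forall>l. a l \<in> Pol (range Inl)" "\<forall>l. \<mu> l \<in> Pol (Inr ` I)"
      "\<forall>w. P w = (\<Sum>l\<in>L. a l w * \<mu> l w)"
      "\<forall>b. (\<forall>w. (\<Sum>l\<in>L. b l * \<mu> l w) = 0) \<longrightarrow> (\<forall>l\<in>L. b l = 0)"
      using Pol_Un_expand_independent[OF P(1)] .
    have a: "a l (e y v) = a l (e y v')" for l y v v'
      by (rule Pol_cong[OF L(2)[rule_format]]) (auto simp: e)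
    have \<mu>: "\<mu> l (e y (\<lambda>i. w (Inr i))) = \<mu> l w" for l y w
      by (rule Pol_cong[OF L(3)[rule_format]]) (auto simp: e)
    have "\<forall>l\<in>L. vanishes Y (\<lambda>y. a l (e y (\<lambda>_. 0)))"
    proof (rule no_generic_relation[where m = "\<lambda>l g y. \<mu> l (e y (\<lambda>i. \<beta> i (g, y)))"])
      show "(\<lambda>y. a l (e y (\<lambda>_. 0))) \<in> polys" for l
        by (rule Pol_comp[OF L(2)[rule_format]]) (auto simp: e coord)
      show "(\<lambda>y. \<mu> l (e y (\<lambda>i. \<beta> i (g, y)))) \<in> polys" for l g
        by (rule Pol_comp[OF L(3)[rule_format]]) (auto simp: e coords2_Pair2[OF \<beta>])
      show "\<forall>l\<in>L. b l = 0" if b: "\<forall>g\<in>G. (\<Sum>l\<in>L. b l * \<mu> l (e y0 (\<lambda>i. \<beta> i (g, y0)))) = 0" for b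
      proof -
        have "(\<lambda>v. \<mu> l (e y0 v)) \<in> Pol I" for l
          unfolding Pol_def
          by (rule Pol_comp[OF L(3)[rule_format]]) (auto simp: e intro: poly_functions.coord)
        then have "(\<lambda>v. \<Sum>l\<in>L. b l * \<mu> l (e y0 v)) \<in> Pol I"
          unfolding Pol_def by (intro pf_sum poly_functions.mult poly_functions.const)
        moreover have "vanishes G (\<lambda>g. \<Sum>l\<in>L. b l * \<mu> l (e y0 (\<lambda>i. \<beta> i (g, y0))))"
          using b by (simp add: vanishes_def)
        ultimately have "vanishes UNIV (\<lambda>v. \<Sum>l\<in>L. b l * \<mu> l (e y0 v))"
          by (rule indepD[OF y0(2)])
        then have v0: "(\<Sum>l\<in>L. b l * \<mu> l (e y0 v)) = 0" for v
          by (simp add: vanishes_def)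
        have "\<forall>w. (\<Sum>l\<in>L. b l * \<mu> l w) = 0"
        proof
          fix w
          show "(\<Sum>l\<in>L. b l * \<mu> l w) = 0"
            using v0[of "\<lambda>i. w (Inr i)"] unfolding \<mu> .
        qed
        then show ?thesis using L(5) by blast
      qed
      show "(\<Sum>l\<in>L. a l (e y (\<lambda>_. 0)) * \<mu> l (e y (\<lambda>i. \<beta> i (g, y)))) = 0" if "g \<in> G" "y \<in> Y" for g y
      proof -
        have "P (\<lambda>s. p s (g, y)) = 0" using P(2) that by (simp add: vanishes_def)
        then have "(\<Sum>l\<in>L. a l (e y (\<lambda>i. \<beta> i (g, y))) * \<mu> l (e y (\<lambda>i. \<beta> i (g, y)))) = 0"
          unfolding p L(4)[rule_format] by simp
        then show ?thesis unfolding a[of _ y "\<lambda>i. \<beta> i (g, y)" "\<lambda>_. 0"] .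
      qed
    qed (use L(1) Y(2) y0(1) in auto)
    then have "a l (e y v) = 0" if "l \<in> L" for l
      using that y a[of l y v "\<lambda>_. 0"] by (simp add: vanishes_def)
    then show ?thesis unfolding L(4)[rule_format] by simp
  qed
  let ?c = "case_sum (\<lambda>i (x :: 'k ^ 'm, y :: 'k ^ 'n). x $ i) (\<lambda>j (x, y). y $ j)"
  have zc: "zclosed ?c (G \<times> Y)"
    by (rule zclosed_Times[OF zclosed_if_closedin[OF G(1)] zclosed_if_closedin[OF Y(1)]])
  have irrc: "irr (poly_functions (range ?c)) (G \<times> Y)"
    using irr_Times[OF G(2) Y(2)] unfolding coords2_eq_range .
  have pc: "p ` ?K \<subseteq> poly_functions (range ?c)"
    unfolding coords2_eq_range[symmetric]
  proof
    fix f assume "f \<in> p ` ?K"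
    then consider j where "f = p (Inl j)" | i where "f = p (Inr i)" by blast
    then show "f \<in> poly_functions coords2"
    proof cases
      case 1
      then show ?thesis using coords2_snd[OF coord, of j] by (simp add: p_def[abs_def] e)
    next
      case 2
      then show ?thesis using \<beta>[of i] by (simp add: p_def[abs_def] e)
    qed
  qed
  have one: "(\<lambda>z. 1) \<in> poly_functions (range ?c)" "\<not> vanishes (G \<times> Y) (\<lambda>z. 1 :: 'k)"
    using irr_nontrivial[OF irrc, of "1 :: 'k"] by (auto intro: poly_functions.const)
  from chevalley[OF zc irrc pc one]
  obtain h' where h': "h' \<in> Pol ?K" "\<not> vanishes (G \<times> Y) (\<lambda>z. h' (\<lambda>s. p s z))"
    "\<forall>u. h' u \<noteq> 0 \<longrightarrow> (\<forall>P\<in>Pol ?K. vanishes (G \<times> Y) (\<lambda>z. P (\<lambda>s. p s z)) \<longrightarrow> P u = 0) \<longrightarrow>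
      (\<exists>z\<in>G \<times> Y. (1 :: 'k) \<noteq> 0 \<and> (\<forall>s\<in>?K. p s z = u s))"
    by (elim bexE conjE)
  obtain g1 y1 where gy: "g1 \<in> G" "y1 \<in> Y" "h' (\<lambda>s. p s (g1, y1)) \<noteq> 0"
    using h'(2) by (auto simp: vanishes_def)
  \<comment> \<open>Evaluating \<open>h'\<close> at the fixed values \<open>v1\<close> turns it into
    a function of \<open>y\<close> alone, nonzero at \<open>y1\<close>.\<close>
  define v1 where "v1 i = \<beta> i (g1, y1)" for i
  show ?thesis
  proof (rule that[of "\<lambda>y. h' (e y v1)"])
    show "(\<lambda>y. h' (e y v1)) \<in> polys"
      by (rule Pol_comp[OF h'(1)]) (auto simp: e coord intro: poly_functions.const)
    show "\<not> vanishes Y (\<lambda>y. h' (e y v1))"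
      using gy by (auto simp: vanishes_def p v1_def[abs_def])
    show "\<forall>y\<in>Y. h' (e y v1) \<noteq> 0 \<longrightarrow> indep (\<lambda>i g. \<beta> i (g, y)) I G"
    proof (intro ballI impI)
      fix y assume y: "y \<in> Y" "h' (e y v1) \<noteq> 0"
      show "indep (\<lambda>i g. \<beta> i (g, y)) I G"
        unfolding indep_def
      proof (intro ballI impI)
        fix Q assume Q: "Q \<in> Pol I" "vanishes G (\<lambda>g. Q (\<lambda>i. \<beta> i (g, y)))"
        have "(\<lambda>v. h' (e y v)) \<in> Pol I"
          unfolding Pol_def
          by (rule Pol_comp[OF h'(1)]) (auto simp: e intro: poly_functions.const poly_functions.coord)
        moreover have "\<not> vanishes UNIV (\<lambda>v. h' (e y v))"
          using y(2) by (auto simp: vanishes_def)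
        moreover have "Q v * h' (e y v) = 0" for v
        proof (cases "h' (e y v) = 0")
          case False
          have "\<forall>P\<in>Pol ?K. vanishes (G \<times> Y) (\<lambda>z. P (\<lambda>s. p s z)) \<longrightarrow> P (e y v) = 0"
            using dense y(1) by blast
          \<comment> \<open>Where \<open>h'\<close> does not vanish, \<open>v\<close> is attained by
            some \<open>g\<close> over the same \<open>y\<close>, because the coordinates of
            \<open>y\<close> are part of the map.\<close>
          from h'(3)[THEN spec, THEN mp, OF False, THEN mp, OF this]
          obtain g y' where z: "g \<in> G" "y' \<in> Y" "\<forall>s\<in>?K. p s (g, y') = e y v s" by auto
          have "y' $ j = y $ j" for j
            using z(3)[rule_format, of "Inl j"] by (simp add: p_def e)
          then have "y' = y" by (simp add: vec_eq_iff)
          then have "\<beta> i (g, y) = v i" if "i \<in> I" for i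
            using z(3)[rule_format, of "Inr i"] that by (simp add: p_def e)
          then have "Q (\<lambda>i. \<beta> i (g, y)) = Q v" by (rule Pol_cong[OF Q(1)])
          then have "Q v = 0" using Q(2) z(1) by (simp add: vanishes_def)
          then show ?thesis by simp
        qed simp
        then have "vanishes UNIV (\<lambda>v. Q v * h' (e y v))" by (simp add: vanishes_def)
        ultimately show "vanishes UNIV Q" using irr_mult[OF irr_Pol_UNIV Q(1)] by blast
      qed
    qed
  qed
qed

section \<open>Krull dimension\<close>

lemma regular_map_pullback:
  assumes "regular_map C X p" "b \<in> polys"
  obtains q where "q \<in> poly_functions C" "\<forall>x\<in>X. q x = b (p x)"
proof -
  have "\<forall>i. \<exists>q. q \<in> poly_functions C \<and> (\<forall>x\<in>X. p x $ i = q x)"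
    using assms(1) unfolding regular_map_def by blast
  from choice[OF this] obtain q where q: "\<forall>i. q i \<in> poly_functions C \<and> (\<forall>x\<in>X. p x $ i = q i x)" ..
  have "(\<lambda>x. b (\<chi> i. q i x)) \<in> poly_functions C"
    by (rule pf_comp[OF assms(2)]) (use q in \<open>auto simp: coords_eq_range\<close>)
  moreover have "(\<chi> i. q i x) = p x" if "x \<in> X" for x
    using q that by (simp add: vec_eq_iff)
  ultimately show ?thesis using that[of "\<lambda>x. b (\<chi> i. q i x)"] by simp
qed

lemma regular_map_pullback_family:
  assumes "regular_map C X p" "f ` I \<subseteq> polys"
  obtains q where "\<forall>i\<in>I. q i \<in> poly_functions C" "\<forall>i\<in>I. \<forall>x\<in>X. q i x = f i (p x)"
proof -
  have "\<forall>i\<in>I. \<exists>q. q \<in> poly_functions C \<and> (\<forall>x\<in>X. q x = f i (p x))"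
  proof
    fix i assume "i \<in> I"
    then have "f i \<in> polys" using assms(2) by blast
    from regular_map_pullback[OF assms(1) this] obtain q
      where "q \<in> poly_functions C" "\<forall>x\<in>X. q x = f i (p x)" .
    then show "\<exists>q. q \<in> poly_functions C \<and> (\<forall>x\<in>X. q x = f i (p x))" by (intro exI conjI)
  qed
  from bchoice[OF this] obtain q
    where "\<forall>i\<in>I. q i \<in> poly_functions C \<and> (\<forall>x\<in>X. q i x = f i (p x))" ..
  then show ?thesis using that[of q] by simp
qed

lemma regular_map_subset: "regular_map C Y p \<Longrightarrow> Z \<subseteq> Y \<Longrightarrow> regular_map C Z p"
  unfolding regular_map_def by blast

lemma irr_regular_image:
  assumes "irr polys V" "regular_map coords V p"
  shows "irr polys (p ` V)"
  unfolding irr_def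
proof (intro conjI ballI impI)
  show "p ` V \<noteq> {}" using assms(1) by (simp add: irr_def)
  fix f g assume fg: "f \<in> polys" "g \<in> polys" "vanishes (p ` V) (\<lambda>x. f x * g x)"
  obtain f' where f': "f' \<in> polys" "\<forall>x\<in>V. f' x = f (p x)"
    using regular_map_pullback[OF assms(2) fg(1)] .
  obtain g' where g': "g' \<in> polys" "\<forall>x\<in>V. g' x = g (p x)"
    using regular_map_pullback[OF assms(2) fg(2)] .
  have "vanishes V (\<lambda>x. f' x * g' x)"
    using fg(3) f'(2) g'(2) by (simp add: vanishes_def)
  then have "vanishes V f' \<or> vanishes V g'" using irr_mult[OF assms(1) f'(1) g'(1)] by blast
  then show "vanishes (p ` V) f \<or> vanishes (p ` V) g"
    using f'(2) g'(2) by (simp add: vanishes_def)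
qed

lemma dim_ge_regular_image:
  fixes p :: "'k::field_char_0 ^ 'm \<Rightarrow> 'k ^ 'n"
  assumes p: "regular_map coords V p" and "dim_ge polys (p ` V) r"
  shows "dim_ge polys V r"
proof -
  obtain f :: "nat \<Rightarrow> 'k ^ 'n \<Rightarrow> 'k" and I
    where f: "finite I" "card I = r" "f ` I \<subseteq> polys" "indep f I (p ` V)"
    using assms(2) by (rule dim_geE)
  obtain q where q: "\<forall>i\<in>I. q i \<in> polys" "\<forall>i\<in>I. \<forall>x\<in>V. q i x = f i (p x)"
    using regular_map_pullback_family[OF p f(3)] .
  show ?thesis
  proof (rule dim_geI[OF f(1,2)])
    show "q ` I \<subseteq> polys" using q by blast
    have "indep (\<lambda>i x. f i (p x)) I V" using f(4) unfolding indep_image .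
    then show "indep q I V" using indep_cong[of I V q "\<lambda>i x. f i (p x)"] q by blast
  qed
qed

lemma dim_ge_one_nonconstant:
  fixes W :: "'x set" and B :: "('x \<Rightarrow> 'k::comm_ring_1) set"
  assumes "dim_ge B W (Suc d)"
  shows "\<not> (\<forall>g\<in>B. \<forall>x\<in>W. \<forall>y\<in>W. g x = g y)"
proof
  assume const: "\<forall>g\<in>B. \<forall>x\<in>W. \<forall>y\<in>W. g x = g y"
  obtain f :: "nat \<Rightarrow> 'x \<Rightarrow> 'k" and I where f: "finite I" "card I = Suc d" "f ` I \<subseteq> B" "indep f I W"
    using assms by (rule dim_geE)
  obtain i where i: "i \<in> I" using f(2) by fastforce
  obtain x where x: "x \<in> W" using indep_nonempty[OF f(4)] by blast
  have "(\<lambda>u. u i - f i x) \<in> Pol I"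
    unfolding Pol_def by (rule pf_diff[OF Pol_coord[OF i, unfolded Pol_def] poly_functions.const])
  moreover have "f i y = f i x" if "y \<in> W" for y using const f(3) i x that by blast
  then have "vanishes W (\<lambda>y. f i y - f i x)" by (simp add: vanishes_def)
  ultimately have "vanishes UNIV (\<lambda>u :: nat \<Rightarrow> 'k. u i - f i x)" by (intro indepD[OF f(4)])
  then have "(f i x + 1) - f i x = 0"
    unfolding vanishes_def by (rule bspec[of _ _ "\<lambda>_. f i x + 1"]) simp
  then show False by simp
qed

lemma krull_dim_geI:
  assumes "\<And>i. i \<le> n \<Longrightarrow> closedin T (Z i) \<and> irreducible_in T (Z i)" "\<And>i. i < n \<Longrightarrow> Z i \<subset> Z (Suc i)"
  shows "enat n \<le> krull_dim T"
  unfolding krull_dim_def by (rule Sup_upper) (use assms in blast)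

text \<open>The supremum may be infinite and then is not attained, but some chain is longer than
  \<open>n - 1\<close>. For \<open>n = 0\<close> the inequality would say nothing, as the empty
  space also has dimension 0.\<close>

lemma krull_dim_geE:
  assumes "enat n \<le> krull_dim T" "0 < n"
  obtains Z where "\<forall>i\<le>n. closedin T (Z i) \<and> irreducible_in T (Z i)" "\<forall>i<n. Z i \<subset> Z (Suc i)"
proof -
  have "enat (n - 1) < krull_dim T" using assms by (cases n) (auto simp: Suc_ile_eq)
  then obtain m Z where m: "enat (n - 1) < enat m"
    "\<forall>i\<le>m. closedin T (Z i) \<and> irreducible_in T (Z i)" "\<forall>i<m. Z i \<subset> Z (Suc i)"
    unfolding krull_dim_def less_Sup_iff by blast
  then have "n \<le> m" using assms(2) by simp
  then show ?thesis using that[of Z] m by simp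
qed

lemma irreducible_in_subtopologyD:
  assumes "irreducible_in (subtopology T S) Z"
  shows "irreducible_in T Z" "Z \<subseteq> S"
proof -
  have Z: "Z \<noteq> {}" "Z \<subseteq> topspace T \<inter> S"
    "closedin (subtopology T S) A \<Longrightarrow> closedin (subtopology T S) B \<Longrightarrow> Z \<subseteq> A \<union> B \<Longrightarrow> Z \<subseteq> A \<or> Z \<subseteq> B" for A B
    using assms by (simp_all add: irreducible_in_def)
  then show "Z \<subseteq> S" by blast
  have "Z \<subseteq> A \<or> Z \<subseteq> B" if "closedin T A" "closedin T B" "Z \<subseteq> A \<union> B" for A B
  proof -
    have "closedin (subtopology T S) (A \<inter> S)" "closedin (subtopology T S) (B \<inter> S)"
      using that(1,2) by (auto simp: closedin_subtopology)
    then show ?thesis using Z(3)[of "A \<inter> S" "B \<inter> S"] Z(2) that(3) by blast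
  qed
  then show "irreducible_in T Z" using Z(1,2) by (auto simp: irreducible_in_def)
qed

lemma dim_ge_if_zariski_dim_ge:
  fixes S :: "('k::field_char_0 ^ 'n) set"
  assumes "enat n \<le> zariski_dim S" "S \<noteq> {}"
  shows "dim_ge polys S n"
proof (cases "n = 0")
  case True
  show ?thesis unfolding True
    by (rule dim_geI[of "{}" _ "\<lambda>_ _. 0"]) (simp_all add: indep_empty assms(2))
next
  case False
  then have "0 < n" by simp
  then obtain Z where Z: "\<forall>i\<le>n. closedin (subtopology zariski S) (Z i) \<and> irreducible_in (subtopology zariski S) (Z i)"
    "\<forall>i<n. Z i \<subset> Z (Suc i)" using krull_dim_geE[OF assms(1)] by blast
  have irr: "irr polys (Z i)" and sub: "Z i \<subseteq> S" if "i \<le> n" for i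
    using Z(1) that irreducible_in_subtopologyD[of zariski S "Z i"]
    by (simp_all add: irreducible_in_zariski_iff)
  have ex: "\<exists>h\<in>polys. vanishes (Z i) h \<and> \<not> vanishes (Z (Suc i)) h" if i: "i < n" for i
  proof -
    have "closedin (subtopology zariski S) (Z i)" using Z(1) i by simp
    then obtain D where D: "closedin zariski D" "Z i = D \<inter> S" by (auto simp: closedin_subtopology)
    obtain F where F: "F \<subseteq> polys" "D = zero_set UNIV F"
      using D(1) unfolding closedin_zariski(2) by (elim exE conjE)
    obtain x where x: "x \<in> Z (Suc i)" "x \<notin> Z i" using Z(2) i by blast
    then have "x \<in> S" using sub[of "Suc i"] i by auto
    then have "x \<notin> D" using x(2) D(2) by blast
    then obtain h where h: "h \<in> F" "h x \<noteq> 0" by (auto simp: F(2) zero_set_def)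
    have "vanishes (Z i) h" using h(1) by (auto simp: D(2) F(2) zero_set_def vanishes_def)
    moreover have "\<not> vanishes (Z (Suc i)) h" using h(2) x(1) by (auto simp: vanishes_def)
    ultimately show ?thesis using h(1) F(1) by blast
  qed
  have mono: "Z i \<subseteq> Z (Suc i)" if "i < n" for i using Z(2) that by blast
  have "\<exists>f. (\<forall>i. f i \<in> polys) \<and> indep f {..<n} (Z n)"
    by (intro chain_independent[of n coords Z] irr mono ex)
  then obtain f where f: "\<forall>i. f i \<in> polys" "indep f {..<n} (Z n)" by (elim exE conjE)
  have "dim_ge polys (Z n) n" by (rule dim_geI[of "{..<n}" _ f]) (use f in auto)
  then show ?thesis by (rule dim_ge_mono) (simp add: sub)
qed

text \<open>Level sets of pulled-back functions come from closed subsets of the target. Counting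
  dimension by the same functions leaves \<open>d = 0\<close>, since functions constant on a set are
  not independent there.\<close>

lemma zariski_dim_ge_regular_image:
  fixes \<pi> :: "'k::{alg_closed_field, field_char_0} ^ 'm \<Rightarrow> 'k ^ 'n"
  assumes \<pi>: "regular_map coords X \<pi>" "\<pi> ` X \<subseteq> F" and h: "h \<in> polys"
    and V: "closedin zariski V" "irr polys V" "{x \<in> V. h x \<noteq> 0} \<subseteq> X" "\<not> vanishes V h"
    and dim: "dim_ge {q \<in> polys. \<exists>b\<in>polys. \<forall>x\<in>X. q x = b (\<pi> x)} V r"
  shows "enat r \<le> zariski_dim F"
proof -
  define B where "B = {q \<in> polys. \<exists>b\<in>polys. \<forall>x\<in>X. q x = b (\<pi> x)}"
  let ?T = "subtopology zariski F"
  have "\<exists>Z. (\<forall>i\<le>r - 0. closedin ?T (Z i) \<and> irreducible_in ?T (Z i)) \<and> (\<forall>i<r - 0. Z i \<subset> Z (Suc i)) \<and>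
    Z (r - 0) = ?T closure_of (\<pi> ` {x \<in> V. h x \<noteq> 0})"
  proof (rule chain_of_sections[OF order_refl _ h _ _ _ _ V dim[folded B_def]])
    show "B \<subseteq> polys" by (auto simp: B_def)
    show "\<pi> ` X \<subseteq> topspace ?T" using \<pi>(2) by (simp add: closedin_zariski(1))
  next
    fix C assume "closedin ?T C"
    then obtain D where D: "closedin zariski D" "C = D \<inter> F" by (auto simp: closedin_subtopology)
    obtain E where E: "E \<subseteq> polys" "D = zero_set UNIV E"
      using D(1) unfolding closedin_zariski(2) by (elim exE conjE)
    define S where "S = {q \<in> polys. \<exists>b\<in>E. \<forall>x\<in>X. q x = b (\<pi> x)}"
    have "\<pi> x \<in> C \<longleftrightarrow> (\<forall>f\<in>S. f x = 0)" if x: "x \<in> X" for x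
    proof -
      have "\<pi> x \<in> C \<longleftrightarrow> (\<forall>b\<in>E. b (\<pi> x) = 0)"
        using \<pi>(2) x by (auto simp: D(2) E(2) zero_set_def)
      also have "\<dots> \<longleftrightarrow> (\<forall>f\<in>S. f x = 0)"
      proof
        assume "\<forall>b\<in>E. b (\<pi> x) = 0"
        then show "\<forall>f\<in>S. f x = 0" using x unfolding S_def by auto
      next
        assume S: "\<forall>f\<in>S. f x = 0"
        show "\<forall>b\<in>E. b (\<pi> x) = 0"
        proof
          fix b assume b: "b \<in> E"
          then have "b \<in> polys" using E(1) by blast
          from regular_map_pullback[OF \<pi>(1) this] obtain q where "q \<in> polys" "\<forall>x\<in>X. q x = b (\<pi> x)" .
          then have "q \<in> S" "q x = b (\<pi> x)" using b x unfolding S_def by blast+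
          then show "b (\<pi> x) = 0" using bspec[OF S] by metis
        qed
      qed
      finally show ?thesis .
    qed
    then show "\<exists>S\<subseteq>polys. \<forall>x\<in>X. \<pi> x \<in> C \<longleftrightarrow> (\<forall>f\<in>S. f x = 0)"
      by (intro exI[of _ S]) (auto simp: S_def)
  next
    fix g c assume "g \<in> B"
    then obtain b where b: "b \<in> polys" "\<forall>x\<in>X. g x = b (\<pi> x)" unfolding B_def by blast
    have "(\<lambda>y. b y - c) \<in> polys" by (intro pf b)
    then have "closedin ?T ({y. b y - c = 0} \<inter> F)"
      unfolding closedin_subtopology using closedin_zariski_zeros by blast
    moreover have "\<pi> x \<in> {y. b y - c = 0} \<inter> F \<longleftrightarrow> g x = c" if "x \<in> X" for x
      using b(2) \<pi>(2) that by auto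
    ultimately show "\<exists>C. closedin ?T C \<and> (\<forall>x\<in>X. \<pi> x \<in> C \<longleftrightarrow> g x = c)"
      by (intro exI[of _ "{y. b y - c = 0} \<inter> F"]) blast
  next
    fix W assume "\<forall>g\<in>B. \<forall>x\<in>W. \<forall>y\<in>W. g x = g y"
    then show "\<not> dim_ge B W (Suc 0)" using dim_ge_one_nonconstant by blast
  qed
  then obtain Z where "\<forall>i\<le>r. closedin ?T (Z i) \<and> irreducible_in ?T (Z i)" "\<forall>i<r. Z i \<subset> Z (Suc i)"
    unfolding diff_zero by (elim exE conjE)
  then show ?thesis by (intro krull_dim_geI[of r ?T Z]) auto
qed

lemma zariski_dim_ge_if_open_piece:
  fixes V :: "('k::{alg_closed_field, field_char_0} ^ 'n) set"
  assumes V: "closedin zariski V" "irr polys V" and h: "h \<in> polys" "\<not> vanishes V h"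
    and F: "{x \<in> V. h x \<noteq> 0} \<subseteq> F" and dim: "dim_ge polys V r"
  shows "enat r \<le> zariski_dim F"
proof (rule zariski_dim_ge_regular_image[where \<pi> = "\<lambda>x. x" and X = "{x \<in> V. h x \<noteq> 0}"])
  show "regular_map coords {x \<in> V. h x \<noteq> 0} (\<lambda>x :: 'k ^ 'n. x)"
    unfolding regular_map_def
  proof
    fix i
    have "(\<lambda>x :: 'k ^ 'n. x $ i) \<in> polys" by (rule poly_functions.coord) (simp add: coords_eq_range)
    then show "\<exists>p\<in>polys. \<forall>x\<in>{x \<in> V. h x \<noteq> 0}. x $ i = p x"
      by (rule bexI[rotated]) simp
  qed
  have "{q \<in> polys. \<exists>b\<in>polys. \<forall>x\<in>{x \<in> V. h x \<noteq> 0}. q x = b x} = polys" by blast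
  then show "dim_ge {q \<in> polys. \<exists>b\<in>polys. \<forall>x\<in>{x \<in> V. h x \<noteq> 0}. q x = b x} V r" using dim by simp
qed (use assms in auto)

text \<open>A reducible \<open>G\<close> is handled through an irreducible closed subset on whose
  image the functions remain independent. The intended image is an orbit, with \<open>G\<close> the
  group.\<close>

lemma zariski_dim_regular_image_ge_iff:
  fixes \<pi> :: "'k::{alg_closed_field, field_char_0} ^ 'm \<Rightarrow> 'k ^ 'n"
  assumes G: "closedin zariski G" "G \<noteq> {}" and \<pi>: "regular_map coords G \<pi>"
  shows "enat r \<le> zariski_dim (\<pi> ` G) \<longleftrightarrow> dim_ge polys (\<pi> ` G) r"
proof
  assume "enat r \<le> zariski_dim (\<pi> ` G)"
  then show "dim_ge polys (\<pi> ` G) r" by (rule dim_ge_if_zariski_dim_ge) (simp add: G(2))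
next
  assume "dim_ge polys (\<pi> ` G) r"
  then obtain f :: "nat \<Rightarrow> 'k ^ 'n \<Rightarrow> 'k" and I
    where f: "finite I" "card I = r" "f ` I \<subseteq> polys" "indep f I (\<pi> ` G)" by (rule dim_geE)
  have "indep f I (\<pi> ` A) \<or> indep f I (\<pi> ` B)" if "indep f I (\<pi> ` (A \<union> B))" for A B
    using that unfolding image_Un by (rule indep_Un)
  moreover have "\<not> indep f I (\<pi> ` {})" using indep_nonempty[of f I "{}"] by auto
  ultimately obtain V where V: "closedin zariski V" "irr polys V" "V \<subseteq> G" "indep f I (\<pi> ` V)"
    using exists_irreducible_closed[of G "\<lambda>V. indep f I (\<pi> ` V)"] G(1) f(4) by metis
  define B where "B = {q \<in> polys. \<exists>b\<in>polys. \<forall>x\<in>G. q x = b (\<pi> x)}"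
  obtain q where q: "\<forall>i\<in>I. q i \<in> polys" "\<forall>i\<in>I. \<forall>x\<in>G. q i x = f i (\<pi> x)"
    using regular_map_pullback_family[OF \<pi> f(3)] .
  have "dim_ge B V r"
  proof (rule dim_geI[OF f(1,2)])
    show "q ` I \<subseteq> B" using q f(3) unfolding B_def by blast
    have "indep (\<lambda>i x. f i (\<pi> x)) I V" using V(4) unfolding indep_image .
    moreover have "q i x = f i (\<pi> x)" if "i \<in> I" "x \<in> V" for i x using q that V(3) by blast
    ultimately show "indep q I V" using indep_cong[of I V q "\<lambda>i x. f i (\<pi> x)"] by blast
  qed
  moreover have "\<not> vanishes V (\<lambda>x. 1 :: 'k)" using V(2) by (auto simp: irr_def vanishes_def)
  ultimately show "enat r \<le> zariski_dim (\<pi> ` G)"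
    using zariski_dim_ge_regular_image[OF \<pi> order_refl poly_functions.const[of 1] V(1,2)] V(3)
    unfolding B_def by blast
qed

section \<open>Actions of affine algebraic groups\<close>

lemma enat_eqI: "(\<And>r. enat r \<le> a \<longleftrightarrow> enat r \<le> b) \<Longrightarrow> a = b"
proof -
  have "a \<le> b" if "\<And>r. enat r \<le> a \<Longrightarrow> enat r \<le> b" for a b :: enat
  proof (cases a)
    case (enat n)
    then show ?thesis using that[of n] by simp
  next
    case infinity
    then show ?thesis using that[of "Suc (the_enat b)"] by (cases b) auto
  qed
  then show "a = b" if "\<And>r. enat r \<le> a \<longleftrightarrow> enat r \<le> b" by (intro antisym) (use that in auto)
qed

lemma enat_diff_leI:
  assumes "\<And>n. enat n \<le> z \<Longrightarrow> enat (n - d) \<le> k"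
  shows "z - enat d \<le> k"
proof (cases z)
  case (enat n)
  then show ?thesis using assms[of n] by simp
next
  case infinity
  have "enat r \<le> k" for r using assms[of "r + d"] infinity by simp
  then have "k = \<infinity>" by (intro enat_eqI) simp
  then show ?thesis by simp
qed

lemma le_enat_diffI: "enat (n + d) \<le> z \<Longrightarrow> enat n \<le> z - enat d"
  by (cases z) auto

lemma connectedin_if_irr:
  fixes V :: "('k::idom ^ 'n) set"
  assumes "irr polys V"
  shows "connectedin zariski V"
proof -
  have V: "irreducible_in zariski V" using assms by (simp add: irreducible_in_zariski_iff)
  have False if "closedin zariski A" "closedin zariski B" "V \<subseteq> A \<union> B" "A \<inter> B \<inter> V = {}"
    "A \<inter> V \<noteq> {}" "B \<inter> V \<noteq> {}" for A B
  proof -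
    have "V \<subseteq> A \<or> V \<subseteq> B" using V that(1-3) unfolding irreducible_in_def by blast
    then show False using that(4-6) by blast
  qed
  then show ?thesis unfolding connectedin_closedin closedin_zariski(1) by blast
qed

lemma spectrum_const: "h \<in> spectrum X A \<Longrightarrow> h (\<lambda>x\<in>X. c) = c"
  unfolding spectrum_def by blast

lemma spectrum_add:
  "h \<in> spectrum X A \<Longrightarrow> f \<in> A \<Longrightarrow> g \<in> A \<Longrightarrow> h (\<lambda>x\<in>X. f x + g x) = h f + h g"
  unfolding spectrum_def by blast

lemma spectrum_mult:
  "h \<in> spectrum X A \<Longrightarrow> f \<in> A \<Longrightarrow> g \<in> A \<Longrightarrow> h (\<lambda>x\<in>X. f x * g x) = h f * h g"
  unfolding spectrum_def by blast

locale irreducible_affine_action =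
  fixes G :: "('k::{alg_closed_field, field_char_0} ^ 'm) monoid" (structure)
    and X :: "('k ^ 'n) set" and \<phi> :: "'k ^ 'm \<Rightarrow> 'k ^ 'n \<Rightarrow> 'k ^ 'n"
  assumes algebraic_group: "affine_algebraic_group G"
    and closed: "closedin zariski X" and irreducible: "irr polys X"
    and action: "algebraic_action G X \<phi>"
begin

abbreviation H where "H \<equiv> identity_component G"

abbreviation \<pi> where "\<pi> \<equiv> quotient_map_to G X \<phi>"

sublocale group_action G X \<phi>
  using action by (simp add: algebraic_action_def)

sublocale group G
  using algebraic_group by (simp add: affine_algebraic_group_def)

lemma closed_group: "closedin zariski (carrier G)"
  using algebraic_group by (simp add: affine_algebraic_group_def)

lemma regular_mult: "w \<in> carrier G \<Longrightarrow> regular_map coords (carrier G) (\<lambda>g. w \<otimes> g)"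
proof -
  assume w: "w \<in> carrier G"
  show ?thesis unfolding regular_map_def
  proof
    fix i
    have "regular_map coords2 (carrier G \<times> carrier G) (\<lambda>(g, h). g \<otimes> h)"
      using algebraic_group by (simp add: affine_algebraic_group_def)
    then obtain p where p: "p \<in> poly_functions coords2"
      "\<forall>z\<in>carrier G \<times> carrier G. (case z of (g, h) \<Rightarrow> g \<otimes> h) $ i = p z"
      unfolding regular_map_def by blast
    then show "\<exists>q\<in>polys. \<forall>g\<in>carrier G. (w \<otimes> g) $ i = q g"
      using w by (intro bexI[OF _ coords2_Pair2[OF p(1)]]) auto
  qed
qed

lemma regular_action: "regular_map coords2 (carrier G \<times> X) (\<lambda>z. \<phi> (fst z) (snd z))"
  using action by (simp add: algebraic_action_def case_prod_beta')

lemma action_pullback: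
  assumes "b \<in> polys"
  obtains q where "q \<in> poly_functions coords2"
    "\<forall>g\<in>carrier G. \<forall>x\<in>X. q (g, x) = b (\<phi> g x)"
proof -
  obtain q where "q \<in> poly_functions coords2" "\<forall>z\<in>carrier G \<times> X. q z = b (\<phi> (fst z) (snd z))"
    using regular_map_pullback[OF regular_action assms] .
  then show ?thesis using that[of q] by simp
qed

lemma regular_translation:
  assumes "g \<in> carrier G"
  shows "regular_map coords X (\<phi> g)"
  unfolding regular_map_def
proof
  fix i
  obtain p where p: "p \<in> poly_functions coords2" "\<forall>z\<in>carrier G \<times> X. \<phi> (fst z) (snd z) $ i = p z"
    using regular_action unfolding regular_map_def by blast
  then show "\<exists>q\<in>polys. \<forall>x\<in>X. \<phi> g x $ i = q x"
    using assms by (intro bexI[OF _ coords2_Pair2[OF p(1)]]) auto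
qed

lemma regular_orbit_map:
  assumes "x \<in> X"
  shows "regular_map coords (carrier G) (\<lambda>g. \<phi> g x)"
  unfolding regular_map_def
proof
  fix i
  obtain p where p: "p \<in> poly_functions coords2" "\<forall>z\<in>carrier G \<times> X. \<phi> (fst z) (snd z) $ i = p z"
    using regular_action unfolding regular_map_def by blast
  then show "\<exists>q\<in>polys. \<forall>g\<in>carrier G. \<phi> g x $ i = q g"
    using assms by (intro bexI[OF _ coords2_Pair1[OF p(1)]]) auto
qed

lemma carrier_H: "carrier H = connected_component_of_set (subtopology zariski (carrier G)) \<one>"
  by (simp add: identity_component_def)

lemma H_subset: "carrier H \<subseteq> carrier G"
  unfolding carrier_H using connected_component_of_subset_topspace[of "subtopology zariski (carrier G)"]
  by auto

lemma closed_H: "closedin zariski (carrier H)"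
  using closedin_connected_component_of closed_group unfolding carrier_H
  by (rule closedin_trans_full)

lemma one_H: "\<one> \<in> carrier H"
  unfolding carrier_H by (simp add: connected_component_of_refl closedin_zariski(1))

text \<open>Translating each irreducible component of \<open>G\<close> to the identity shows that \<open>H\<close> has finite index.\<close>

lemma finite_index:
  obtains N where "finite N" "N \<subseteq> carrier G" "carrier G \<subseteq> (\<Union>z\<in>N. (\<lambda>h. z \<otimes> h) ` carrier H)"
proof -
  obtain \<V> where \<V>: "finite \<V>" "carrier G = \<Union>\<V>" "\<And>V. V \<in> \<V> \<Longrightarrow> closedin zariski V \<and> irr polys V"
    using finite_irreducible_cover[OF closed_group] by metis
  have "V \<noteq> {}" if "V \<in> \<V>" for V using \<V>(3)[OF that] by (simp add: irr_def)
  then have "\<forall>V\<in>\<V>. \<exists>z. z \<in> V" by blast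
  from bchoice[OF this] obtain z where z: "\<forall>V\<in>\<V>. z V \<in> V" ..
  have "V \<subseteq> (\<lambda>h. z V \<otimes> h) ` carrier H" if V: "V \<in> \<V>" for V
  proof
    fix v assume v: "v \<in> V"
    have sub: "V \<subseteq> carrier G" using V \<V>(2) by blast
    have zV: "z V \<in> carrier G" using z V sub by blast
    let ?W = "(\<lambda>h. inv z V \<otimes> h) ` V"
    have "inv z V \<in> carrier G" using zV by simp
    from regular_map_subset[OF regular_mult[OF this] sub] \<V>(3)[OF V]
    have "irr polys ?W" by (intro irr_regular_image) simp_all
    moreover have "?W \<subseteq> carrier G" using sub zV by auto
    ultimately have "connectedin (subtopology zariski (carrier G)) ?W"
      by (simp add: connectedin_subtopology connectedin_if_irr)
    moreover have "\<one> \<in> ?W" using z V zV by (intro image_eqI[of _ _ "z V"]) auto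
    ultimately have "?W \<subseteq> carrier H"
      unfolding carrier_H by (rule connected_component_of_maximal)
    then have "inv z V \<otimes> v \<in> carrier H" using v by blast
    moreover have "v = z V \<otimes> (inv z V \<otimes> v)"
      using zV v sub by (simp add: m_assoc[symmetric] subsetD)
    ultimately show "v \<in> (\<lambda>h. z V \<otimes> h) ` carrier H" by blast
  qed
  then have "carrier G \<subseteq> (\<Union>w\<in>z ` \<V>. (\<lambda>h. w \<otimes> h) ` carrier H)" unfolding \<V>(2) by blast
  moreover have "z ` \<V> \<subseteq> carrier G" using z \<V>(2) by blast
  ultimately show ?thesis using that[of "z ` \<V>"] \<V>(1) by blast
qed

section \<open>Orbits and their dimensions\<close>

lemma orbit_image: "orbit K \<phi> x = (\<lambda>g. \<phi> g x) ` carrier K"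
  by (auto simp: orbit_def)

lemma orbit_subset: "x \<in> X \<Longrightarrow> orbit G \<phi> x \<subseteq> X"
  using element_image by (auto simp: orbit_def)

lemma orbit_eq:
  assumes x: "x \<in> X" and y: "y \<in> orbit G \<phi> x"
  shows "orbit G \<phi> y = orbit G \<phi> x"
proof -
  have yX: "y \<in> X" using orbit_subset[OF x] y by blast
  have "x \<in> orbit G \<phi> y" by (rule orbit_sym[OF x yX y])
  then have "z \<in> orbit G \<phi> y \<longleftrightarrow> z \<in> orbit G \<phi> x" for z
    using orbit_trans[OF x yX _ y, of z] orbit_trans[OF yX x, of z] orbit_subset[OF x] orbit_subset[OF yX]
    by blast
  then show ?thesis by blast
qed

text \<open>The orbit of \<open>G\<close> is covered by finitely many translates of that of
  \<open>H\<close>. One translate carries the independent functions, and composing them with the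
  translation, a regular map, brings them to the orbit of \<open>H\<close>.\<close>

lemma dim_ge_orbit_iff:
  assumes x: "x \<in> X"
  shows "dim_ge polys (orbit G \<phi> x) r \<longleftrightarrow> dim_ge polys (orbit H \<phi> x) r"
proof
  assume dim: "dim_ge polys (orbit G \<phi> x) r"
  obtain N where N: "finite N" "N \<subseteq> carrier G" "carrier G \<subseteq> (\<Union>z\<in>N. (\<lambda>h. z \<otimes> h) ` carrier H)"
    by (rule finite_index)
  have "orbit G \<phi> x \<subseteq> \<Union>((\<lambda>z. \<phi> z ` orbit H \<phi> x) ` N)"
  proof
    fix y assume "y \<in> orbit G \<phi> x"
    then obtain g where g: "g \<in> carrier G" "y = \<phi> g x" by (auto simp: orbit_def)
    then obtain z h where zh: "z \<in> N" "h \<in> carrier H" "g = z \<otimes> h" using N(3) by blast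
    then have "y = \<phi> z (\<phi> h x)" using g composition_rule[OF x, of z h] N(2) H_subset by blast
    then show "y \<in> \<Union>((\<lambda>z. \<phi> z ` orbit H \<phi> x) ` N)" using zh by (auto simp: orbit_def)
  qed
  from dim_ge_Union[OF dim_ge_mono[OF dim this]] obtain z
    where z: "z \<in> N" "dim_ge polys (\<phi> z ` orbit H \<phi> x) r" using N(1) by blast
  have "orbit H \<phi> x \<subseteq> X" using x H_subset element_image by (auto simp: orbit_def)
  then show "dim_ge polys (orbit H \<phi> x) r"
    using dim_ge_regular_image[OF _ z(2)] regular_map_subset[OF regular_translation] z(1) N(2) by blast
next
  assume "dim_ge polys (orbit H \<phi> x) r"
  then show "dim_ge polys (orbit G \<phi> x) r"
    by (rule dim_ge_mono) (use H_subset in \<open>auto simp: orbit_def\<close>)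
qed

lemma zariski_dim_orbit_ge_iff:
  assumes "x \<in> X"
  shows "enat r \<le> zariski_dim (orbit G \<phi> x) \<longleftrightarrow> dim_ge polys (orbit G \<phi> x) r"
  unfolding orbit_image
  by (rule zariski_dim_regular_image_ge_iff[OF closed_group _ regular_orbit_map[OF assms]]) auto

lemma zariski_dim_orbit_H:
  assumes x: "x \<in> X"
  shows "zariski_dim (orbit H \<phi> x) = zariski_dim (orbit G \<phi> x)"
proof (rule enat_eqI)
  fix r
  have "enat r \<le> zariski_dim (orbit H \<phi> x) \<longleftrightarrow> dim_ge polys (orbit H \<phi> x) r"
    unfolding orbit_image
    using regular_map_subset[OF regular_orbit_map[OF x] H_subset] closed_H one_H
    by (intro zariski_dim_regular_image_ge_iff) auto
  then show "enat r \<le> zariski_dim (orbit H \<phi> x) \<longleftrightarrow> enat r \<le> zariski_dim (orbit G \<phi> x)"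
    using dim_ge_orbit_iff[OF x] zariski_dim_orbit_ge_iff[OF x] by simp
qed

lemma zariski_dim_orbit_le:
  assumes "x \<in> X"
  shows "zariski_dim (orbit G \<phi> x) \<le> enat CARD('n)"
proof (rule ccontr)
  assume "\<not> ?thesis"
  then have "enat (Suc CARD('n)) \<le> zariski_dim (orbit G \<phi> x)" by (simp add: Suc_ile_eq)
  then show False
    using zariski_dim_orbit_ge_iff[OF assms] dim_ge_bound[where ?'n = 'n and r = "Suc CARD('n)"] by fastforce
qed

text \<open>For points of \<open>X\<close> the value \<open>the_enat\<close> is meaningful, since
  orbits have dimension at most \<open>CARD('n)\<close>. Orbits of the identity component have the
  same dimension.\<close>

definition orbit_dim where
  "orbit_dim x = the_enat (zariski_dim (orbit G \<phi> x))"

lemma orbit_dim: "x \<in> X \<Longrightarrow> zariski_dim (orbit G \<phi> x) = enat (orbit_dim x)"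
  using zariski_dim_orbit_le[of x] enat_ile by (fastforce simp: orbit_dim_def)

lemma dim_ge_orbit_dim: "x \<in> X \<Longrightarrow> dim_ge polys (orbit G \<phi> x) r \<longleftrightarrow> r \<le> orbit_dim x"
  using zariski_dim_orbit_ge_iff[of x r] orbit_dim[of x] by simp

lemma regular_locus_iff:
  "x \<in> regular_locus G \<phi> X \<longleftrightarrow> x \<in> X \<and> (\<forall>y\<in>X. orbit_dim y \<le> orbit_dim x)"
  by (auto simp: regular_locus_def orbit_dim)

lemma regular_locus_nonempty: "\<exists>x. x \<in> regular_locus G \<phi> X"
proof -
  have fin: "finite (orbit_dim ` X)"
    by (rule finite_subset[of _ "{..CARD('n)}"]) (use zariski_dim_orbit_le orbit_dim in force)+
  have "X \<noteq> {}" using irreducible by (simp add: irr_def)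
  then obtain x where "x \<in> X" "orbit_dim x = Max (orbit_dim ` X)"
    using Max_in[OF fin] by (metis (no_types, lifting) image_iff image_is_empty)
  then show ?thesis using Max_ge[OF fin] unfolding regular_locus_iff by fastforce
qed

text \<open>The same functions witness the maximal orbit dimension at all general points.\<close>

lemma generic_orbit:
  assumes Y: "closedin zariski Y" "irr polys Y" "Y \<subseteq> X" and x: "x \<in> Y"
  obtains h f and I :: "nat set" where "h \<in> polys" "\<not> vanishes Y h" "finite I" "card I = orbit_dim x"
    "\<forall>i. f i \<in> polys" "\<forall>y\<in>Y. h y \<noteq> 0 \<longrightarrow> indep f I (orbit G \<phi> y)"
proof -
  have "x \<in> X" using x Y(3) by blast
  then have "dim_ge polys (orbit G \<phi> x) (orbit_dim x)" by (simp add: dim_ge_orbit_dim)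
  then obtain f0 :: "nat \<Rightarrow> 'k ^ 'n \<Rightarrow> 'k" and I
    where f0: "finite I" "card I = orbit_dim x" "f0 ` I \<subseteq> polys" "indep f0 I (orbit G \<phi> x)" by (rule dim_geE)
  \<comment> \<open>Functions outside \<open>I\<close> are set to 0 so that \<open>f i\<close> is a
    polynomial, and can be pulled back, for every index.\<close>
  define f where "f i = (if i \<in> I then f0 i else (\<lambda>_. 0))" for i
  have f: "\<forall>i. f i \<in> polys" using f0(3) by (auto simp: f_def intro: poly_functions.const)
  have "indep f I (orbit G \<phi> x)"
    using f0(4) indep_cong[of I "orbit G \<phi> x" f f0] by (simp add: f_def)
  then have ind: "indep (\<lambda>i g. f i (\<phi> g x)) I (carrier G)" unfolding orbit_image indep_image .
  obtain \<V> where \<V>: "finite \<V>" "carrier G = \<Union>\<V>" "\<And>V. V \<in> \<V> \<Longrightarrow> closedin zariski V \<and> irr polys V"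
    using finite_irreducible_cover[OF closed_group] by metis
  \<comment> \<open>The group may be reducible, so independence is kept on one irreducible component
    \<open>V\<close>; the part of an orbit swept out by \<open>V\<close> then suffices.\<close>
  obtain V where V: "V \<in> \<V>" "indep (\<lambda>i g. f i (\<phi> g x)) I V"
    using indep_Union[OF \<V>(1) ind[unfolded \<V>(2)]] by (elim bexE)
  have sub: "V \<subseteq> carrier G" using V(1) \<V>(2) by blast
  have "\<forall>i. \<exists>q. q \<in> poly_functions coords2 \<and> (\<forall>g\<in>carrier G. \<forall>x\<in>X. q (g, x) = f i (\<phi> g x))"
    using action_pullback[OF f[rule_format]] by metis
  from choice[OF this] obtain \<beta> where
    \<beta>: "\<forall>i. \<beta> i \<in> poly_functions coords2 \<and> (\<forall>g\<in>carrier G. \<forall>x\<in>X. \<beta> i (g, x) = f i (\<phi> g x))" ..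
  have eq: "indep (\<lambda>i g. \<beta> i (g, y)) I V \<longleftrightarrow> indep (\<lambda>i g. f i (\<phi> g y)) I V" if "y \<in> Y" for y
    by (rule indep_cong) (use \<beta> that Y(3) sub in blast)
  obtain h where h: "h \<in> polys" "\<not> vanishes Y h"
    "\<forall>y\<in>Y. h y \<noteq> 0 \<longrightarrow> indep (\<lambda>i g. \<beta> i (g, y)) I V"
  proof (rule generic_independence[where \<beta> = \<beta> and I = I and G = V and Y = Y and ?y0.0 = x])
    show "closedin zariski V" "irr polys V" using \<V>(3) V(1) by blast+
    show "\<beta> i \<in> poly_functions coords2" for i using \<beta> by blast
    show "indep (\<lambda>i g. \<beta> i (g, x)) I V" using V(2) eq[OF x] by blast
  qed (use Y x in auto)
  have "indep f I (orbit G \<phi> y)" if "y \<in> Y" "h y \<noteq> 0" for y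
  proof -
    have "indep (\<lambda>i g. f i (\<phi> g y)) I V" using h(3) that eq by blast
    then show ?thesis unfolding orbit_image indep_image using sub by (rule indep_superset)
  qed
  then show ?thesis using that[of h I f] h(1,2) f0(1,2) f by blast
qed

text \<open>Semicontinuity: where the functions from \<open>generic_orbit\<close> stay independent,
  the orbit dimension is at least that of \<open>x\<close>, which is already maximal.\<close>

lemma regular_locus_open_piece:
  assumes Y: "closedin zariski Y" "irr polys Y" "Y \<subseteq> X" and x: "x \<in> Y" "x \<in> regular_locus G \<phi> X"
  obtains h where "h \<in> polys" "\<not> vanishes Y h" "{y \<in> Y. h y \<noteq> 0} \<subseteq> regular_locus G \<phi> X"
proof -
  obtain h f and I :: "nat set" where h: "h \<in> polys" "\<not> vanishes Y h" "finite I" "card I = orbit_dim x"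
    "\<forall>i. f i \<in> polys" "\<forall>y\<in>Y. h y \<noteq> 0 \<longrightarrow> indep f I (orbit G \<phi> y)"
    using generic_orbit[OF Y x(1)] .
  have "y \<in> regular_locus G \<phi> X" if "y \<in> Y" "h y \<noteq> 0" for y
  proof -
    have "dim_ge polys (orbit G \<phi> y) (orbit_dim x)"
      using h that by (intro dim_geI[of I _ f]) auto
    then have "orbit_dim x \<le> orbit_dim y" using dim_ge_orbit_dim that(1) Y(3) by blast
    then show ?thesis
      using x(2) that(1) Y(3) unfolding regular_locus_iff by (meson order_trans subsetD)
  qed
  then show ?thesis using that[of h] h(1,2) by blast
qed

section \<open>Modality and the categorical quotient\<close>

lemma quotient_map_apply: "f \<in> invariant_ring G X \<phi> \<Longrightarrow> \<pi> x f = f x"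
  by (simp add: quotient_map_to_def)

lemma invariant_ring_poly:
  assumes "f \<in> invariant_ring G X \<phi>"
  obtains p where "p \<in> polys" "f = restrict p X"
  using assms by (auto simp: invariant_ring_def coord_ring_def)

text \<open>On \<open>F\<close> a fibre of the quotient map is a finite union of orbits, all of dimension \<open>d\<close>.\<close>

lemma family_dim_le_quotient_dim:
  assumes visible: "visible G X \<phi>"
    and V: "closedin zariski V" "irr polys V" "V \<subseteq> X" and h: "h \<in> polys" "\<not> vanishes V h"
    and F: "{x \<in> V. h x \<noteq> 0} \<subseteq> F" "F \<subseteq> V" and d: "\<And>x. x \<in> F \<Longrightarrow> orbit_dim x = d"
  shows "zariski_dim F - enat d \<le> krull_dim (quotient_space G X \<phi>)"
proof (rule enat_diff_leI)
  fix n assume n: "enat n \<le> zariski_dim F"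
  let ?T = "quotient_space G X \<phi>" and ?A = "invariant_ring G X \<phi>"
  let ?X = "{x \<in> V. h x \<noteq> 0}"
  have "?X \<noteq> {}" using h(2) by (auto simp: vanishes_def)
  then have "F \<noteq> {}" using F(1) by blast
  then have dim: "dim_ge polys V n"
    using dim_ge_if_zariski_dim_ge[OF n] F(2) by (blast intro: dim_ge_mono)
  \<comment> \<open>Invariants are functions restricted to \<open>X\<close>; \<open>A\<close>
    collects their polynomial representatives, whose level sets cut \<open>V\<close>.\<close>
  define A where "A = {p \<in> polys. restrict p X \<in> ?A}"
  have XX: "x \<in> X" if "x \<in> ?X" for x using that V(3) by blast
  have "\<exists>Z. (\<forall>i\<le>n - d. closedin ?T (Z i) \<and> irreducible_in ?T (Z i)) \<and> (\<forall>i<n - d. Z i \<subset> Z (Suc i)) \<and>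
    Z (n - d) = ?T closure_of (\<pi> ` {x \<in> V. h x \<noteq> 0})"
  proof (rule chain_of_sections[OF _ order_refl h(1) _ _ _ _ V(1,2) order_refl h(2) dim])
    show "A \<subseteq> polys" by (auto simp: A_def)
    show "\<pi> ` ?X \<subseteq> topspace ?T" using quotient_space(3)[OF action] XX by (auto simp: Pi_iff)
  next
    fix C assume C: "closedin ?T C"
    then obtain S where S: "S \<subseteq> ?A" "C = {h \<in> spectrum X ?A. \<forall>f\<in>S. h f = 0}"
      unfolding quotient_space(2)[OF action] by (elim exE conjE)
    have "\<pi> x \<in> C \<longleftrightarrow> (\<forall>f\<in>{p \<in> polys. restrict p X \<in> S}. f x = 0)" if x: "x \<in> ?X" for x
    proof -
      have "\<pi> x \<in> spectrum X ?A"
        using quotient_space(3)[OF action] XX[OF x] quotient_space(1)[OF action] by (auto simp: Pi_iff)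
      then have "\<pi> x \<in> C \<longleftrightarrow> (\<forall>f\<in>S. f x = 0)"
        using S quotient_map_apply by (auto simp: subset_iff)
      also have "\<dots> \<longleftrightarrow> (\<forall>f\<in>{p \<in> polys. restrict p X \<in> S}. f x = 0)"
      proof
        assume l: "\<forall>f\<in>S. f x = 0"
        show "\<forall>f\<in>{p \<in> polys. restrict p X \<in> S}. f x = 0"
        proof
          fix p assume "p \<in> {p \<in> polys. restrict p X \<in> S}"
          then have "restrict p X x = 0" using l by blast
          then show "p x = 0" using XX[OF x] by simp
        qed
      next
        assume r: "\<forall>f\<in>{p \<in> polys. restrict p X \<in> S}. f x = 0"
        show "\<forall>f\<in>S. f x = 0"
        proof
          fix f assume f: "f \<in> S"
          then have "f \<in> ?A" using S(1) by blast
          then obtain p where p: "p \<in> polys" "f = restrict p X" by (rule invariant_ring_poly)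
          then have "p x = 0" using bspec[OF r, of p] f by blast
          then show "f x = 0" using p(2) XX[OF x] by simp
        qed
      qed
      finally show ?thesis .
    qed
    then show "\<exists>S\<subseteq>polys. \<forall>x\<in>?X. \<pi> x \<in> C \<longleftrightarrow> (\<forall>f\<in>S. f x = 0)"
      by (intro exI[of _ "{p \<in> polys. restrict p X \<in> S}"]) auto
  next
    fix g c assume "g \<in> A"
    then have g: "restrict g X \<in> ?A" by (simp add: A_def)
    \<comment> \<open>On \<open>X\<close> the level set of \<open>g\<close> is the zero set of the
      invariant \<open>g - c\<close>.\<close>
    let ?f = "\<lambda>x\<in>X. restrict g X x + (\<lambda>x\<in>X. - c) x"
    have f: "?f \<in> ?A"
      by (rule invariant_ring_closed(2)[OF action g invariant_ring_closed(1)[OF action]])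
    define C where "C = {h \<in> spectrum X ?A. \<forall>f\<in>{?f}. h f = 0}"
    have "closedin ?T C"
      unfolding quotient_space(2)[OF action] C_def by (rule exI[of _ "{?f}"]) (use f in simp)
    moreover have "\<pi> x \<in> C \<longleftrightarrow> g x = c" if x: "x \<in> ?X" for x
    proof -
      have "\<pi> x \<in> spectrum X ?A"
        using quotient_space(3)[OF action] XX[OF x] quotient_space(1)[OF action] by (auto simp: Pi_iff)
      then have "\<pi> x \<in> C \<longleftrightarrow> ?f x = 0"
        unfolding C_def using quotient_map_apply[OF f, of x] by simp
      then show ?thesis using XX[OF x] by simp
    qed
    ultimately show "\<exists>C. closedin ?T C \<and> (\<forall>x\<in>?X. \<pi> x \<in> C \<longleftrightarrow> g x = c)" by blast
  next
    fix W assume W: "W \<subseteq> ?X" and const: "\<forall>g\<in>A. \<forall>x\<in>W. \<forall>y\<in>W. g x = g y"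
    show "\<not> dim_ge polys W (Suc d)"
    proof
      assume dim: "dim_ge polys W (Suc d)"
      then obtain w where w: "w \<in> W" using dim_ge_nonempty by blast
      let ?fib = "{x \<in> X. \<pi> x = \<pi> w}"
      have "W \<subseteq> ?fib"
      proof
        fix x assume x: "x \<in> W"
        have "f x = f w" if f: "f \<in> ?A" for f
        proof -
          obtain p where p: "p \<in> polys" "f = restrict p X" using f by (rule invariant_ring_poly)
          then have "p x = p w" using const x w f unfolding A_def by blast
          then show ?thesis using p(2) W XX x w by (auto simp: subset_iff)
        qed
        then have "\<pi> x = \<pi> w" unfolding quotient_map_to_def by (intro restrict_ext)
        then show "x \<in> ?fib" using W XX x by auto
      qed
      have wX: "w \<in> X" using W XX w by blast
      then have "\<pi> w \<in> topspace ?T" using quotient_space(3)[OF action] by (auto simp: Pi_iff)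
      then have fin: "finite (orbits G ?fib \<phi>)" using visible unfolding visible_def by blast
      \<comment> \<open>Only orbits that meet \<open>W\<close> are kept: they contain a point of
        \<open>F\<close>, so their dimension is \<open>d\<close>.\<close>
      let ?O = "{orb \<in> orbits G ?fib \<phi>. orb \<inter> W \<noteq> {}}"
      have "W \<subseteq> \<Union>?O"
      proof
        fix x assume x: "x \<in> W"
        then have "x \<in> ?fib" using \<open>W \<subseteq> ?fib\<close> by blast
        moreover from this have "x \<in> orbit G \<phi> x" using orbit_refl by blast
        ultimately show "x \<in> \<Union>?O" using x unfolding orbits_def by blast
      qed
      from dim_ge_Union[OF dim_ge_mono[OF dim this]] fin
      obtain orb where orb: "orb \<in> ?O" "dim_ge polys orb (Suc d)" by auto
      then obtain x y where xy: "x \<in> X" "orb = orbit G \<phi> x" "y \<in> orb" "y \<in> W"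
        unfolding orbits_def by blast
      have y: "y \<in> X" "y \<in> F" using xy(4) W XX F(1) by blast+
      have "dim_ge polys (orbit G \<phi> y) (Suc d)" using orb(2) orbit_eq[OF xy(1)] xy(2,3) by simp
      then show False using dim_ge_orbit_dim[OF y(1)] d[OF y(2)] by simp
    qed
  qed
  then obtain Z where "\<forall>i\<le>n - d. closedin ?T (Z i) \<and> irreducible_in ?T (Z i)"
    "\<forall>i<n - d. Z i \<subset> Z (Suc i)" by (elim exE conjE)
  then show "enat (n - d) \<le> krull_dim ?T" by (intro krull_dim_geI[of "n - d" ?T Z]) auto
qed

text \<open>An algebra homomorphism commutes with polynomials. Membership in the invariant ring is
  carried along because the laws in \<open>spectrum\<close> speak only about elements of the
  ring.\<close>

lemma spectrum_Pol:
  assumes P: "P \<in> Pol J" and a: "\<And>i. i \<in> J \<Longrightarrow> a i \<in> invariant_ring G X \<phi>"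
  shows "(\<lambda>x\<in>X. P (\<lambda>i. a i x)) \<in> invariant_ring G X \<phi> \<and>
    (\<forall>h\<in>spectrum X (invariant_ring G X \<phi>). h (\<lambda>x\<in>X. P (\<lambda>i. a i x)) = P (\<lambda>i. h (a i)))"
  using P unfolding Pol_def
proof induction
  case (const c)
  show ?case
    by (intro conjI ballI invariant_ring_closed(1)[OF action] spectrum_const)
next
  case (coord f)
  then obtain i where i: "i \<in> J" "f = (\<lambda>u. u i)" by blast
  obtain p where "p \<in> polys" "a i = restrict p X" using invariant_ring_poly[OF a[OF i(1)]] .
  then have "(\<lambda>x\<in>X. a i x) = a i" by (intro ext) simp
  then show ?case using a[OF i(1)] i(2) by simp
next
  case (add f g)
  let ?f = "\<lambda>x\<in>X. f (\<lambda>i. a i x)" and ?g = "\<lambda>x\<in>X. g (\<lambda>i. a i x)"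
  have eq: "(\<lambda>x\<in>X. f (\<lambda>i. a i x) + g (\<lambda>i. a i x)) = (\<lambda>x\<in>X. ?f x + ?g x)"
    by (rule restrict_ext) simp
  have fg: "?f \<in> invariant_ring G X \<phi>" "?g \<in> invariant_ring G X \<phi>" using add.IH by blast+
  show ?case
    unfolding eq
  proof (intro conjI ballI)
    show "(\<lambda>x\<in>X. ?f x + ?g x) \<in> invariant_ring G X \<phi>"
      by (rule invariant_ring_closed(2)[OF action fg])
    fix h assume h: "h \<in> spectrum X (invariant_ring G X \<phi>)"
    have "h (\<lambda>x\<in>X. ?f x + ?g x) = h ?f + h ?g" by (rule spectrum_add[OF h fg])
    also have "h ?f = f (\<lambda>i. h (a i))" using add.IH(1) h by blast
    also have "h ?g = g (\<lambda>i. h (a i))" using add.IH(2) h by blast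
    finally show "h (\<lambda>x\<in>X. ?f x + ?g x) = f (\<lambda>i. h (a i)) + g (\<lambda>i. h (a i))" .
  qed
next
  case (mult f g)
  let ?f = "\<lambda>x\<in>X. f (\<lambda>i. a i x)" and ?g = "\<lambda>x\<in>X. g (\<lambda>i. a i x)"
  have eq: "(\<lambda>x\<in>X. f (\<lambda>i. a i x) * g (\<lambda>i. a i x)) = (\<lambda>x\<in>X. ?f x * ?g x)"
    by (rule restrict_ext) simp
  have fg: "?f \<in> invariant_ring G X \<phi>" "?g \<in> invariant_ring G X \<phi>" using mult.IH by blast+
  show ?case
    unfolding eq
  proof (intro conjI ballI)
    show "(\<lambda>x\<in>X. ?f x * ?g x) \<in> invariant_ring G X \<phi>"
      by (rule invariant_ring_closed(3)[OF action fg])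
    fix h assume h: "h \<in> spectrum X (invariant_ring G X \<phi>)"
    have "h (\<lambda>x\<in>X. ?f x * ?g x) = h ?f * h ?g" by (rule spectrum_mult[OF h fg])
    also have "h ?f = f (\<lambda>i. h (a i))" using mult.IH(1) h by blast
    also have "h ?g = g (\<lambda>i. h (a i))" using mult.IH(2) h by blast
    finally show "h (\<lambda>x\<in>X. ?f x * ?g x) = f (\<lambda>i. h (a i)) * g (\<lambda>i. h (a i))" .
  qed
qed

text \<open>A chain yields independent polynomials in the evaluation functions on the spectrum, and
  each of them is evaluation at one invariant. A relation between these invariants on
  \<open>X\<close> is an equation in the invariant ring, so every homomorphism respects it; thus
  independence passes from the spectrum to \<open>X\<close>.\<close>

lemma quotient_dim_independent:
  assumes n: "enat n \<le> krull_dim (quotient_space G X \<phi>)"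
  obtains a :: "nat \<Rightarrow> 'k ^ 'n \<Rightarrow> 'k" where "\<forall>i<n. a i \<in> polys"
    "\<forall>i<n. \<forall>g\<in>carrier G. \<forall>x\<in>X. a i (\<phi> g x) = a i x" "indep a {..<n} X"
proof (cases "n = 0")
  case True
  have "X \<noteq> {}" using irreducible by (simp add: irr_def)
  then show ?thesis using that[of "\<lambda>_ _. 0"] True by (simp add: indep_empty)
next
  case False
  let ?T = "quotient_space G X \<phi>" and ?A = "invariant_ring G X \<phi>"
  let ?S = "spectrum X ?A"
  define E where "E = {(\<lambda>h :: ('k ^ 'n \<Rightarrow> 'k) \<Rightarrow> 'k. h f) | f. f \<in> ?A}"
  have "0 < n" using False by simp
  then obtain Z where Z: "\<forall>i\<le>n. closedin ?T (Z i) \<and> irreducible_in ?T (Z i)" "\<forall>i<n. Z i \<subset> Z (Suc i)"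
    using krull_dim_geE[OF n] by blast
  have ZS: "Z i \<subseteq> ?S" if "i \<le> n" for i
    using Z(1) that quotient_space(1)[OF action] unfolding irreducible_in_def by metis
  have elem: "\<exists>a\<in>?A. \<forall>h\<in>?S. r h = h a" if "r \<in> poly_functions E" for r
    using that
  proof induction
    case (const c)
    show ?case using invariant_ring_closed(1)[OF action, of c]
      by (intro bexI[of _ "\<lambda>x\<in>X. c"] ballI spectrum_const[symmetric])
  next
    case (coord f)
    then show ?case unfolding E_def by blast
  next
    case (add f g)
    then obtain a b where ab: "a \<in> ?A" "\<forall>h\<in>?S. f h = h a" "b \<in> ?A" "\<forall>h\<in>?S. g h = h b" by (elim bexE)
    show ?case
    proof (intro bexI[of _ "\<lambda>x\<in>X. a x + b x"] ballI invariant_ring_closed(2)[OF action ab(1,3)])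
      fix h assume h: "h \<in> ?S"
      show "f h + g h = h (\<lambda>x\<in>X. a x + b x)"
        unfolding spectrum_add[OF h ab(1,3)] using ab(2,4) h by simp
    qed
  next
    case (mult f g)
    then obtain a b where ab: "a \<in> ?A" "\<forall>h\<in>?S. f h = h a" "b \<in> ?A" "\<forall>h\<in>?S. g h = h b" by (elim bexE)
    show ?case
    proof (intro bexI[of _ "\<lambda>x\<in>X. a x * b x"] ballI invariant_ring_closed(3)[OF action ab(1,3)])
      fix h assume h: "h \<in> ?S"
      show "f h * g h = h (\<lambda>x\<in>X. a x * b x)"
        unfolding spectrum_mult[OF h ab(1,3)] using ab(2,4) h by simp
    qed
  qed
  have closed_zeros: "closedin ?T {h \<in> ?S. h a = 0}" if "a \<in> ?A" for a
    unfolding quotient_space(2)[OF action] by (rule exI[of _ "{a}"]) (use that in auto)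
  have irr: "irr (poly_functions E) (Z i)" if i: "i \<le> n" for i
    unfolding irr_def
  proof (intro conjI ballI impI)
    have irrZ: "irreducible_in ?T (Z i)" using Z(1) i by blast
    then show "Z i \<noteq> {}" by (simp add: irreducible_in_def)
    fix f g assume fg: "f \<in> poly_functions E" "g \<in> poly_functions E" "vanishes (Z i) (\<lambda>h. f h * g h)"
    obtain a b where ab: "a \<in> ?A" "\<forall>h\<in>?S. f h = h a" "b \<in> ?A" "\<forall>h\<in>?S. g h = h b"
      using elem[OF fg(1)] elem[OF fg(2)] by (elim bexE)
    have "Z i \<subseteq> {h \<in> ?S. h a = 0} \<union> {h \<in> ?S. h b = 0}"
    proof
      fix h assume h: "h \<in> Z i"
      then have "h \<in> ?S" "f h * g h = 0" using ZS[OF i] fg(3) by (auto simp: vanishes_def)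
      then show "h \<in> {h \<in> ?S. h a = 0} \<union> {h \<in> ?S. h b = 0}" using ab(2,4) by auto
    qed
    then have "Z i \<subseteq> {h \<in> ?S. h a = 0} \<or> Z i \<subseteq> {h \<in> ?S. h b = 0}"
      using irrZ closed_zeros[OF ab(1)] closed_zeros[OF ab(3)] unfolding irreducible_in_def by blast
    then show "vanishes (Z i) f \<or> vanishes (Z i) g"
      using ab(2,4) unfolding vanishes_def by fastforce
  qed
  have mono: "Z i \<subseteq> Z (Suc i)" if "i < n" for i using Z(2) that by blast
  have ex: "\<exists>r\<in>poly_functions E. vanishes (Z i) r \<and> \<not> vanishes (Z (Suc i)) r" if i: "i < n" for i
  proof -
    have "closedin ?T (Z i)" using Z(1) i by simp
    then obtain F where F: "F \<subseteq> ?A" "Z i = {h \<in> ?S. \<forall>f\<in>F. h f = 0}"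
      unfolding quotient_space(2)[OF action] by (elim exE conjE)
    obtain h where h: "h \<in> Z (Suc i)" "h \<notin> Z i" using Z(2) i by blast
    then have "h \<in> ?S" using ZS[of "Suc i"] i by auto
    then obtain f where f: "f \<in> F" "h f \<noteq> 0" using h(2) F(2) by blast
    have "(\<lambda>h. h f) \<in> poly_functions E"
      using f(1) F(1) unfolding E_def by (intro poly_functions.coord) blast
    moreover have "vanishes (Z i) (\<lambda>h. h f)" using f(1) F(2) by (simp add: vanishes_def)
    moreover have "\<not> vanishes (Z (Suc i)) (\<lambda>h. h f)" using f(2) h(1) by (auto simp: vanishes_def)
    ultimately show ?thesis by blast
  qed
  have "\<exists>r. (\<forall>i. r i \<in> poly_functions E) \<and> indep r {..<n} (Z n)"
    by (intro chain_independent[of n E Z] irr mono ex)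
  then obtain r where r: "\<forall>i. r i \<in> poly_functions E" "indep r {..<n} (Z n)" by (elim exE conjE)
  have "\<forall>i. \<exists>p. p \<in> polys \<and> restrict p X \<in> ?A \<and> (\<forall>h\<in>?S. r i h = h (restrict p X))"
  proof
    fix i
    obtain b where b: "b \<in> ?A" "\<forall>h\<in>?S. r i h = h b" using elem[OF spec[OF r(1), of i]] by (elim bexE)
    obtain p where "p \<in> polys" "b = restrict p X" using invariant_ring_poly[OF b(1)] .
    then show "\<exists>p. p \<in> polys \<and> restrict p X \<in> ?A \<and> (\<forall>h\<in>?S. r i h = h (restrict p X))"
      using b by (intro exI[of _ p]) simp
  qed
  from choice[OF this] obtain a where
    a: "\<forall>i. a i \<in> polys \<and> restrict (a i) X \<in> ?A \<and> (\<forall>h\<in>?S. r i h = h (restrict (a i) X))" ..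
  have "indep (\<lambda>i h. h (restrict (a i) X)) {..<n} (Z n)"
    using indep_cong[of "{..<n}" "Z n" r "\<lambda>i h. h (restrict (a i) X)"] a r(2) ZS[OF order_refl] by blast
  then have ind: "indep (\<lambda>i h. h (restrict (a i) X)) {..<n} ?S"
    by (rule indep_superset[OF _ ZS[OF order_refl]])
  show ?thesis
  proof (rule that[of a])
    show "\<forall>i<n. a i \<in> polys" using a by blast
    show "\<forall>i<n. \<forall>g\<in>carrier G. \<forall>x\<in>X. a i (\<phi> g x) = a i x"
    proof (intro allI impI ballI)
      fix i g x assume gx: "g \<in> carrier G" "x \<in> X"
      then have "restrict (a i) X (\<phi> g x) = restrict (a i) X x"
        using a unfolding invariant_ring_def by blast
      then show "a i (\<phi> g x) = a i x" using gx element_image by auto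
    qed
    show "indep a {..<n} X"
      unfolding indep_def
    proof (intro ballI impI)
      fix P :: "(nat \<Rightarrow> 'k) \<Rightarrow> 'k" assume P: "P \<in> Pol {..<n}" "vanishes X (\<lambda>x. P (\<lambda>i. a i x))"
      have "P (\<lambda>i. h (restrict (a i) X)) = 0" if h: "h \<in> ?S" for h
      proof -
        have "(\<lambda>x\<in>X. P (\<lambda>i. restrict (a i) X x)) = (\<lambda>x\<in>X. 0)"
          using P(2) by (intro restrict_ext) (simp add: vanishes_def)
        moreover have "h (\<lambda>x\<in>X. P (\<lambda>i. restrict (a i) X x)) = P (\<lambda>i. h (restrict (a i) X))"
          using spectrum_Pol[OF P(1), of "\<lambda>i. restrict (a i) X"] a h by blast
        moreover have "h (\<lambda>x\<in>X. 0) = 0" using h by (rule spectrum_const)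
        ultimately show ?thesis by simp
      qed
      then show "vanishes UNIV P" by (intro indepD[OF ind P(1)]) (simp add: vanishes_def)
    qed
  qed
qed

text \<open>Invariants that are independent on \<open>X\<close> stay independent together with functions that are
  independent on general orbits, since the former are constant along orbits.\<close>

lemma dim_ge_invariants_plus_orbits:
  fixes a f :: "nat \<Rightarrow> 'k ^ 'n \<Rightarrow> 'k"
  assumes a: "\<forall>i<n. a i \<in> polys" "\<forall>i<n. \<forall>g\<in>carrier G. \<forall>x\<in>X. a i (\<phi> g x) = a i x" "indep a {..<n} X"
    and h: "h \<in> polys" "\<not> vanishes X h"
    and f: "finite I" "\<forall>i. f i \<in> polys" "\<forall>y\<in>X. h y \<noteq> 0 \<longrightarrow> indep f I (orbit G \<phi> y)"
  shows "dim_ge polys X (n + card I)"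
proof -
  \<comment> \<open>Indices below \<open>n\<close> belong to the invariants; the functions on orbits
    are shifted by \<open>n\<close>.\<close>
  define F where "F k = (if k < n then a k else f (k - n))" for k
  let ?K = "{..<n} \<union> (\<lambda>i. i + n) ` I"
  have "indep F ?K X"
    unfolding indep_def
  proof (intro ballI impI)
    fix P :: "(nat \<Rightarrow> 'k) \<Rightarrow> 'k" assume P: "P \<in> Pol ?K" "vanishes X (\<lambda>x. P (\<lambda>k. F k x))"
    show "vanishes UNIV P"
    proof (rule ccontr)
      assume "\<not> ?thesis"
      then obtain u where u: "P u \<noteq> 0" by (auto simp: vanishes_def)
      \<comment> \<open>Freezing the orbit variables at \<open>u\<close> leaves a nonzero polynomial
        in the invariants, which selects a general point \<open>y\<close>. Freezing the invariants
        at their values in \<open>y\<close> then leaves a nonzero polynomial \<open>R\<close> in the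
        orbit functions, which selects a point of the orbit of \<open>y\<close>.\<close>
      define Q where "Q v = P (\<lambda>k. if k < n then v k else u k)" for v
      have Q: "Q \<in> Pol {..<n}"
        unfolding Q_def Pol_def
        by (rule Pol_comp[OF P(1)]) (auto intro: poly_functions.coord poly_functions.const)
      have "Q u \<noteq> 0" using u by (simp add: Q_def)
      then have "\<not> vanishes UNIV Q" by (auto simp: vanishes_def)
      moreover have "indep a {..<n} {x \<in> X. h x \<noteq> 0}"
        by (rule indep_minus_zeros[OF a(3) irreducible h]) (use a(1) in auto)
      ultimately have "\<not> vanishes {x \<in> X. h x \<noteq> 0} (\<lambda>x. Q (\<lambda>i. a i x))"
        using indepD[OF _ Q] by blast
      then obtain y where y: "y \<in> X" "h y \<noteq> 0" "Q (\<lambda>i. a i y) \<noteq> 0" by (auto simp: vanishes_def)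
      define R where "R v = P (\<lambda>k. if k < n then a k y else v (k - n))" for v
      have R: "R \<in> Pol I"
        unfolding R_def Pol_def
        by (rule Pol_comp[OF P(1)]) (auto intro: poly_functions.coord poly_functions.const)
      have "(\<lambda>k. if k < n then a k y else u (k - n + n)) = (\<lambda>k. if k < n then a k y else u k)"
        by (rule ext) simp
      then have "R (\<lambda>i. u (i + n)) = Q (\<lambda>i. a i y)" by (simp only: R_def Q_def)
      then have "R (\<lambda>i. u (i + n)) \<noteq> 0" using y(3) by simp
      then have "\<not> vanishes UNIV R" unfolding vanishes_def by blast
      then have "\<not> vanishes (orbit G \<phi> y) (\<lambda>x. R (\<lambda>i. f i x))"
        using indepD[OF f(3)[rule_format, OF y(1,2)] R] by blast
      then obtain g where g: "g \<in> carrier G" "R (\<lambda>i. f i (\<phi> g y)) \<noteq> 0"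
        by (auto simp: vanishes_def orbit_def)
      have "(\<lambda>k. if k < n then a k y else f (k - n) (\<phi> g y)) = (\<lambda>k. F k (\<phi> g y))"
        using a(2) g(1) y(1) by (intro ext) (simp add: F_def)
      then have "P (\<lambda>k. F k (\<phi> g y)) \<noteq> 0" using g(2) by (simp add: R_def)
      moreover have "\<phi> g y \<in> X" using g(1) y(1) element_image by blast
      ultimately show False using P(2) by (simp add: vanishes_def)
    qed
  qed
  moreover have "finite ?K" using f(1) by simp
  moreover have "card ?K = n + card I"
    using f(1) by (subst card_Un_disjoint) (auto simp: card_image inj_on_def)
  moreover have "F ` ?K \<subseteq> polys" using a(1) f(2) by (auto simp: F_def)
  ultimately show ?thesis by (intro dim_geI[of ?K _ F])
qed

section \<open>Modality against the dimension of the quotient\<close>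

lemma family_modality_eq:
  assumes "F \<subseteq> X" "x \<in> F" "\<forall>x\<in>F. orbit_dim x = d"
  shows "family_modality H \<phi> F = zariski_dim F - enat d"
proof -
  have "\<forall>x\<in>F. zariski_dim (orbit H \<phi> x) = enat d"
    using assms(1,3) zariski_dim_orbit_H orbit_dim by auto
  then have "(THE d. \<forall>x\<in>F. zariski_dim (orbit H \<phi> x) = d) = enat d"
    using assms(2) by (intro the_equality) auto
  then show ?thesis by (simp add: family_modality_def)
qed

text \<open>The open piece given by \<open>generic_orbit\<close> need not be stable, so the family
  \<open>F\<close> is the union of its translates. Letting \<open>Y\<close> lie anywhere between the
  regular locus and \<open>X\<close> gives the bound for both modalities at once.\<close>

lemma quotient_dim_le_modality:
  assumes Y: "regular_locus G \<phi> X \<subseteq> Y" "Y \<subseteq> X"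
  shows "krull_dim (quotient_space G X \<phi>) \<le> modality G \<phi> Y"
proof -
  obtain x0 where x0: "x0 \<in> regular_locus G \<phi> X" using regular_locus_nonempty by blast
  then have x0X: "x0 \<in> X" by (simp add: regular_locus_iff)
  obtain h f and I :: "nat set" where h: "h \<in> polys" "\<not> vanishes X h"
    and f: "finite I" "card I = orbit_dim x0" "\<forall>i. f i \<in> polys"
      "\<forall>y\<in>X. h y \<noteq> 0 \<longrightarrow> indep f I (orbit G \<phi> y)"
    using generic_orbit[OF closed irreducible order_refl x0X] .
  define F where "F = {x \<in> X. \<exists>g\<in>carrier G. h (\<phi> g x) \<noteq> 0}"
  have hF: "{x \<in> X. h x \<noteq> 0} \<subseteq> F"
  proof
    fix x assume x: "x \<in> {x \<in> X. h x \<noteq> 0}"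
    then have "\<phi> \<one> x = x" using id_eq_one by (metis (mono_tags, lifting) mem_Collect_eq restrict_apply)
    then show "x \<in> F" using x unfolding F_def by (auto intro!: bexI[of _ \<one>])
  qed
  obtain x1 where "x1 \<in> X" "h x1 \<noteq> 0" using h(2) by (auto simp: vanishes_def)
  then have x1: "x1 \<in> F" using hF by blast
  have F_dim: "orbit_dim x = orbit_dim x0" if x: "x \<in> F" for x
  proof -
    obtain g where g: "g \<in> carrier G" "h (\<phi> g x) \<noteq> 0" "x \<in> X" using x by (auto simp: F_def)
    have gx: "\<phi> g x \<in> X" "\<phi> g x \<in> orbit G \<phi> x" using g element_image by (auto simp: orbit_def)
    have "dim_ge polys (orbit G \<phi> (\<phi> g x)) (orbit_dim x0)"
      using f gx(1) g(2) by (intro dim_geI[of I _ f]) auto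
    then have "orbit_dim x0 \<le> orbit_dim x"
      using orbit_eq[OF g(3) gx(2)] dim_ge_orbit_dim[OF g(3)] by simp
    then show ?thesis using x0 g(3) unfolding regular_locus_iff by (meson le_antisym)
  qed
  have FX: "F \<subseteq> X" by (auto simp: F_def)
  have FY: "F \<subseteq> Y"
  proof
    fix x assume "x \<in> F"
    then have "x \<in> regular_locus G \<phi> X"
      using F_dim x0 FX unfolding regular_locus_iff by auto
    then show "x \<in> Y" using Y(1) by blast
  qed
  have irrF: "irr polys F"
    unfolding irr_def
  proof (intro conjI ballI impI)
    show "F \<noteq> {}" using x1 by blast
    fix p q assume pq: "p \<in> polys" "q \<in> polys" "vanishes F (\<lambda>x. p x * q x)"
    have "vanishes X (\<lambda>x. (p x * q x) * h x)"
      using pq(3) hF by (auto simp: vanishes_def)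
    then have "vanishes X (\<lambda>x. p x * q x)"
      using irr_mult[OF irreducible poly_functions.mult[OF pq(1,2)] h(1) _ h(2)] by blast
    then have "vanishes X p \<or> vanishes X q" using irr_mult[OF irreducible pq(1,2)] by blast
    then show "vanishes F p \<or> vanishes F q" using FX by (auto simp: vanishes_def)
  qed
  have "\<forall>g. \<exists>q. g \<in> carrier G \<longrightarrow> q \<in> polys \<and> (\<forall>x\<in>X. q x = h (\<phi> g x))"
  proof
    fix g
    show "\<exists>q. g \<in> carrier G \<longrightarrow> q \<in> polys \<and> (\<forall>x\<in>X. q x = h (\<phi> g x))"
    proof (cases "g \<in> carrier G")
      case True
      from regular_map_pullback[OF regular_translation[OF this] h(1)]
      obtain q where "q \<in> polys" "\<forall>x\<in>X. q x = h (\<phi> g x)" .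
      then show ?thesis by (intro exI[of _ q]) simp
    qed simp
  qed
  from choice[OF this] obtain q
    where q: "\<forall>g. g \<in> carrier G \<longrightarrow> q g \<in> polys \<and> (\<forall>x\<in>X. q g x = h (\<phi> g x))" ..
  \<comment> \<open>The complement of \<open>F\<close> in \<open>X\<close> is cut out by all
    translates of \<open>h\<close>.\<close>
  define N where "N = zero_set UNIV (q ` carrier G)"
  have N: "closedin zariski N"
    unfolding N_def closedin_zariski(2) using q by (intro exI[of _ "q ` carrier G"]) auto
  have FN: "F = X - N" using q by (auto simp: F_def N_def zero_set_def)
  have "locally_closed_in (subtopology zariski Y) F"
    unfolding locally_closed_in_def
  proof (intro exI conjI)
    show "openin (subtopology zariski Y) ((UNIV - N) \<inter> Y)"
      using N unfolding closedin_def closedin_zariski(1) by (auto simp: openin_subtopology)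
    show "closedin (subtopology zariski Y) Y"
      using closedin_topspace[of "subtopology zariski Y"] by (simp add: closedin_zariski(1))
    show "F = (UNIV - N) \<inter> Y \<inter> Y" using FN FY Y(2) by blast
  qed
  moreover have "stable H \<phi> F"
    unfolding stable_def
  proof (intro ballI image_subsetI)
    fix k x assume k: "k \<in> carrier H" and x: "x \<in> F"
    have kG: "k \<in> carrier G" using k H_subset by blast
    obtain g where g: "g \<in> carrier G" "h (\<phi> g x) \<noteq> 0" "x \<in> X" using x by (auto simp: F_def)
    have "\<phi> (g \<otimes> inv k) (\<phi> k x) = \<phi> (g \<otimes> inv k \<otimes> k) x"
      using composition_rule[OF g(3), of "g \<otimes> inv k" k] g(1) kG by simp
    also have "g \<otimes> inv k \<otimes> k = g" using g(1) kG by (simp add: m_assoc)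
    finally have "h (\<phi> (g \<otimes> inv k) (\<phi> k x)) \<noteq> 0" using g(2) by simp
    moreover have "g \<otimes> inv k \<in> carrier G" using g(1) kG by simp
    moreover have "\<phi> k x \<in> X" using kG g(3) element_image by blast
    ultimately show "\<phi> k x \<in> F" unfolding F_def by blast
  qed
  moreover have "is_family H \<phi> F"
    unfolding is_family_def irreducible_in_zariski_iff
  proof (intro conjI exI ballI irrF)
    show "zariski_dim (orbit H \<phi> x) = enat (orbit_dim x0)" if "x \<in> F" for x
      using that F_dim FX zariski_dim_orbit_H orbit_dim by auto
  qed
  ultimately have fam: "F \<in> families H \<phi> Y" using FY by (simp add: families_def)
  have mod: "family_modality H \<phi> F = zariski_dim F - enat (orbit_dim x0)"
    using family_modality_eq[OF FX x1] F_dim by blast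
  have "enat n \<le> modality G \<phi> Y" if n: "enat n \<le> krull_dim (quotient_space G X \<phi>)" for n
  proof -
    obtain a :: "nat \<Rightarrow> 'k ^ 'n \<Rightarrow> 'k" where "\<forall>i<n. a i \<in> polys"
      "\<forall>i<n. \<forall>g\<in>carrier G. \<forall>x\<in>X. a i (\<phi> g x) = a i x" "indep a {..<n} X"
      using quotient_dim_independent[OF n] .
    then have "dim_ge polys X (n + orbit_dim x0)"
      using dim_ge_invariants_plus_orbits[OF _ _ _ h f(1,3,4)] f(2) by metis
    from zariski_dim_ge_if_open_piece[OF closed irreducible h hF this]
    have "enat n \<le> family_modality H \<phi> F"
      unfolding mod by (rule le_enat_diffI)
    then show ?thesis unfolding modality_def using fam by (rule SUP_upper2[rotated])
  qed
  \<comment> \<open>With \<open>d = 0\<close> the bounds for all finite \<open>n\<close> combine to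
    an inequality that also covers an infinite dimension.\<close>
  then show ?thesis
    using enat_diff_leI[of "krull_dim (quotient_space G X \<phi>)" 0 "modality G \<phi> Y"] by (simp add: zero_enat_def[symmetric])
qed

text \<open>A family in \<open>Y\<close> contains a nonempty open piece of its closure.\<close>

lemma modality_le_quotient_dim:
  assumes visible: "visible G X \<phi>" and YX: "Y \<subseteq> X"
    and piece: "\<And>V x. closedin zariski V \<Longrightarrow> irr polys V \<Longrightarrow> V \<subseteq> X \<Longrightarrow> x \<in> V \<Longrightarrow> x \<in> Y \<Longrightarrow>
      \<exists>h\<in>polys. \<not> vanishes V h \<and> {y \<in> V. h y \<noteq> 0} \<subseteq> Y"
  shows "modality G \<phi> Y \<le> krull_dim (quotient_space G X \<phi>)"
  unfolding modality_def
proof (rule SUP_least)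
  fix F assume "F \<in> families H \<phi> Y"
  then have F: "F \<subseteq> Y" "locally_closed_in (subtopology zariski Y) F" "irr polys F"
    "\<exists>d. \<forall>x\<in>F. zariski_dim (orbit H \<phi> x) = d"
    by (simp_all add: families_def is_family_def irreducible_in_zariski_iff)
  obtain x where x: "x \<in> F" using F(3) by (auto simp: irr_def)
  have FX: "F \<subseteq> X" using F(1) YX by blast
  have d: "\<forall>y\<in>F. orbit_dim y = orbit_dim x"
  proof
    fix y assume y: "y \<in> F"
    have "zariski_dim (orbit H \<phi> y) = zariski_dim (orbit H \<phi> x)" using F(4) x y by metis
    then have "enat (orbit_dim y) = enat (orbit_dim x)"
      using zariski_dim_orbit_H orbit_dim x y FX by (metis subsetD)
    then show "orbit_dim y = orbit_dim x" by simp
  qed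
  obtain U C where UC: "openin (subtopology zariski Y) U" "closedin (subtopology zariski Y) C" "F = U \<inter> C"
    using F(2) unfolding locally_closed_in_def by (elim exE conjE)
  obtain U' where U': "openin zariski U'" "U = U' \<inter> Y" using UC(1) unfolding openin_subtopology by blast
  obtain C' where C': "closedin zariski C'" "C = C' \<inter> Y" using UC(2) unfolding closedin_subtopology by blast
  have "closedin zariski (UNIV - U')" using U'(1) openin_closedin_eq[of zariski U'] by (simp add: closedin_zariski(1))
  then obtain S where S: "S \<subseteq> polys" "UNIV - U' = zero_set UNIV S"
    unfolding closedin_zariski(2) by (elim exE conjE)
  define V where "V = zariski closure_of F"
  have FV: "F \<subseteq> V" unfolding V_def by (rule closure_of_subset) (simp add: closedin_zariski(1))
  have FC: "F \<subseteq> C'" using UC(3) C'(2) by blast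
  have V: "closedin zariski V" "V \<subseteq> X" "V \<subseteq> C'"
    unfolding V_def
    by (rule closedin_closure_of closure_of_minimal[OF FX closed] closure_of_minimal[OF FC C'(1)])+
  have vanV: "vanishes V p" if p: "p \<in> polys" "vanishes F p" for p
  proof -
    have "V \<subseteq> {x. p x = 0}"
      unfolding V_def by (rule closure_of_minimal[OF _ closedin_zariski_zeros[OF p(1)]])
        (use p(2) in \<open>auto simp: vanishes_def\<close>)
    then show ?thesis by (auto simp: vanishes_def)
  qed
  have irrV: "irr polys V"
    unfolding irr_def
  proof (intro conjI ballI impI)
    show "V \<noteq> {}" using FV x by blast
    fix p q assume pq: "p \<in> polys" "q \<in> polys" "vanishes V (\<lambda>x. p x * q x)"
    then have "vanishes F (\<lambda>x. p x * q x)" using FV by (auto simp: vanishes_def)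
    then have "vanishes F p \<or> vanishes F q" using irr_mult[OF F(3) pq(1,2)] by blast
    then show "vanishes V p \<or> vanishes V q" using vanV pq(1,2) by blast
  qed
  have "x \<notin> zero_set UNIV S" using x UC(3) U'(2) S(2) by blast
  then obtain s where s: "s \<in> S" "s x \<noteq> 0" by (auto simp: zero_set_def)
  have xV: "x \<in> V" "x \<in> Y" using FV x F(1) by blast+
  obtain h where h: "h \<in> polys" "\<not> vanishes V h" "{y \<in> V. h y \<noteq> 0} \<subseteq> Y"
    using piece[OF V(1) irrV V(2) xV] by blast
  have sp: "s \<in> polys" using s(1) S(1) by blast
  have sV: "\<not> vanishes V s" using s(2) xV(1) by (auto simp: vanishes_def)
  \<comment> \<open>The factor \<open>s\<close> keeps the piece inside the open set
    \<open>U'\<close> and \<open>h\<close> keeps it inside \<open>Y\<close>; the closed set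
    \<open>C'\<close> contains all of \<open>V\<close>.\<close>
  have sub: "{y \<in> V. s y * h y \<noteq> 0} \<subseteq> F"
  proof
    fix y assume y: "y \<in> {y \<in> V. s y * h y \<noteq> 0}"
    then have "y \<in> Y" "y \<in> C'" "y \<notin> zero_set UNIV S" using h(3) V(3) s(1) by (auto simp: zero_set_def)
    then show "y \<in> F" using S(2) UC(3) U'(2) C'(2) by blast
  qed
  have "zariski_dim F - enat (orbit_dim x) \<le> krull_dim (quotient_space G X \<phi>)"
    by (rule family_dim_le_quotient_dim[OF visible V(1) irrV V(2) poly_functions.mult[OF sp h(1)]
          irr_mult[OF irrV sp h(1) sV h(2)] sub FV]) (use d in blast)
  then show "family_modality H \<phi> F \<le> krull_dim (quotient_space G X \<phi>)"
    using family_modality_eq[OF FX x d] by simp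
qed

lemma modality_eq_quotient_dim:
  assumes "visible G X \<phi>"
  shows "modality G \<phi> X = krull_dim (quotient_space G X \<phi>)"
proof (rule antisym)
  have "\<exists>h\<in>polys. \<not> vanishes V h \<and> {y \<in> V. h y \<noteq> 0} \<subseteq> X" if "V \<subseteq> X" "irr polys V" for V
    using that irr_nontrivial[OF that(2), of "1 :: 'k"] by (intro bexI[of _ "\<lambda>_. 1"]) (auto intro: poly_functions.const)
  then show "modality G \<phi> X \<le> krull_dim (quotient_space G X \<phi>)"
    by (intro modality_le_quotient_dim[OF assms]) auto
qed (rule quotient_dim_le_modality; auto simp: regular_locus_def)

lemma modality_regular_locus_eq_quotient_dim:
  assumes "visible G X \<phi>"
  shows "modality G \<phi> (regular_locus G \<phi> X) = krull_dim (quotient_space G X \<phi>)"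
proof (rule antisym)
  have sub: "regular_locus G \<phi> X \<subseteq> X" by (auto simp: regular_locus_def)
  show "modality G \<phi> (regular_locus G \<phi> X) \<le> krull_dim (quotient_space G X \<phi>)"
  proof (rule modality_le_quotient_dim[OF assms sub])
    fix V x assume "closedin zariski V" "irr polys V" "V \<subseteq> X" "x \<in> V" "x \<in> regular_locus G \<phi> X"
    from regular_locus_open_piece[OF this] obtain h
      where "h \<in> polys" "\<not> vanishes V h" "{y \<in> V. h y \<noteq> 0} \<subseteq> regular_locus G \<phi> X" .
    then show "\<exists>h\<in>polys. \<not> vanishes V h \<and> {y \<in> V. h y \<noteq> 0} \<subseteq> regular_locus G \<phi> X"
      by (intro bexI[of _ h] conjI)
  qed
  show "krull_dim (quotient_space G X \<phi>) \<le> modality G \<phi> (regular_locus G \<phi> X)"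
    by (rule quotient_dim_le_modality[OF order_refl sub])
qed

section \<open>Closed stable subsets\<close>

lemma visible_closed_subset:
  assumes visible: "visible G X \<phi>" and Z: "Z \<subseteq> X" "stable G \<phi> Z"
  shows "visible G Z (induced_action \<phi> Z)"
  unfolding visible_def
proof
  fix y
  let ?\<psi> = "induced_action \<phi> Z"
  let ?fib = "{x \<in> Z. quotient_map_to G Z ?\<psi> x = y}"
  \<comment> \<open>A point of the quotient of \<open>Z\<close> that is not an image has an empty
    fibre; otherwise a point \<open>z\<close> of the fibre selects the fibre of the quotient map of
    \<open>X\<close>.\<close>
  show "finite (orbits G ?fib ?\<psi>)"
  proof (cases "?fib = {}")
    case True
    show ?thesis unfolding True by (simp add: orbits_def)
  next
    case False
    then obtain z where z: "z \<in> Z" "quotient_map_to G Z ?\<psi> z = y" by blast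
    let ?fib' = "{x \<in> X. \<pi> x = \<pi> z}"
    have "\<pi> x = \<pi> z" if x: "x \<in> ?fib" for x
      unfolding quotient_map_to_def
    proof (rule restrict_ext)
      fix f assume f: "f \<in> invariant_ring G X \<phi>"
      obtain p where p: "p \<in> polys" "f = restrict p X" using f by (rule invariant_ring_poly)
      have "restrict p Z \<in> invariant_ring G Z ?\<psi>"
        unfolding invariant_ring_def coord_ring_def
      proof (intro CollectI conjI ballI)
        show "\<exists>q. restrict p Z = restrict q Z \<and> q \<in> polys" using p(1) by blast
        fix g x assume g: "g \<in> carrier G" and x: "x \<in> Z"
        have "\<phi> g x \<in> Z" using Z(2) g x unfolding stable_def by blast
        moreover have "f (\<phi> g x) = f x" using f g x Z(1) unfolding invariant_ring_def by blast
        ultimately show "restrict p Z (?\<psi> g x) = restrict p Z x"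
          using x subsetD[OF Z(1)] p(2) by (simp add: induced_action_def)
      qed
      moreover have "quotient_map_to G Z ?\<psi> x = quotient_map_to G Z ?\<psi> z" using x z by simp
      ultimately have "restrict p Z x = restrict p Z z"
        unfolding quotient_map_to_def by (metis (no_types, lifting) restrict_apply')
      then show "f x = f z" using x z(1) subsetD[OF Z(1)] p(2) by simp
    qed
    then have sub: "?fib \<subseteq> ?fib'" using Z(1) by blast
    have "z \<in> X" using z(1) Z(1) by blast
    then have "\<pi> z \<in> topspace (quotient_space G X \<phi>)"
      using quotient_space(3)[OF action] by (auto simp: Pi_iff)
    then have "finite (orbits G ?fib' \<phi>)" using visible unfolding visible_def by blast
    moreover have "orbits G ?fib ?\<psi> \<subseteq> orbits G ?fib' \<phi>"
    proof
      fix orb assume "orb \<in> orbits G ?fib ?\<psi>"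
      then obtain x where x: "x \<in> ?fib" "orb = orbit G ?\<psi> x" unfolding orbits_def by blast
      have "orbit G ?\<psi> x = orbit G \<phi> x" using x(1) by (auto simp: orbit_def induced_action_def)
      then show "orb \<in> orbits G ?fib' \<phi>" using x sub unfolding orbits_def by blast
    qed
    ultimately show ?thesis by (rule finite_subset[rotated])
  qed
qed

end

theorem theorem2p10:
  fixes G :: "('k::{alg_closed_field, field_char_0} ^ 'm) monoid"
    and X :: "('k ^ 'n) set"
    and \<phi> :: "'k ^ 'm \<Rightarrow> 'k ^ 'n \<Rightarrow> 'k ^ 'n"
  assumes "reductive_group G"
    and "closedin zariski X" and "irreducible_in zariski X"
    and "algebraic_action G X \<phi>"
    and "visible G X \<phi>"
  shows "modality_regular G \<phi> X \<and>
    modality G \<phi> X = krull_dim (quotient_space G X \<phi>) \<and>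
    (\<forall>Z. closedin zariski Z \<and> Z \<subseteq> X \<and> stable G \<phi> Z \<longrightarrow> visible G Z (induced_action \<phi> Z))"
proof -
  interpret irreducible_affine_action G X \<phi>
    using assms(1-4) by unfold_locales (simp_all add: reductive_group_def irreducible_in_zariski_iff)
  show ?thesis
    using modality_eq_quotient_dim[OF assms(5)] modality_regular_locus_eq_quotient_dim[OF assms(5)]
      visible_closed_subset[OF assms(5)] by (simp add: modality_regular_def)
qed

end
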